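(* Let $d$ be a positive integer and let $(X,\varphi,\mathbb{Z}^d)$ and $(Z,\psi,\mathbb{Z}^d)$ be two free minimal Cantor systems. The following are equivalent: (1) There exists a bounded orbit injection $\theta: X\to Z$ from $(X,\varphi,\mathbb{Z}^d)$ to $(Z,\psi,\mathbb{Z}^d)$. (2) There exists a $*$-monomorphism $\alpha: C(X)\rtimes_\varphi\mathbb{Z}^d\to C(Z)\rtimes_\psi\mathbb{Z}^d$ such that $\alpha(C(X))\subseteq C(Z)$ and, letting $p=\alpha(1)$, the range of $\alpha$ is $p\,(C(Z)\rtimes_\psi\mathbb{Z}^d)\,p$.
   Context: A dynamical system $(X,\varphi,\mathbb{Z}^d)$ is a compact space $X$ with an action $\varphi$ of $\mathbb{Z}^d$ by homeomorphisms $\varphi^z$ ($z\in\mathbb{Z}^d$). It is a Cantor system if $X$ is a Cantor set, free if the action is free, and minimal if every orbit is dense. Orbit injection: for free dynamical systems $(X,\varphi,\mathbb{Z}^d)$ and $(Y,\psi,\mathbb{Z}^d)$, a map $\theta:X\to Y$ is an orbit injection if it is a continuous open injection such that for all $x,y\in X$: there is $w\in\mathbb{Z}^d$ with $\varphi^w(x)=y$ if and only if there is $v\in\mathbb{Z}^d$ with $\psi^v(\theta(x))=\theta(y)$. Its cocycle is the (unique) function $\eta:X\times\mathbb{Z}^d\to\mathbb{Z}^d$ with $\psi^{\eta(x,w)}(\theta(x))=\theta(\varphi^w(x))$. The orbit injection $\theta$ is bounded if $\eta$ is continuous. Crossed product: $C(X)\rtimes_\varphi\mathbb{Z}^d$ is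 the universal C*-algebra generated by a copy of $C(X)$ and unitaries $U_\varphi^z$ ($z\in\mathbb{Z}^d$) subject to $U_\varphi^z f (U_\varphi^{z})^*=f\circ\varphi^{-z}$, $U_\varphi^zU_\varphi^{z'}=U_\varphi^{z+z'}$, $U_\varphi^0=1$ for all $f\in C(X)$ and $z,z'\in\mathbb{Z}^d$. $C(X)$ is regarded as a subalgebra of $C(X)\rtimes_\varphi\mathbb{Z}^d$. *)

theory Defs
  imports "HOL-Analysis.Analysis" "HOL-Algebra.FiniteProduct"
begin

section \<open>Dynamical systems\<close>

definition dynamical_system :: "(int ^ 'd \<Rightarrow> 'x::topological_space \<Rightarrow> 'x) \<Rightarrow> bool" where
  "dynamical_system \<phi> \<longleftrightarrow>
     compact (UNIV :: 'x set) \<and>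
     (\<forall>z. \<exists>g. homeomorphism UNIV UNIV (\<phi> z) g) \<and>
     \<phi> 0 = id \<and> (\<forall>z w. \<phi> (z + w) = \<phi> z \<circ> \<phi> w)"

text \<open>The type \<^typ>\<open>nat \<Rightarrow> bool\<close> carries the product of the discrete topologies,
  so it is the standard Cantor set.\<close>

definition cantor_system :: "(int ^ 'd \<Rightarrow> 'x::topological_space \<Rightarrow> 'x) \<Rightarrow> bool" where
  "cantor_system \<phi> \<longleftrightarrow>
     dynamical_system \<phi> \<and>
     (UNIV :: 'x set) homeomorphic (UNIV :: (nat \<Rightarrow> bool) set)"

definition free_system :: "(int ^ 'd \<Rightarrow> 'x \<Rightarrow> 'x) \<Rightarrow> bool" where
  "free_system \<phi> \<longleftrightarrow> (\<forall>z x. \<phi> z x = x \<longrightarrow> z = 0)"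

definition minimal_system :: "(int ^ 'd \<Rightarrow> 'x::topological_space \<Rightarrow> 'x) \<Rightarrow> bool" where
  "minimal_system \<phi> \<longleftrightarrow> (\<forall>x. closure (range (\<lambda>z. \<phi> z x)) = UNIV)"

definition orbit_injection ::
  "(int ^ 'd \<Rightarrow> 'x::topological_space \<Rightarrow> 'x) \<Rightarrow> (int ^ 'd \<Rightarrow> 'y::topological_space \<Rightarrow> 'y)
    \<Rightarrow> ('x \<Rightarrow> 'y) \<Rightarrow> bool" where
  "orbit_injection \<phi> \<psi> \<theta> \<longleftrightarrow>
     continuous_on UNIV \<theta> \<and> (\<forall>U. open U \<longrightarrow> open (\<theta> ` U)) \<and> inj \<theta> \<and>
     (\<forall>x y. (\<exists>w. \<phi> w x = y) \<longleftrightarrow> (\<exists>v. \<psi> v (\<theta> x) = \<theta> y))"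

definition cocycle ::
  "(int ^ 'd \<Rightarrow> 'x \<Rightarrow> 'x) \<Rightarrow> (int ^ 'd \<Rightarrow> 'y \<Rightarrow> 'y) \<Rightarrow> ('x \<Rightarrow> 'y) \<Rightarrow> 'x \<times> (int ^ 'd) \<Rightarrow> int ^ 'd" where
  "cocycle \<phi> \<psi> \<theta> = (\<lambda>(x, w). THE v. \<psi> v (\<theta> x) = \<theta> (\<phi> w x))"

definition bounded_orbit_injection ::
  "(int ^ 'd \<Rightarrow> 'x::topological_space \<Rightarrow> 'x) \<Rightarrow> (int ^ 'd \<Rightarrow> 'y::topological_space \<Rightarrow> 'y)
    \<Rightarrow> ('x \<Rightarrow> 'y) \<Rightarrow> bool" where
  "bounded_orbit_injection \<phi> \<psi> \<theta> \<longleftrightarrow>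
     orbit_injection \<phi> \<psi> \<theta> \<and> continuous_on UNIV (cocycle \<phi> \<psi> \<theta>)"


section \<open>Star-algebras and C*-algebras\<close>

record 'a star_algebra =
  carr :: "'a set"
  zer :: 'a
  unt :: 'a
  add :: "'a \<Rightarrow> 'a \<Rightarrow> 'a"
  smul :: "complex \<Rightarrow> 'a \<Rightarrow> 'a"
  mul :: "'a \<Rightarrow> 'a \<Rightarrow> 'a"
  adj :: "'a \<Rightarrow> 'a"

record 'a cstar_algebra = "'a star_algebra" +
  nrm :: "'a \<Rightarrow> real"

abbreviation sub :: "('a, 'm) star_algebra_scheme \<Rightarrow> 'a \<Rightarrow> 'a \<Rightarrow> 'a" where
  "sub A x y \<equiv> add A x (smul A (-1) y)"

locale star_algebra =
  fixes A :: "('a, 'm) star_algebra_scheme"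
  assumes zer_closed [simp]: "zer A \<in> carr A"
    and unt_closed [simp]: "unt A \<in> carr A"
    and add_closed [simp]: "\<lbrakk>x \<in> carr A; y \<in> carr A\<rbrakk> \<Longrightarrow> add A x y \<in> carr A"
    and smul_closed [simp]: "x \<in> carr A \<Longrightarrow> smul A c x \<in> carr A"
    and mul_closed [simp]: "\<lbrakk>x \<in> carr A; y \<in> carr A\<rbrakk> \<Longrightarrow> mul A x y \<in> carr A"
    and adj_closed [simp]: "x \<in> carr A \<Longrightarrow> adj A x \<in> carr A"
    and add_assoc: "\<lbrakk>x \<in> carr A; y \<in> carr A; z \<in> carr A\<rbrakk> \<Longrightarrow> add A (add A x y) z = add A x (add A y z)"
    and add_comm: "\<lbrakk>x \<in> carr A; y \<in> carr A\<rbrakk> \<Longrightarrow> add A x y = add A y x"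
    and add_zer [simp]: "x \<in> carr A \<Longrightarrow> add A x (zer A) = x"
    and sub_self [simp]: "x \<in> carr A \<Longrightarrow> sub A x x = zer A"
    and smul_add: "\<lbrakk>x \<in> carr A; y \<in> carr A\<rbrakk> \<Longrightarrow> smul A c (add A x y) = add A (smul A c x) (smul A c y)"
    and add_smul: "x \<in> carr A \<Longrightarrow> smul A (c + d) x = add A (smul A c x) (smul A d x)"
    and smul_smul [simp]: "x \<in> carr A \<Longrightarrow> smul A c (smul A d x) = smul A (c * d) x"
    and smul_one [simp]: "x \<in> carr A \<Longrightarrow> smul A 1 x = x"
    and mul_assoc: "\<lbrakk>x \<in> carr A; y \<in> carr A; z \<in> carr A\<rbrakk> \<Longrightarrow> mul A (mul A x y) z = mul A x (mul A y z)"
    and unt_mul [simp]: "x \<in> carr A \<Longrightarrow> mul A (unt A) x = x"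
    and mul_unt [simp]: "x \<in> carr A \<Longrightarrow> mul A x (unt A) = x"
    and mul_add: "\<lbrakk>x \<in> carr A; y \<in> carr A; z \<in> carr A\<rbrakk> \<Longrightarrow> mul A x (add A y z) = add A (mul A x y) (mul A x z)"
    and add_mul: "\<lbrakk>x \<in> carr A; y \<in> carr A; z \<in> carr A\<rbrakk> \<Longrightarrow> mul A (add A x y) z = add A (mul A x z) (mul A y z)"
    and smul_mul: "\<lbrakk>x \<in> carr A; y \<in> carr A\<rbrakk> \<Longrightarrow> mul A (smul A c x) y = smul A c (mul A x y)"
    and mul_smul: "\<lbrakk>x \<in> carr A; y \<in> carr A\<rbrakk> \<Longrightarrow> mul A x (smul A c y) = smul A c (mul A x y)"
    and adj_adj [simp]: "x \<in> carr A \<Longrightarrow> adj A (adj A x) = x"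
    and adj_add: "\<lbrakk>x \<in> carr A; y \<in> carr A\<rbrakk> \<Longrightarrow> adj A (add A x y) = add A (adj A x) (adj A y)"
    and adj_smul: "x \<in> carr A \<Longrightarrow> adj A (smul A c x) = smul A (cnj c) (adj A x)"
    and adj_mul: "\<lbrakk>x \<in> carr A; y \<in> carr A\<rbrakk> \<Longrightarrow> adj A (mul A x y) = mul A (adj A y) (adj A x)"

definition cstar_seminorm :: "('a, 'm) star_algebra_scheme \<Rightarrow> ('a \<Rightarrow> real) \<Rightarrow> bool" where
  "cstar_seminorm A q \<longleftrightarrow>
     (\<forall>x\<in>carr A. 0 \<le> q x) \<and>
     (\<forall>x\<in>carr A. \<forall>y\<in>carr A. q (add A x y) \<le> q x + q y) \<and>
     (\<forall>c. \<forall>x\<in>carr A. q (smul A c x) = norm c * q x) \<and>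
     (\<forall>x\<in>carr A. \<forall>y\<in>carr A. q (mul A x y) \<le> q x * q y) \<and>
     (\<forall>x\<in>carr A. q (mul A (adj A x) x) = (q x)\<^sup>2)"

definition cauchy_seq :: "('a, 'm) star_algebra_scheme \<Rightarrow> ('a \<Rightarrow> real) \<Rightarrow> (nat \<Rightarrow> 'a) \<Rightarrow> bool" where
  "cauchy_seq A q s \<longleftrightarrow>
     (\<forall>n. s n \<in> carr A) \<and> (\<forall>e>0. \<exists>N. \<forall>m\<ge>N. \<forall>n\<ge>N. q (sub A (s m) (s n)) < e)"

locale cstar_algebra = star_algebra A for A :: "('a, 'm) cstar_algebra_scheme" +
  assumes cstar_norm: "cstar_seminorm A (nrm A)"
    and nrm_zero: "\<lbrakk>x \<in> carr A; nrm A x = 0\<rbrakk> \<Longrightarrow> x = zer A"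
    and complete: "cauchy_seq A (nrm A) s
           \<Longrightarrow> \<exists>x\<in>carr A. (\<lambda>n. nrm A (sub A (s n) x)) \<longlonglongrightarrow> 0"

definition star_hom ::
  "('a, 'm) star_algebra_scheme \<Rightarrow> ('b, 'n) star_algebra_scheme \<Rightarrow> ('a \<Rightarrow> 'b) \<Rightarrow> bool" where
  "star_hom A B \<alpha> \<longleftrightarrow>
     (\<forall>x\<in>carr A. \<alpha> x \<in> carr B) \<and>
     (\<forall>x\<in>carr A. \<forall>y\<in>carr A. \<alpha> (add A x y) = add B (\<alpha> x) (\<alpha> y)) \<and>
     (\<forall>c. \<forall>x\<in>carr A. \<alpha> (smul A c x) = smul B c (\<alpha> x)) \<and>
     (\<forall>x\<in>carr A. \<forall>y\<in>carr A. \<alpha> (mul A x y) = mul B (\<alpha> x) (\<alpha> y)) \<and>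
     (\<forall>x\<in>carr A. \<alpha> (adj A x) = adj B (\<alpha> x))"

definition star_monomorphism ::
  "('a, 'm) star_algebra_scheme \<Rightarrow> ('b, 'n) star_algebra_scheme \<Rightarrow> ('a \<Rightarrow> 'b) \<Rightarrow> bool" where
  "star_monomorphism A B \<alpha> \<longleftrightarrow> star_hom A B \<alpha> \<and> inj_on \<alpha> (carr A)"


section \<open>The enveloping C*-algebra\<close>

text \<open>The Hausdorff completion with respect to a seminorm: an element is the class of all Cauchy
  sequences at distance zero from a given one, and the operations act on representatives.
  The lemmas \<open>add_C\<close>, \<open>mul_C\<close>, \<open>smul_C\<close>, \<open>adj_C\<close> and \<open>nrm_C_lim\<close> below show that the choice of
  representatives does not matter.\<close>

definition cls :: "('a, 'm) star_algebra_scheme \<Rightarrow> ('a \<Rightarrow> real) \<Rightarrow> (nat \<Rightarrow> 'a) \<Rightarrow> (nat \<Rightarrow> 'a) set" where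
  "cls A q s = {t. cauchy_seq A q t \<and> (\<lambda>n. q (sub A (s n) (t n))) \<longlonglongrightarrow> 0}"

definition rep :: "(nat \<Rightarrow> 'a) set \<Rightarrow> nat \<Rightarrow> 'a" where
  "rep S = (SOME s. s \<in> S)"

definition completion ::
  "('a, 'm) star_algebra_scheme \<Rightarrow> ('a \<Rightarrow> real) \<Rightarrow> (nat \<Rightarrow> 'a) set cstar_algebra" where
  "completion A q =
     \<lparr>carr = {cls A q s | s. cauchy_seq A q s},
      zer = cls A q (\<lambda>n. zer A),
      unt = cls A q (\<lambda>n. unt A),
      add = (\<lambda>S T. cls A q (\<lambda>n. add A (rep S n) (rep T n))),
      smul = (\<lambda>c S. cls A q (\<lambda>n. smul A c (rep S n))),
      mul = (\<lambda>S T. cls A q (\<lambda>n. mul A (rep S n) (rep T n))),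
      adj = (\<lambda>S. cls A q (\<lambda>n. adj A (rep S n))),
      nrm = (\<lambda>S. lim (\<lambda>n. q (rep S n)))\<rparr>"

text \<open>Every star-homomorphism \<open>\<pi>\<close> into a C*-algebra gives the C*-seminorm \<open>a \<mapsto> \<parallel>\<pi> a\<parallel>\<close>, and every
  C*-seminorm arises in this way (complete it). So the supremum below is the one over all
  star-homomorphisms into C*-algebras, without a quantification over types.\<close>

definition universal_seminorm :: "('a, 'm) star_algebra_scheme \<Rightarrow> 'a \<Rightarrow> real" where
  "universal_seminorm A a = (SUP q \<in> {q. cstar_seminorm A q}. q a)"

definition enveloping_cstar :: "('a, 'm) star_algebra_scheme \<Rightarrow> (nat \<Rightarrow> 'a) set cstar_algebra" where
  "enveloping_cstar A = completion A (universal_seminorm A)"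

definition envelope_embed :: "('a, 'm) star_algebra_scheme \<Rightarrow> 'a \<Rightarrow> (nat \<Rightarrow> 'a) set" where
  "envelope_embed A a = cls A (universal_seminorm A) (\<lambda>n. a)"


section \<open>The crossed product\<close>

text \<open>The star-algebra presented by \<open>C(X)\<close>, the unitaries \<open>U\<^sup>z\<close> and the covariance relations.
  By these relations its elements are the finite sums of \<open>a\<^sub>z U\<^sup>z\<close> with \<open>a\<^sub>z\<close> in \<open>C(X)\<close>; such a sum is
  represented by its coefficient function \<open>a\<close>. The product and the involution come from
  \<open>(f U\<^sup>w) (g U\<^sup>v) = f (g \<circ> \<phi> (-w)) U\<^sup>w\<^sup>+\<^sup>v\<close> and
  \<open>(f U\<^sup>w)* = (cnj f \<circ> \<phi> w) U\<^sup>-\<^sup>w\<close>.\<close>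

definition skew_group_algebra ::
  "(int ^ 'd \<Rightarrow> 'x::topological_space \<Rightarrow> 'x) \<Rightarrow> (int ^ 'd \<Rightarrow> 'x \<Rightarrow> complex) star_algebra" where
  "skew_group_algebra \<phi> =
     \<lparr>carr = {a. finite {z. a z \<noteq> (\<lambda>x. 0)} \<and> (\<forall>z. continuous_on UNIV (a z))},
      zer = (\<lambda>z x. 0),
      unt = (\<lambda>z x. if z = 0 then 1 else 0),
      add = (\<lambda>a b z x. a z x + b z x),
      smul = (\<lambda>c a z x. c * a z x),
      mul = (\<lambda>a b z x. \<Sum>w\<in>{w. a w \<noteq> (\<lambda>x. 0)}. a w x * b (z - w) (\<phi> (- w) x)),
      adj = (\<lambda>a z x. cnj (a (- z) (\<phi> (- z) x)))\<rparr>"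

definition single :: "int ^ 'd \<Rightarrow> ('x \<Rightarrow> complex) \<Rightarrow> int ^ 'd \<Rightarrow> 'x \<Rightarrow> complex" where
  "single w f = (\<lambda>z x. if z = w then f x else 0)"

text \<open>The universal C*-algebra of covariant pairs; this is the content of the theorems
  \<open>crossed_product_cstar_algebra\<close>, \<open>crossed_product_covariant_pair\<close>, \<open>crossed_product_generated\<close>
  and \<open>crossed_product_universal\<close> below.\<close>

definition crossed_product ::
  "(int ^ 'd \<Rightarrow> 'x::topological_space \<Rightarrow> 'x)
    \<Rightarrow> (nat \<Rightarrow> int ^ 'd \<Rightarrow> 'x \<Rightarrow> complex) set cstar_algebra" where
  "crossed_product \<phi> = enveloping_cstar (skew_group_algebra \<phi>)"

definition function_elem ::
  "(int ^ 'd \<Rightarrow> 'x::topological_space \<Rightarrow> 'x) \<Rightarrow> ('x \<Rightarrow> complex)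
    \<Rightarrow> (nat \<Rightarrow> int ^ 'd \<Rightarrow> 'x \<Rightarrow> complex) set" where
  "function_elem \<phi> f =
     envelope_embed (skew_group_algebra \<phi>) (single 0 f)"

definition unitary_elem ::
  "(int ^ 'd \<Rightarrow> 'x::topological_space \<Rightarrow> 'x) \<Rightarrow> int ^ 'd
    \<Rightarrow> (nat \<Rightarrow> int ^ 'd \<Rightarrow> 'x \<Rightarrow> complex) set" where
  "unitary_elem \<phi> w =
     envelope_embed (skew_group_algebra \<phi>) (single w (\<lambda>x. 1))"

definition function_algebra :: "('x::topological_space \<Rightarrow> complex) star_algebra" where
  "function_algebra =
     \<lparr>carr = {f. continuous_on UNIV f}, zer = (\<lambda>x. 0), unt = (\<lambda>x. 1),
      add = (\<lambda>f g x. f x + g x), smul = (\<lambda>c f x. c * f x),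
      mul = (\<lambda>f g x. f x * g x), adj = (\<lambda>f x. cnj (f x))\<rparr>"

definition covariant_pair ::
  "(int ^ 'd \<Rightarrow> 'x::topological_space \<Rightarrow> 'x) \<Rightarrow> ('b, 'n) star_algebra_scheme
    \<Rightarrow> (('x \<Rightarrow> complex) \<Rightarrow> 'b) \<Rightarrow> (int ^ 'd \<Rightarrow> 'b) \<Rightarrow> bool" where
  "covariant_pair \<phi> B \<pi> V \<longleftrightarrow>
     star_hom function_algebra B \<pi> \<and> \<pi> (\<lambda>x. 1) = unt B \<and>
     (\<forall>z. V z \<in> carr B \<and> mul B (V z) (adj B (V z)) = unt B \<and> mul B (adj B (V z)) (V z) = unt B) \<and>
     (\<forall>z f. continuous_on UNIV f \<longrightarrow> mul B (mul B (V z) (\<pi> f)) (adj B (V z)) = \<pi> (f \<circ> \<phi> (- z))) \<and>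
     (\<forall>z w. mul B (V z) (V w) = V (z + w)) \<and> V 0 = unt B"

definition function_subalgebra ::
  "(int ^ 'd \<Rightarrow> 'x::topological_space \<Rightarrow> 'x)
    \<Rightarrow> (nat \<Rightarrow> int ^ 'd \<Rightarrow> 'x \<Rightarrow> complex) set set" where
  "function_subalgebra \<phi> = {function_elem \<phi> f | f. continuous_on UNIV f}"


section \<open>The completion is a C*-algebra\<close>

context star_algebra begin

lemma add_left_comm: "\<lbrakk>x \<in> carr A; y \<in> carr A; z \<in> carr A\<rbrakk> \<Longrightarrow> add A x (add A y z) = add A y (add A x z)"
  by (metis add_assoc add_comm)

lemma zer_add [simp]: "x \<in> carr A \<Longrightarrow> add A (zer A) x = x"
  by (metis add_comm add_zer zer_closed)

lemma smul_zero [simp]: "x \<in> carr A \<Longrightarrow> smul A 0 x = zer A"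
  using add_smul[of x 1 "-1"] sub_self[of x] smul_one[of x] by simp

lemma sub_swap: "\<lbrakk>x \<in> carr A; y \<in> carr A\<rbrakk> \<Longrightarrow> smul A (-1) (sub A x y) = sub A y x"
  by (simp add: smul_add add_comm)

lemma add_cancel_neg: "\<lbrakk>x \<in> carr A; y \<in> carr A\<rbrakk> \<Longrightarrow> add A x (sub A y x) = y"
  by (subst add_left_comm) simp_all

lemma sub_trans: "\<lbrakk>x \<in> carr A; y \<in> carr A; z \<in> carr A\<rbrakk> \<Longrightarrow> add A (sub A x y) (sub A y z) = sub A x z"
proof -
  assume a: "x \<in> carr A" "y \<in> carr A" "z \<in> carr A"
  have "add A (sub A x y) (sub A y z) = add A x (add A (smul A (-1) z) (sub A y y))"
    using a by (simp add: add_assoc add_comm add_left_comm del: sub_self)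
  then show ?thesis using a by simp
qed

lemma sub_add: "\<lbrakk>x \<in> carr A; y \<in> carr A; x' \<in> carr A; y' \<in> carr A\<rbrakk> \<Longrightarrow>
   sub A (add A x y) (add A x' y') = add A (sub A x x') (sub A y y')"
  by (simp add: smul_add add_assoc add_comm add_left_comm)

lemma smul_sub: "\<lbrakk>x \<in> carr A; y \<in> carr A\<rbrakk> \<Longrightarrow> sub A (smul A c x) (smul A c y) = smul A c (sub A x y)"
  by (simp add: smul_add mult.commute)

lemma sub_mul: "\<lbrakk>x \<in> carr A; y \<in> carr A; x' \<in> carr A; y' \<in> carr A\<rbrakk> \<Longrightarrow>
   sub A (mul A x y) (mul A x' y') = add A (mul A (sub A x x') y) (mul A x' (sub A y y'))"
  using sub_trans[of "mul A x y" "mul A x' y" "mul A x' y'"]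
  by (simp add: mul_add add_mul smul_mul mul_smul)

lemma adj_sub: "\<lbrakk>x \<in> carr A; y \<in> carr A\<rbrakk> \<Longrightarrow> sub A (adj A x) (adj A y) = adj A (sub A x y)"
  by (simp add: adj_add adj_smul)

lemma adj_unt [simp]: "adj A (unt A) = unt A"
  by (metis adj_adj adj_closed adj_mul mul_unt unt_closed unt_mul)

lemma eq_if_sub_zero: "\<lbrakk>x \<in> carr A; y \<in> carr A; sub A x y = zer A\<rbrakk> \<Longrightarrow> x = y"
  by (metis add_cancel_neg sub_swap add_zer smul_closed sub_self add_closed smul_zero smul_smul mult_zero_right)

end

locale seminormed_star_algebra = star_algebra A for A :: "('a, 'm) star_algebra_scheme" +
  fixes q :: "'a \<Rightarrow> real"
  assumes cstar_q: "cstar_seminorm A q"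
begin

lemma q_nonneg [simp]: "x \<in> carr A \<Longrightarrow> 0 \<le> q x"
  and q_add: "\<lbrakk>x \<in> carr A; y \<in> carr A\<rbrakk> \<Longrightarrow> q (add A x y) \<le> q x + q y"
  and q_smul: "x \<in> carr A \<Longrightarrow> q (smul A c x) = norm c * q x"
  and q_mul: "\<lbrakk>x \<in> carr A; y \<in> carr A\<rbrakk> \<Longrightarrow> q (mul A x y) \<le> q x * q y"
  and q_cstar: "x \<in> carr A \<Longrightarrow> q (mul A (adj A x) x) = (q x)\<^sup>2"
  using cstar_q unfolding cstar_seminorm_def by auto

lemma q_zer [simp]: "q (zer A) = 0"
  using q_smul[of "zer A" 0] by simp

lemma q_sub_commute: "\<lbrakk>x \<in> carr A; y \<in> carr A\<rbrakk> \<Longrightarrow> q (sub A x y) = q (sub A y x)"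
  using q_smul[of "sub A y x" "-1"] sub_swap[of y x] by simp

lemma q_sub_triangle: "\<lbrakk>x \<in> carr A; y \<in> carr A; z \<in> carr A\<rbrakk> \<Longrightarrow> q (sub A x z) \<le> q (sub A x y) + q (sub A y z)"
  using q_add[of "sub A x y" "sub A y z"] sub_trans[of x y z] by simp

lemma q_adj [simp]: 
  assumes "x \<in> carr A" shows "q (adj A x) = q x"
proof -
  have *: "q y \<le> q (adj A y)" if y: "y \<in> carr A" for y
  proof (cases "q y = 0")
    case True then show ?thesis using y by simp
  next
    case False
    have "q y * q y \<le> q (adj A y) * q y"
      using q_mul[of "adj A y" y] q_cstar[OF y] y by (simp add: power2_eq_square)
    moreover have "q y > 0" using False q_nonneg[OF y] by linarith
    ultimately show ?thesis by simp
  qed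
  show ?thesis using *[OF assms] *[of "adj A x"] assms by simp
qed

lemma q_diff: "\<lbrakk>x \<in> carr A; y \<in> carr A\<rbrakk> \<Longrightarrow> \<bar>q x - q y\<bar> \<le> q (sub A x y)"
  using q_add[of y "sub A x y"] q_add[of x "sub A y x"] add_cancel_neg[of x y] add_cancel_neg[of y x]
    q_sub_commute[of x y] by simp

lemma q_sub_add: "\<lbrakk>x \<in> carr A; y \<in> carr A; x' \<in> carr A; y' \<in> carr A\<rbrakk> \<Longrightarrow>
   q (sub A (add A x y) (add A x' y')) \<le> q (sub A x x') + q (sub A y y')"
  by (simp only: sub_add) (simp add: q_add)

lemma q_sub_smul: "\<lbrakk>x \<in> carr A; y \<in> carr A\<rbrakk> \<Longrightarrow> q (sub A (smul A c x) (smul A c y)) = norm c * q (sub A x y)"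
  by (simp only: smul_sub) (simp add: q_smul)

lemma q_sub_adj: "\<lbrakk>x \<in> carr A; y \<in> carr A\<rbrakk> \<Longrightarrow> q (sub A (adj A x) (adj A y)) = q (sub A x y)"
  by (simp only: adj_sub) simp

lemma q_sub_mul: "\<lbrakk>x \<in> carr A; y \<in> carr A; x' \<in> carr A; y' \<in> carr A\<rbrakk> \<Longrightarrow>
   q (sub A (mul A x y) (mul A x' y')) \<le> q (sub A x x') * q y + q x' * q (sub A y y')"
proof -
  assume a: "x \<in> carr A" "y \<in> carr A" "x' \<in> carr A" "y' \<in> carr A"
  show ?thesis unfolding sub_mul[OF a]
    using a q_add[of "mul A (sub A x x') y" "mul A x' (sub A y y')"] q_mul[of "sub A x x'" y] q_mul[of x' "sub A y y'"]
    by simp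
qed

abbreviation "cauchy \<equiv> cauchy_seq A q"

definition null :: "(nat \<Rightarrow> 'a) \<Rightarrow> (nat \<Rightarrow> 'a) \<Rightarrow> bool" where
  "null s t \<longleftrightarrow> (\<lambda>n. q (sub A (s n) (t n))) \<longlonglongrightarrow> 0"

lemma cauchyD: "cauchy s \<Longrightarrow> s n \<in> carr A"
  by (simp add: cauchy_seq_def)

lemma cauchy_const [simp]: "x \<in> carr A \<Longrightarrow> cauchy (\<lambda>n. x)"
  by (simp add: cauchy_seq_def)

lemma cauchy_q: assumes "cauchy s" shows "Cauchy (\<lambda>n. q (s n))"
proof (rule metric_CauchyI)
  fix e :: real assume "e > 0"
  then obtain N where N: "\<forall>m\<ge>N. \<forall>n\<ge>N. q (sub A (s m) (s n)) < e"
    using assms unfolding cauchy_seq_def by blast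
  have "dist (q (s m)) (q (s n)) < e" if "m \<ge> N" "n \<ge> N" for m n
    using N that q_diff[of "s m" "s n"] cauchyD[OF assms] unfolding dist_real_def
    by (meson le_less_trans)
  then show "\<exists>M. \<forall>m\<ge>M. \<forall>n\<ge>M. dist (q (s m)) (q (s n)) < e" by blast
qed

lemma q_convergent: "cauchy s \<Longrightarrow> convergent (\<lambda>n. q (s n))"
  using cauchy_q Cauchy_convergent by blast

lemma q_bounded: assumes "cauchy s" obtains K where "K > 0" "\<And>n. q (s n) \<le> K"
proof -
  have "Bseq (\<lambda>n. q (s n))" using q_convergent[OF assms] convergent_imp_Bseq by blast
  then obtain K where "K > 0" "\<forall>n. norm (q (s n)) \<le> K" unfolding Bseq_def by blast
  then show ?thesis using that by (metis abs_ge_self order_trans real_norm_def)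
qed

lemma cauchy_add: assumes s: "cauchy s" and t: "cauchy t" shows "cauchy (\<lambda>n. add A (s n) (t n))"
proof -
  have "\<exists>N. \<forall>m\<ge>N. \<forall>n\<ge>N. q (sub A (add A (s m) (t m)) (add A (s n) (t n))) < e" if e: "e > 0" for e
  proof -
    obtain N1 where N1: "\<forall>m\<ge>N1. \<forall>n\<ge>N1. q (sub A (s m) (s n)) < e/2"
      using s e unfolding cauchy_seq_def by (meson half_gt_zero)
    obtain N2 where N2: "\<forall>m\<ge>N2. \<forall>n\<ge>N2. q (sub A (t m) (t n)) < e/2"
      using t e unfolding cauchy_seq_def by (meson half_gt_zero)
    have "q (sub A (add A (s m) (t m)) (add A (s n) (t n))) < e" if "m \<ge> max N1 N2" "n \<ge> max N1 N2" for m n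
    proof -
      have "q (sub A (add A (s m) (t m)) (add A (s n) (t n))) \<le> q (sub A (s m) (s n)) + q (sub A (t m) (t n))"
        using cauchyD[OF s] cauchyD[OF t] by (simp only: q_sub_add)
      moreover have "q (sub A (s m) (s n)) < e/2" "q (sub A (t m) (t n)) < e/2" using N1 N2 that by auto
      ultimately show ?thesis by linarith
    qed
    then show ?thesis by blast
  qed
  then show ?thesis using cauchyD[OF s] cauchyD[OF t] unfolding cauchy_seq_def by simp
qed

lemma cauchy_mul: assumes s: "cauchy s" and t: "cauchy t" shows "cauchy (\<lambda>n. mul A (s n) (t n))"
proof -
  obtain K where K: "K > 0" "\<And>n. q (s n) \<le> K" using q_bounded[OF s] by blast
  obtain L where L: "L > 0" "\<And>n. q (t n) \<le> L" using q_bounded[OF t] by blast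
  have "\<exists>N. \<forall>m\<ge>N. \<forall>n\<ge>N. q (sub A (mul A (s m) (t m)) (mul A (s n) (t n))) < e" if e: "e > 0" for e
  proof -
    obtain N1 where N1: "\<forall>m\<ge>N1. \<forall>n\<ge>N1. q (sub A (s m) (s n)) < e/2/L"
      using s e L(1) unfolding cauchy_seq_def by (meson half_gt_zero divide_pos_pos)
    obtain N2 where N2: "\<forall>m\<ge>N2. \<forall>n\<ge>N2. q (sub A (t m) (t n)) < e/2/K"
      using t e K(1) unfolding cauchy_seq_def by (meson half_gt_zero divide_pos_pos)
    have "q (sub A (mul A (s m) (t m)) (mul A (s n) (t n))) < e" if "m \<ge> max N1 N2" "n \<ge> max N1 N2" for m n
    proof -
      have c: "s m \<in> carr A" "t m \<in> carr A" "s n \<in> carr A" "t n \<in> carr A"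
        using cauchyD[OF s] cauchyD[OF t] by auto
      have "q (sub A (mul A (s m) (t m)) (mul A (s n) (t n)))
          \<le> q (sub A (s m) (s n)) * q (t m) + q (s n) * q (sub A (t m) (t n))"
        using c by (simp only: q_sub_mul)
      also have "\<dots> \<le> q (sub A (s m) (s n)) * L + K * q (sub A (t m) (t n))"
        using c K L by (intro add_mono mult_left_mono mult_right_mono) auto
      also have "\<dots> < (e/2/L) * L + K * (e/2/K)"
        using N1 N2 that K(1) L(1) by (intro add_strict_mono mult_strict_left_mono mult_strict_right_mono) auto
      also have "\<dots> = e" using K(1) L(1) by simp
      finally show ?thesis .
    qed
    then show ?thesis by blast
  qed
  then show ?thesis using cauchyD[OF s] cauchyD[OF t] unfolding cauchy_seq_def by simp
qed

lemma cauchy_smul: assumes s: "cauchy s" shows "cauchy (\<lambda>n. smul A c (s n))"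
proof -
  have "\<exists>N. \<forall>m\<ge>N. \<forall>n\<ge>N. q (sub A (smul A c (s m)) (smul A c (s n))) < e" if e: "e > 0" for e
  proof -
    have "e / (norm c + 1) > 0" using e by (simp add: add_nonneg_pos)
    then obtain N where N: "\<forall>m\<ge>N. \<forall>n\<ge>N. q (sub A (s m) (s n)) < e / (norm c + 1)"
      using s unfolding cauchy_seq_def by meson
    have "q (sub A (smul A c (s m)) (smul A c (s n))) < e" if "m \<ge> N" "n \<ge> N" for m n
    proof -
      have c: "s m \<in> carr A" "s n \<in> carr A" using cauchyD[OF s] by auto
      have "q (sub A (smul A c (s m)) (smul A c (s n))) = norm c * q (sub A (s m) (s n))"
        using c by (simp only: q_sub_smul)
      also have "\<dots> \<le> (norm c + 1) * q (sub A (s m) (s n))"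
        using c by (intro mult_right_mono) auto
      also have "\<dots> < (norm c + 1) * (e / (norm c + 1))"
        using N that by (intro mult_strict_left_mono) (auto simp: add_nonneg_pos)
      also have "\<dots> = e" by (simp add: add_nonneg_eq_0_iff)
      finally show ?thesis .
    qed
    then show ?thesis by blast
  qed
  then show ?thesis using cauchyD[OF s] unfolding cauchy_seq_def by simp
qed

lemma cauchy_adj: assumes s: "cauchy s" shows "cauchy (\<lambda>n. adj A (s n))"
  using s cauchyD[OF s] q_sub_adj unfolding cauchy_seq_def by simp

lemma null_refl: "cauchy s \<Longrightarrow> null s s"
  by (simp add: null_def cauchyD)

lemma null_sym: "\<lbrakk>null s t; cauchy s; cauchy t\<rbrakk> \<Longrightarrow> null t s"
  unfolding null_def using q_sub_commute[OF cauchyD cauchyD, of s t] by simp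

lemma null_squeeze: assumes "\<And>n. s n \<in> carr A" "\<And>n. t n \<in> carr A"
    "\<And>n. q (sub A (s n) (t n)) \<le> f n" "f \<longlonglongrightarrow> 0" shows "null s t"
  unfolding null_def by (rule tendsto_sandwich[OF _ _ tendsto_const assms(4)]) (use assms in auto)

lemma null_trans: assumes "null s t" "null t u" "cauchy s" "cauchy t" "cauchy u" shows "null s u"
proof (rule null_squeeze)
  show "(\<lambda>n. q (sub A (s n) (t n)) + q (sub A (t n) (u n))) \<longlonglongrightarrow> 0"
    using tendsto_add[OF assms(1,2)[unfolded null_def]] by simp
  show "q (sub A (s n) (u n)) \<le> q (sub A (s n) (t n)) + q (sub A (t n) (u n))" for n
    using assms by (intro q_sub_triangle cauchyD)
qed (use assms in \<open>simp_all add: cauchyD\<close>)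

lemma null_add: assumes "null s s'" "null t t'" "cauchy s" "cauchy s'" "cauchy t" "cauchy t'"
  shows "null (\<lambda>n. add A (s n) (t n)) (\<lambda>n. add A (s' n) (t' n))"
proof (rule null_squeeze)
  show "(\<lambda>n. q (sub A (s n) (s' n)) + q (sub A (t n) (t' n))) \<longlonglongrightarrow> 0"
    using tendsto_add[OF assms(1,2)[unfolded null_def]] by simp
  show "q (sub A (add A (s n) (t n)) (add A (s' n) (t' n)))
      \<le> q (sub A (s n) (s' n)) + q (sub A (t n) (t' n))" for n
    using assms by (intro q_sub_add cauchyD)
qed (use assms in \<open>simp_all add: cauchyD\<close>)

lemma null_mul: assumes "null s s'" "null t t'" "cauchy s" "cauchy s'" "cauchy t" "cauchy t'"
  shows "null (\<lambda>n. mul A (s n) (t n)) (\<lambda>n. mul A (s' n) (t' n))"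
proof -
  obtain K where K: "K > 0" "\<And>n. q (s' n) \<le> K" using q_bounded[OF assms(4)] by blast
  obtain L where L: "L > 0" "\<And>n. q (t n) \<le> L" using q_bounded[OF assms(5)] by blast
  show ?thesis
  proof (rule null_squeeze)
    have "(\<lambda>n. q (sub A (s n) (s' n)) * L + K * q (sub A (t n) (t' n))) \<longlonglongrightarrow> 0 * L + K * 0"
      using assms(1,2) unfolding null_def by (intro tendsto_intros)
    then show "(\<lambda>n. q (sub A (s n) (s' n)) * L + K * q (sub A (t n) (t' n))) \<longlonglongrightarrow> 0" by simp
    fix n
    have c: "s n \<in> carr A" "t n \<in> carr A" "s' n \<in> carr A" "t' n \<in> carr A"
      using assms cauchyD by auto
    have "q (sub A (mul A (s n) (t n)) (mul A (s' n) (t' n)))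
      \<le> q (sub A (s n) (s' n)) * q (t n) + q (s' n) * q (sub A (t n) (t' n))"
      using c by (simp only: q_sub_mul)
    also have "\<dots> \<le> q (sub A (s n) (s' n)) * L + K * q (sub A (t n) (t' n))"
      using c K L by (intro add_mono mult_left_mono mult_right_mono) auto
    finally show "q (sub A (mul A (s n) (t n)) (mul A (s' n) (t' n)))
      \<le> q (sub A (s n) (s' n)) * L + K * q (sub A (t n) (t' n))" .
  qed (use assms in \<open>simp_all add: cauchyD\<close>)
qed

lemma null_smul: assumes "null s s'" "cauchy s" "cauchy s'"
  shows "null (\<lambda>n. smul A c (s n)) (\<lambda>n. smul A c (s' n))"
proof (rule null_squeeze)
  show "(\<lambda>n. norm c * q (sub A (s n) (s' n))) \<longlonglongrightarrow> 0"
    using tendsto_mult_left[OF assms(1)[unfolded null_def], of "norm c"] by simp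
  show "q (sub A (smul A c (s n)) (smul A c (s' n))) \<le> norm c * q (sub A (s n) (s' n))" for n
    using assms by (intro eq_refl q_sub_smul cauchyD)
qed (use assms in \<open>simp_all add: cauchyD\<close>)

lemma null_adj: assumes "null s s'" "cauchy s" "cauchy s'"
  shows "null (\<lambda>n. adj A (s n)) (\<lambda>n. adj A (s' n))"
proof (rule null_squeeze)
  show "(\<lambda>n. q (sub A (s n) (s' n))) \<longlonglongrightarrow> 0" using assms(1)[unfolded null_def] .
  show "q (sub A (adj A (s n)) (adj A (s' n))) \<le> q (sub A (s n) (s' n))" for n
    using assms by (intro eq_refl q_sub_adj cauchyD)
qed (use assms in \<open>simp_all add: cauchyD\<close>)

lemma null_q_lim: assumes "null s t" "cauchy s" "cauchy t" "(\<lambda>n. q (s n)) \<longlonglongrightarrow> l"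
  shows "(\<lambda>n. q (t n)) \<longlonglongrightarrow> l"
proof -
  have "(\<lambda>n. q (t n) - q (s n)) \<longlonglongrightarrow> 0"
  proof (rule Lim_null_comparison)
    show "(\<lambda>n. q (sub A (s n) (t n))) \<longlonglongrightarrow> 0" using assms(1)[unfolded null_def] .
    show "\<forall>\<^sub>F n in sequentially. norm (q (t n) - q (s n)) \<le> q (sub A (s n) (t n))"
    proof (intro always_eventually allI)
      fix n
      show "norm (q (t n) - q (s n)) \<le> q (sub A (s n) (t n))"
      using q_diff[of "s n" "t n"] assms(2,3) cauchyD by (simp add: abs_minus_commute)
    qed
  qed
  from tendsto_add[OF this assms(4)] show ?thesis by simp
qed

abbreviation "C \<equiv> completion A q"
abbreviation "cl \<equiv> cls A q"

lemma mem_cls: "t \<in> cl s \<longleftrightarrow> cauchy t \<and> null s t"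
  by (simp add: cls_def null_def)

lemma cls_eq_iff: assumes "cauchy s" "cauchy t" shows "cl s = cl t \<longleftrightarrow> null s t"
proof
  assume "cl s = cl t"
  then show "null s t" using mem_cls null_refl assms by blast
next
  assume st: "null s t"
  show "cl s = cl t"
    unfolding set_eq_iff mem_cls by (meson null_trans null_sym st assms)
qed

lemma rep_cls: assumes "cauchy s" shows "cauchy (rep (cl s))" "null s (rep (cl s))" 
proof -
  have "rep (cl s) \<in> cl s" unfolding rep_def by (rule someI[of _ s]) (simp add: mem_cls null_refl assms)
  then show "cauchy (rep (cl s))" "null s (rep (cl s))" by (auto simp: mem_cls)
qed

lemma rep_cls': assumes "cauchy s" shows "null (rep (cl s)) s"
  by (rule null_sym[OF rep_cls(2)[OF assms] assms rep_cls(1)[OF assms]])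

lemma carr_C: "carr C = {cl s | s. cauchy s}"
  by (simp add: completion_def)

lemma carr_CI [simp]: "cauchy s \<Longrightarrow> cl s \<in> carr C"
  by (auto simp: carr_C)

lemma carr_CE: assumes "S \<in> carr C" obtains s where "cauchy s" "S = cl s"
  using assms by (auto simp: carr_C)

lemma zer_C: "zer C = cl (\<lambda>n. zer A)" and unt_C: "unt C = cl (\<lambda>n. unt A)"
  by (simp_all add: completion_def)

lemma add_C [simp]: "\<lbrakk>cauchy s; cauchy t\<rbrakk> \<Longrightarrow> add C (cl s) (cl t) = cl (\<lambda>n. add A (s n) (t n))"
  by (simp add: completion_def cls_eq_iff cauchy_add null_add rep_cls rep_cls')

lemma mul_C [simp]: "\<lbrakk>cauchy s; cauchy t\<rbrakk> \<Longrightarrow> mul C (cl s) (cl t) = cl (\<lambda>n. mul A (s n) (t n))"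
  by (simp add: completion_def cls_eq_iff cauchy_mul null_mul rep_cls rep_cls')

lemma smul_C [simp]: "cauchy s \<Longrightarrow> smul C c (cl s) = cl (\<lambda>n. smul A c (s n))"
  by (simp add: completion_def cls_eq_iff cauchy_smul null_smul rep_cls rep_cls')

lemma adj_C [simp]: "cauchy s \<Longrightarrow> adj C (cl s) = cl (\<lambda>n. adj A (s n))"
  by (simp add: completion_def cls_eq_iff cauchy_adj null_adj rep_cls rep_cls')

lemma nrm_C_lim: assumes "cauchy s" shows "(\<lambda>n. q (s n)) \<longlonglongrightarrow> nrm C (cl s)"
proof -
  obtain l where l: "(\<lambda>n. q (s n)) \<longlonglongrightarrow> l" using q_convergent[OF assms] convergent_def by blast
  have "(\<lambda>n. q (rep (cl s) n)) \<longlonglongrightarrow> l"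
    using null_q_lim[OF rep_cls(2)[OF assms] assms rep_cls(1)[OF assms] l] .
  then have "nrm C (cl s) = l" by (simp add: completion_def limI)
  with l show ?thesis by simp
qed

lemma nrm_C_const: "x \<in> carr A \<Longrightarrow> nrm C (cl (\<lambda>n. x)) = q x"
  by (rule LIMSEQ_unique[OF nrm_C_lim tendsto_const]) simp

lemmas cauchy_ops [simp] = cauchy_add cauchy_mul cauchy_smul cauchy_adj

lemma star_algebra_C: "star_algebra C"
proof
  fix x y z :: "(nat \<Rightarrow> 'a) set" and c d :: complex
  show "zer C \<in> carr C" "unt C \<in> carr C" by (simp_all add: zer_C unt_C)
  { assume "x \<in> carr C"
    then obtain s where s: "cauchy s" "x = cl s" by (rule carr_CE)
    note [simp] = s cauchyD[OF s(1)]
    show "smul C c x \<in> carr C" "adj C x \<in> carr C" by simp_all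
    show "add C x (zer C) = x" "sub C x x = zer C" "mul C (unt C) x = x" "mul C x (unt C) = x" 
       "adj C (adj C x) = x" "smul C 1 x = x" "smul C c (smul C d x) = smul C (c * d) x"
       "smul C (c + d) x = add C (smul C c x) (smul C d x)"
       "adj C (smul C c x) = smul C (cnj c) (adj C x)"
      by (simp_all add: zer_C unt_C add_smul adj_smul)
    { assume "y \<in> carr C"
      then obtain t where t: "cauchy t" "y = cl t" by (rule carr_CE)
      note [simp] = t cauchyD[OF t(1)]
      show "add C x y \<in> carr C" "mul C x y \<in> carr C" by simp_all
      show "add C x y = add C y x" by (simp add: add_comm)
      show "smul C c (add C x y) = add C (smul C c x) (smul C c y)"
        "mul C (smul C c x) y = smul C c (mul C x y)" "mul C x (smul C c y) = smul C c (mul C x y)"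
        "adj C (add C x y) = add C (adj C x) (adj C y)" "adj C (mul C x y) = mul C (adj C y) (adj C x)"
        by (simp_all add: smul_add smul_mul mul_smul adj_add adj_mul)
      { assume "z \<in> carr C"
        then obtain u where u: "cauchy u" "z = cl u" by (rule carr_CE)
        note [simp] = u cauchyD[OF u(1)]
        show "add C (add C x y) z = add C x (add C y z)" by (simp add: add_assoc)
        show "mul C (mul C x y) z = mul C x (mul C y z)" by (simp add: mul_assoc)
        show "mul C x (add C y z) = add C (mul C x y) (mul C x z)" by (simp add: mul_add)
        show "mul C (add C x y) z = add C (mul C x z) (mul C y z)" by (simp add: add_mul)
      } } }
qed

lemma cstar_seminorm_C: "cstar_seminorm C (nrm C)"
  unfolding cstar_seminorm_def
proof (intro conjI ballI allI)
  fix x c assume "x \<in> carr C"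
  then obtain s where s: "cauchy s" "x = cl s" by (rule carr_CE)
  note [simp] = s cauchyD[OF s(1)]
  note sl = nrm_C_lim[OF s(1)]
  show "0 \<le> nrm C x" using LIMSEQ_le_const[OF sl, of 0] by auto
  have "(\<lambda>n. q (smul A c (s n))) \<longlonglongrightarrow> norm c * nrm C x"
    using tendsto_mult_left[OF sl, of "norm c"] by (simp add: q_smul)
  then show "nrm C (smul C c x) = norm c * nrm C x"
    using nrm_C_lim[of "\<lambda>n. smul A c (s n)"] LIMSEQ_unique by auto
  have "(\<lambda>n. q (mul A (adj A (s n)) (s n))) \<longlonglongrightarrow> (nrm C x)\<^sup>2"
    using tendsto_power[OF sl, of 2] by (simp add: q_cstar)
  then show "nrm C (mul C (adj C x) x) = (nrm C x)\<^sup>2"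
    using nrm_C_lim[of "\<lambda>n. mul A (adj A (s n)) (s n)"] LIMSEQ_unique by auto
  { fix y assume "y \<in> carr C"
    then obtain t where t: "cauchy t" "y = cl t" by (rule carr_CE)
    note [simp] = t cauchyD[OF t(1)]
    note tl = nrm_C_lim[OF t(1)]
    show "nrm C (add C x y) \<le> nrm C x + nrm C y"
      using LIMSEQ_le[OF nrm_C_lim[of "\<lambda>n. add A (s n) (t n)"] tendsto_add[OF sl tl]] by (auto simp: q_add)
    show "nrm C (mul C x y) \<le> nrm C x * nrm C y"
      using LIMSEQ_le[OF nrm_C_lim[of "\<lambda>n. mul A (s n) (t n)"] tendsto_mult[OF sl tl]] by (auto simp: q_mul) }
qed

lemma seminormed_C: "seminormed_star_algebra C (nrm C)"
  by (intro seminormed_star_algebra.intro star_algebra_C seminormed_star_algebra_axioms.intro cstar_seminorm_C)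

lemma sub_C: "\<lbrakk>cauchy s; cauchy t\<rbrakk> \<Longrightarrow> sub C (cl s) (cl t) = cl (\<lambda>n. sub A (s n) (t n))"
  by simp

lemma C_dense: assumes "S \<in> carr C" "e > 0" shows "\<exists>a\<in>carr A. nrm C (sub C S (cl (\<lambda>n. a))) < e"
proof -
  from assms(1) obtain s where s: "cauchy s" "S = cl s" by (rule carr_CE)
  note [simp] = cauchyD[OF s(1)]
  obtain N where N: "\<forall>m\<ge>N. \<forall>n\<ge>N. q (sub A (s m) (s n)) < e/2"
    using s(1) assms(2) unfolding cauchy_seq_def by (meson half_gt_zero)
  have "(\<lambda>n. q (sub A (s n) (s N))) \<longlonglongrightarrow> nrm C (sub C S (cl (\<lambda>n. s N)))"
    using nrm_C_lim[of "\<lambda>n. sub A (s n) (s N)"] s by simp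
  then have "nrm C (sub C S (cl (\<lambda>n. s N))) \<le> e/2"
    by (rule LIMSEQ_le_const2) (use N in \<open>auto intro!: exI[of _ N] less_imp_le\<close>)
  then show ?thesis using assms(2) by (intro bexI[of _ "s N"]) auto
qed

lemma cstar_algebra_C: "cstar_algebra C"
proof (intro cstar_algebra.intro star_algebra_C cstar_algebra_axioms.intro cstar_seminorm_C)
  interpret C: seminormed_star_algebra C "nrm C" by (rule seminormed_C)
  show "x = zer C" if x: "x \<in> carr C" "nrm C x = 0" for x
  proof -
    from x(1) obtain s where s: "cauchy s" "x = cl s" by (rule carr_CE)
    have "null s (\<lambda>n. zer A)" unfolding null_def
      using nrm_C_lim[OF s(1)] x(2) s cauchyD[OF s(1)]
        smul_zero[of "zer A"] smul_smul[of "zer A" "-1" 0] by simp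
    then show ?thesis using s by (simp add: zer_C cls_eq_iff)
  qed
  fix S assume S: "cauchy_seq C (nrm C) S"
  have Sc: "S n \<in> carr C" for n using S by (simp add: cauchy_seq_def)
  have "\<exists>a\<in>carr A. nrm C (sub C (S n) (cl (\<lambda>k. a))) < inverse (of_nat (Suc n))" for n
    by (rule C_dense[OF Sc]) simp
  then obtain a where ac: "\<And>n. a n \<in> carr A"
    and a: "\<And>n. nrm C (sub C (S n) (cl (\<lambda>k. a n))) < inverse (of_nat (Suc n))" by metis
  define E where "E n = cl (\<lambda>k. a n)" for n
  have Ec: "E n \<in> carr C" for n using ac by (simp add: E_def)
  have qE: "q (sub A (a m) (a n)) = nrm C (sub C (E m) (E n))" for m n
    using ac nrm_C_const[of "sub A (a m) (a n)"] by (simp add: E_def)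
  have tri: "nrm C (sub C (E m) (E n)) \<le> inverse (of_nat (Suc m)) + nrm C (sub C (S m) (S n)) + inverse (of_nat (Suc n))" for m n
  proof -
    have "nrm C (sub C (E m) (E n)) \<le> nrm C (sub C (E m) (S m)) + nrm C (sub C (S m) (E n))"
      using Ec Sc by (intro C.q_sub_triangle)
    also have "nrm C (sub C (S m) (E n)) \<le> nrm C (sub C (S m) (S n)) + nrm C (sub C (S n) (E n))"
      using Ec Sc by (intro C.q_sub_triangle)
    also have "nrm C (sub C (E m) (S m)) = nrm C (sub C (S m) (E m))"
      using Ec Sc by (intro C.q_sub_commute)
    finally show ?thesis using a[of m] a[of n] unfolding E_def[symmetric] by linarith
  qed
  have ca: "cauchy a"
    unfolding cauchy_seq_def
  proof (intro conjI allI impI)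
    show "a n \<in> carr A" for n by (rule ac)
    fix e :: real assume e: "e > 0"
    obtain N1 where N1: "\<forall>m\<ge>N1. \<forall>n\<ge>N1. nrm C (sub C (S m) (S n)) < e/3"
      using S e unfolding cauchy_seq_def by (metis divide_pos_pos zero_less_numeral)
    obtain N2 where N2: "inverse (of_nat (Suc N2)) < e/3" using reals_Archimedean[of "e/3"] e by auto
    have N2': "inverse (of_nat (Suc n)) < e/3" if "n \<ge> N2" for n
      by (rule le_less_trans[OF _ N2]) (use that in \<open>auto intro!: le_imp_inverse_le\<close>)
    have "q (sub A (a m) (a n)) < e" if "m \<ge> max N1 N2" "n \<ge> max N1 N2" for m n
      using tri[of m n] N1[rule_format, of m n] N2'[of m] N2'[of n] that unfolding qE by simp
    then show "\<exists>N. \<forall>m\<ge>N. \<forall>n\<ge>N. q (sub A (a m) (a n)) < e" by blast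
  qed
  have lim: "(\<lambda>n. nrm C (sub C (S n) (cl a))) \<longlonglongrightarrow> 0"
  proof (rule LIMSEQ_I)
    fix e :: real assume e: "e > 0"
    obtain N1 where N1: "\<forall>m\<ge>N1. \<forall>n\<ge>N1. q (sub A (a m) (a n)) < e/3"
      using ca e unfolding cauchy_seq_def by (metis divide_pos_pos zero_less_numeral)
    obtain N2 where N2: "inverse (of_nat (Suc N2)) < e/3" using reals_Archimedean[of "e/3"] e by auto
    have N2': "inverse (of_nat (Suc n)) < e/3" if "n \<ge> N2" for n
      by (rule le_less_trans[OF _ N2]) (use that in \<open>auto intro!: le_imp_inverse_le\<close>)
    have "nrm C (sub C (S n) (cl a)) < e" if n: "n \<ge> max N1 N2" for n
    proof -
      have "(\<lambda>k. q (sub A (a n) (a k))) \<longlonglongrightarrow> nrm C (sub C (E n) (cl a))"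
        using nrm_C_lim[of "\<lambda>k. sub A (a n) (a k)"] ca ac by (simp add: E_def)
      then have "nrm C (sub C (E n) (cl a)) \<le> e/3"
        by (rule LIMSEQ_le_const2) (use N1 n in \<open>auto intro!: exI[of _ N1] less_imp_le\<close>)
      moreover have "nrm C (sub C (S n) (cl a)) \<le> nrm C (sub C (S n) (E n)) + nrm C (sub C (E n) (cl a))"
        using Sc Ec ca by (intro C.q_sub_triangle) auto
      ultimately show ?thesis using a[of n] N2'[of n] n e unfolding E_def[symmetric] by simp
    qed
    moreover have "nrm C (sub C (S n) (cl a)) \<ge> 0" for n using Sc ca by (intro C.q_nonneg C.add_closed C.smul_closed) auto
    ultimately show "\<exists>N. \<forall>n\<ge>N. norm (nrm C (sub C (S n) (cl a)) - 0) < e" by (intro exI[of _ "max N1 N2"]) auto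
  qed
  show "\<exists>x\<in>carr C. (\<lambda>n. nrm C (sub C (S n) x)) \<longlonglongrightarrow> 0"
    using lim ca by (intro bexI[of _ "cl a"]) auto
qed

end


section \<open>The universal property of the enveloping C*-algebra\<close>

definition seminorm_bounded :: "('a, 'm) star_algebra_scheme \<Rightarrow> bool" where
  "seminorm_bounded A \<longleftrightarrow> (\<forall>a\<in>carr A. \<exists>K. \<forall>q. cstar_seminorm A q \<longrightarrow> q a \<le> K)"

lemma cstar_seminorm_zero: "cstar_seminorm A (\<lambda>x. 0)"
  by (simp add: cstar_seminorm_def)

lemma universal_seminorm_upper:
  assumes "seminorm_bounded A" "a \<in> carr A" "cstar_seminorm A q"
  shows "q a \<le> universal_seminorm A a"
  unfolding universal_seminorm_def
proof (rule cSUP_upper)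
  obtain K where "\<forall>q. cstar_seminorm A q \<longrightarrow> q a \<le> K"
    using assms unfolding seminorm_bounded_def by blast
  then show "bdd_above ((\<lambda>q. q a) ` {q. cstar_seminorm A q})" by (intro bdd_aboveI2[of _ _ K]) auto
qed (use assms in auto)

lemma universal_seminorm_least:
  assumes "\<And>q. cstar_seminorm A q \<Longrightarrow> q a \<le> K"
  shows "universal_seminorm A a \<le> K"
  unfolding universal_seminorm_def
  by (rule cSUP_least) (use assms cstar_seminorm_zero in auto)

lemma cstar_seminorm_universal:
  assumes A: "star_algebra A" and b: "seminorm_bounded A"
  shows "cstar_seminorm A (universal_seminorm A)"
proof -
  interpret star_algebra A by (rule A)
  let ?u = "universal_seminorm A"
  note up = universal_seminorm_upper[OF b]
  have nn: "0 \<le> ?u x" if "x \<in> carr A" for x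
    using up[OF that cstar_seminorm_zero] by simp
  note D = cstar_seminorm_def[THEN iffD1]
  show ?thesis unfolding cstar_seminorm_def
  proof (intro conjI ballI allI)
    fix x assume x: "x \<in> carr A"
    show "0 \<le> ?u x" by (rule nn[OF x])
    { fix c
      have le: "?u (smul A d y) \<le> norm d * ?u y" if "y \<in> carr A" for d y
      proof (rule universal_seminorm_least)
        fix q assume q: "cstar_seminorm A q"
        then have "q (smul A d y) = norm d * q y" using that by (simp add: cstar_seminorm_def)
        also have "\<dots> \<le> norm d * ?u y" using up[OF that q] by (intro mult_left_mono) simp_all
        finally show "q (smul A d y) \<le> norm d * ?u y" .
      qed
      show "?u (smul A c x) = norm c * ?u x"
      proof (cases "c = 0")
        case True
        then show ?thesis using le[OF x, of 0] nn[of "zer A"] x by simp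
      next
        case False
        have "?u x \<le> norm (inverse c) * ?u (smul A c x)"
          using le[of "smul A c x" "inverse c"] x False by simp
        then have "norm c * ?u x \<le> ?u (smul A c x)"
          using False by (simp add: norm_inverse norm_divide field_simps)
        then show ?thesis using le[OF x, of c] by simp
      qed }
    show "?u (mul A (adj A x) x) = (?u x)\<^sup>2"
    proof (rule antisym)
      show "?u (mul A (adj A x) x) \<le> (?u x)\<^sup>2"
      proof (rule universal_seminorm_least)
        fix q assume q: "cstar_seminorm A q"
        then have "q (mul A (adj A x) x) = (q x)\<^sup>2" "0 \<le> q x" using x by (simp_all add: cstar_seminorm_def)
        then show "q (mul A (adj A x) x) \<le> (?u x)\<^sup>2" using up[OF x q] by (simp add: power_mono)
      qed
      have "?u x \<le> sqrt (?u (mul A (adj A x) x))"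
      proof (rule universal_seminorm_least)
        fix q assume q: "cstar_seminorm A q"
        then have "(q x)\<^sup>2 \<le> ?u (mul A (adj A x) x)"
          using up[of "mul A (adj A x) x" q] x by (simp add: cstar_seminorm_def)
        then show "q x \<le> sqrt (?u (mul A (adj A x) x))" by (rule real_le_rsqrt)
      qed
      then have "(?u x)\<^sup>2 \<le> (sqrt (?u (mul A (adj A x) x)))\<^sup>2"
        using nn[OF x] by (intro power_mono)
      then show "(?u x)\<^sup>2 \<le> ?u (mul A (adj A x) x)" using nn x by simp
    qed
    fix y assume y: "y \<in> carr A"
    show "?u (add A x y) \<le> ?u x + ?u y"
    proof (rule universal_seminorm_least)
      fix q assume q: "cstar_seminorm A q"
      then have "q (add A x y) \<le> q x + q y" using x y by (simp add: cstar_seminorm_def)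
      then show "q (add A x y) \<le> ?u x + ?u y" using up[OF x q] up[OF y q] by linarith
    qed
    show "?u (mul A x y) \<le> ?u x * ?u y"
    proof (rule universal_seminorm_least)
      fix q assume q: "cstar_seminorm A q"
      then have "q (mul A x y) \<le> q x * q y" "0 \<le> q x" "0 \<le> q y" using x y by (simp_all add: cstar_seminorm_def)
      moreover have "q x * q y \<le> ?u x * ?u y" using calculation up[OF x q] up[OF y q] nn[OF x]
        by (intro mult_mono)
      ultimately show "q (mul A x y) \<le> ?u x * ?u y" by linarith
    qed
  qed
qed

theorem enveloping_cstar_algebra:
  assumes "star_algebra A" "seminorm_bounded A"
  shows "cstar_algebra (enveloping_cstar A)"
  unfolding enveloping_cstar_def
  by (intro seminormed_star_algebra.cstar_algebra_C seminormed_star_algebra.intro assms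
      seminormed_star_algebra_axioms.intro cstar_seminorm_universal)

lemma envelope_embed_hom:
  assumes "star_algebra A" "seminorm_bounded A"
  shows "star_hom A (enveloping_cstar A) (envelope_embed A)"
    and "envelope_embed A (unt A) = unt (enveloping_cstar A)"
    and "\<And>S e. \<lbrakk>S \<in> carr (enveloping_cstar A); e > 0\<rbrakk> \<Longrightarrow>
       \<exists>a\<in>carr A. nrm (enveloping_cstar A) (sub (enveloping_cstar A) S (envelope_embed A a)) < e"
proof -
  interpret seminormed_star_algebra A "universal_seminorm A"
    by (intro seminormed_star_algebra.intro assms seminormed_star_algebra_axioms.intro cstar_seminorm_universal)
  show "star_hom A (enveloping_cstar A) (envelope_embed A)"
    unfolding star_hom_def enveloping_cstar_def envelope_embed_def by simp
  show "envelope_embed A (unt A) = unt (enveloping_cstar A)"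
    by (simp add: envelope_embed_def enveloping_cstar_def unt_C)
  show "\<And>S e. \<lbrakk>S \<in> carr (enveloping_cstar A); e > 0\<rbrakk> \<Longrightarrow>
       \<exists>a\<in>carr A. nrm (enveloping_cstar A) (sub (enveloping_cstar A) S (envelope_embed A a)) < e"
    unfolding enveloping_cstar_def envelope_embed_def by (rule C_dense)
qed

lemma star_hom_sub: "\<lbrakk>star_algebra A; star_hom A B \<pi>; x \<in> carr A; y \<in> carr A\<rbrakk> \<Longrightarrow> \<pi> (sub A x y) = sub B (\<pi> x) (\<pi> y)"
  by (simp add: star_hom_def star_algebra.smul_closed)

lemma star_hom_seminorm:
  assumes "star_algebra A" "star_hom A B \<pi>" "cstar_algebra B"
  shows "cstar_seminorm A (\<lambda>a. nrm B (\<pi> a))"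
proof -
  interpret A: star_algebra A by fact
  interpret B: cstar_algebra B by fact
  show ?thesis using assms(2) B.cstar_norm unfolding star_hom_def cstar_seminorm_def by auto
qed

theorem enveloping_cstar_universal:
  assumes A: "star_algebra A" and b: "seminorm_bounded A" and B: "cstar_algebra B"
    and \<pi>: "star_hom A B \<pi>"
  shows "\<exists>\<Phi>. star_hom (enveloping_cstar A) B \<Phi> \<and> (\<forall>a\<in>carr A. \<Phi> (envelope_embed A a) = \<pi> a) \<and>
      (\<forall>x\<in>carr (enveloping_cstar A). nrm B (\<Phi> x) \<le> nrm (enveloping_cstar A) x)"
proof -
  let ?u = "universal_seminorm A"
  interpret seminormed_star_algebra A ?u
    by (intro seminormed_star_algebra.intro assms seminormed_star_algebra_axioms.intro cstar_seminorm_universal)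
  interpret B: cstar_algebra B by (rule B)
  interpret B: seminormed_star_algebra B "nrm B" 
    by unfold_locales (rule B.cstar_norm)
  have \<pi>c [simp]: "\<pi> x \<in> carr B" if "x \<in> carr A" for x using \<pi> that by (simp add: star_hom_def)
  have contr: "nrm B (\<pi> x) \<le> ?u x" if "x \<in> carr A" for x
    using universal_seminorm_upper[OF b that star_hom_seminorm[OF A \<pi> B]] .
  have contr2: "nrm B (sub B (\<pi> x) (\<pi> y)) \<le> ?u (sub A x y)" if "x \<in> carr A" "y \<in> carr A" for x y
    using contr[of "sub A x y"] star_hom_sub[OF A \<pi> that] that by simp
  have cs: "B.cauchy (\<lambda>n. \<pi> (s n))" if s: "cauchy s" for s
    unfolding cauchy_seq_def
  proof (intro conjI allI impI)
    show "\<pi> (s n) \<in> carr B" for n using cauchyD[OF s] by simp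
    fix e :: real assume "e > 0"
    then obtain N where "\<forall>m\<ge>N. \<forall>n\<ge>N. ?u (sub A (s m) (s n)) < e"
      using s unfolding cauchy_seq_def by meson
    then show "\<exists>N. \<forall>m\<ge>N. \<forall>n\<ge>N. nrm B (sub B (\<pi> (s m)) (\<pi> (s n))) < e"
      by (intro exI[of _ N] allI impI le_less_trans[OF contr2[OF cauchyD[OF s] cauchyD[OF s]]]) simp
  qed
  define L where "L s x \<longleftrightarrow> x \<in> carr B \<and> (\<lambda>n. nrm B (sub B (\<pi> (s n)) x)) \<longlonglongrightarrow> 0" for s x
  have L_ex: "\<exists>x. L s x" if "cauchy s" for s
    using B.complete[OF cs[OF that]] by (auto simp: L_def)
  have L_null: "L s x \<longleftrightarrow> x \<in> carr B \<and> B.null (\<lambda>n. \<pi> (s n)) (\<lambda>n. x)" for s x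
    by (simp add: L_def B.null_def)
  have L_eq: "x = y" if "L s x" "L t y" "null s t" "cauchy s" "cauchy t" for s t x y
  proof -
    have st: "B.null (\<lambda>n. \<pi> (s n)) (\<lambda>n. \<pi> (t n))"
    proof (rule B.null_squeeze)
      show "nrm B (sub B (\<pi> (s n)) (\<pi> (t n))) \<le> ?u (sub A (s n) (t n))" for n
        using that by (intro contr2 cauchyD)
      show "(\<lambda>n. ?u (sub A (s n) (t n))) \<longlonglongrightarrow> 0" using that(3) by (simp add: null_def)
    qed (use that in \<open>simp_all add: cauchyD\<close>)
    have x: "x \<in> carr B" "y \<in> carr B" using that by (auto simp: L_def)
    have "B.null (\<lambda>n. x) (\<lambda>n. \<pi> (s n))"
      by (rule B.null_sym[OF _ cs[OF that(4)] B.cauchy_const[OF x(1)]]) (use that in \<open>simp add: L_null\<close>)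
    from B.null_trans[OF this st B.cauchy_const[OF x(1)] cs[OF that(4)] cs[OF that(5)]]
    have "B.null (\<lambda>n. x) (\<lambda>n. \<pi> (t n))" .
    from B.null_trans[OF this _ B.cauchy_const[OF x(1)] cs[OF that(5)] B.cauchy_const[OF x(2)]]
    have "B.null (\<lambda>n. x) (\<lambda>n. y)" using that by (simp add: L_null)
    then have "nrm B (sub B x y) = 0" by (simp add: B.null_def LIMSEQ_const_iff)
    then show ?thesis using B.nrm_zero[of "sub B x y"] B.eq_if_sub_zero[OF x] x by simp
  qed
  define \<Phi> where "\<Phi> S = (THE x. L (rep S) x)" for S
  have \<Phi>: "\<Phi> (cl s) = x" if Ls: "L s x" and s: "cauchy s" for s x
  proof -
    note rc = rep_cls[OF s]
    obtain y where y: "L (rep (cl s)) y" using L_ex[OF rc(1)] by blast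
    have xy: "x = y" by (rule L_eq[OF Ls y rc(2) s rc(1)])
    have un: "z = y" if "L (rep (cl s)) z" for z
      by (rule L_eq[OF that y null_refl[OF rc(1)] rc(1) rc(1)])
    show ?thesis unfolding \<Phi>_def xy by (rule the_equality, rule y, rule un)
  qed
  have pw: "\<pi> (add A x y) = add B (\<pi> x) (\<pi> y)" "\<pi> (mul A x y) = mul B (\<pi> x) (\<pi> y)" if "x \<in> carr A" "y \<in> carr A" for x y
    using \<pi> that by (simp_all add: star_hom_def)
  have pw1: "\<pi> (smul A c x) = smul B c (\<pi> x)" "\<pi> (adj A x) = adj B (\<pi> x)" if "x \<in> carr A" for x c
    using \<pi> that by (simp_all add: star_hom_def)
  have hom: "star_hom C B \<Phi>"
    unfolding star_hom_def
  proof (intro conjI ballI allI)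
    fix S c assume "S \<in> carr C"
    then obtain s where s: "cauchy s" "S = cl s" by (rule carr_CE)
    obtain x where x: "L s x" using L_ex[OF s(1)] ..
    have xc: "x \<in> carr B" using x by (simp add: L_def)
    note [simp] = cauchyD[OF s(1)] cs[OF s(1)]
    show "\<Phi> S \<in> carr B" using \<Phi>[OF x s(1)] s xc by simp
    have "L (\<lambda>n. smul A c (s n)) (smul B c x)"
      using x B.null_smul[of "\<lambda>n. \<pi> (s n)" "\<lambda>n. x" c] by (simp add: L_null pw1)
    from \<Phi>[OF this] show "\<Phi> (smul C c S) = smul B c (\<Phi> S)" using s \<Phi>[OF x s(1)] by simp
    have "L (\<lambda>n. adj A (s n)) (adj B x)"
      using x B.null_adj[of "\<lambda>n. \<pi> (s n)" "\<lambda>n. x"] by (simp add: L_null pw1)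
    from \<Phi>[OF this] show "\<Phi> (adj C S) = adj B (\<Phi> S)" using s \<Phi>[OF x s(1)] by simp
    fix T assume "T \<in> carr C"
    then obtain t where t: "cauchy t" "T = cl t" by (rule carr_CE)
    obtain y where y: "L t y" using L_ex[OF t(1)] ..
    have yc: "y \<in> carr B" using y by (simp add: L_def)
    note [simp] = cauchyD[OF t(1)] cs[OF t(1)]
    have "L (\<lambda>n. add A (s n) (t n)) (add B x y)"
      using x y B.null_add[of "\<lambda>n. \<pi> (s n)" "\<lambda>n. x" "\<lambda>n. \<pi> (t n)" "\<lambda>n. y"] by (simp add: L_null pw)
    from \<Phi>[OF this] show "\<Phi> (add C S T) = add B (\<Phi> S) (\<Phi> T)"
      using s t \<Phi>[OF x s(1)] \<Phi>[OF y t(1)] by simp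
    have "L (\<lambda>n. mul A (s n) (t n)) (mul B x y)"
      using x y B.null_mul[of "\<lambda>n. \<pi> (s n)" "\<lambda>n. x" "\<lambda>n. \<pi> (t n)" "\<lambda>n. y"] by (simp add: L_null pw)
    from \<Phi>[OF this] show "\<Phi> (mul C S T) = mul B (\<Phi> S) (\<Phi> T)"
      using s t \<Phi>[OF x s(1)] \<Phi>[OF y t(1)] by simp
  qed
  have emb: "\<Phi> (cl (\<lambda>n. a)) = \<pi> a" if "a \<in> carr A" for a
    using \<Phi>[of "\<lambda>n. a" "\<pi> a"] that by (simp add: L_def)
  have nle: "nrm B (\<Phi> S) \<le> nrm C S" if "S \<in> carr C" for S
  proof -
    from that obtain s where s: "cauchy s" "S = cl s" by (rule carr_CE)
    obtain x where x: "L s x" using L_ex[OF s(1)] ..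
    have xc: "x \<in> carr B" using x by (simp add: L_def)
    obtain l where l: "(\<lambda>n. nrm B (\<pi> (s n))) \<longlonglongrightarrow> l"
      using B.q_convergent[OF cs[OF s(1)]] convergent_def by blast
    have "(\<lambda>n. nrm B x) \<longlonglongrightarrow> l"
      by (rule B.null_q_lim[OF _ cs[OF s(1)] _ l]) (use x in \<open>simp_all add: L_null\<close>)
    then have "l = nrm B x" by (simp add: LIMSEQ_const_iff)
    moreover have "l \<le> nrm C S" unfolding s(2)
      by (rule LIMSEQ_le[OF l nrm_C_lim[OF s(1)]]) (use contr[OF cauchyD[OF s(1)]] in auto)
    ultimately show ?thesis using \<Phi>[OF x s(1)] s by simp
  qed
  show ?thesis using hom emb nle unfolding enveloping_cstar_def envelope_embed_def by (intro exI[of _ \<Phi>]) auto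
qed


section \<open>The universal property of the crossed product\<close>

locale zd_system =
  fixes \<phi> :: "int ^ 'd \<Rightarrow> 'x::topological_space \<Rightarrow> 'x"
  assumes dyn: "dynamical_system \<phi>"
begin

abbreviation "S \<equiv> skew_group_algebra \<phi>"
abbreviation "supp a \<equiv> {w. a w \<noteq> (\<lambda>x. 0 :: complex)}"

lemma phi_zero [simp]: "\<phi> 0 x = x"
  using dyn by (simp add: dynamical_system_def)

lemma phi_phi [simp]: "\<phi> z (\<phi> w x) = \<phi> (z + w) x"
  using dyn by (simp add: dynamical_system_def)

lemma phi_cont: "continuous_on UNIV (\<phi> z)"
  using dyn unfolding dynamical_system_def homeomorphism_def by blast

lemma cont_phi: "continuous_on UNIV f \<Longrightarrow> continuous_on UNIV (\<lambda>x. f (\<phi> z x))"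
  using continuous_on_compose2[OF _ phi_cont[of z], of UNIV f] by simp

lemma skew_carr: "a \<in> carr S \<longleftrightarrow> finite (supp a) \<and> (\<forall>z. continuous_on UNIV (a z))"
  by (simp add: skew_group_algebra_def)

lemma skew_simps:
  "zer S = (\<lambda>z x. 0)" "unt S = single 0 (\<lambda>x. 1)" "add S a b = (\<lambda>z x. a z x + b z x)"
  "smul S c a = (\<lambda>z x. c * a z x)" "adj S a = (\<lambda>z x. cnj (a (- z) (\<phi> (- z) x)))"
  by (simp_all add: skew_group_algebra_def single_def fun_eq_iff)

lemma skew_mul: assumes "finite F" "supp a \<subseteq> F"
  shows "mul S a b z x = (\<Sum>w\<in>F. a w x * b (z - w) (\<phi> (- w) x))"
proof -
  have "mul S a b z x = (\<Sum>w\<in>supp a. a w x * b (z - w) (\<phi> (- w) x))"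
    by (simp add: skew_group_algebra_def)
  also have "\<dots> = (\<Sum>w\<in>F. a w x * b (z - w) (\<phi> (- w) x))"
  proof (rule sum.mono_neutral_left[OF assms])
    show "\<forall>w\<in>F - supp a. a w x * b (z - w) (\<phi> (- w) x) = 0"
      by (metis (mono_tags, lifting) DiffE mem_Collect_eq mult_zero_left)
  qed
  finally show ?thesis .
qed

lemma single_supp: "supp (single w f) \<subseteq> {w}"
  by (auto simp: single_def)

lemma single_carr [simp]: "continuous_on UNIV f \<Longrightarrow> single w f \<in> carr S"
  unfolding skew_carr
proof (intro conjI allI)
  show "finite (supp (single w f))" using finite_subset[OF single_supp] by blast
  show "continuous_on UNIV (single w f z)" if "continuous_on UNIV f" for z
    using that by (cases "z = w") (simp_all add: single_def)
qed

lemma single_mul: "mul S (single w f) b = (\<lambda>z x. f x * b (z - w) (\<phi> (- w) x))"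
  by (intro ext, subst skew_mul[OF _ single_supp]) (simp_all add: single_def)

lemma single_single: "mul S (single w f) (single v g) = single (w + v) (\<lambda>x. f x * g (\<phi> (- w) x))"
  unfolding single_mul by (auto simp: single_def fun_eq_iff algebra_simps)

lemma single_adj: "adj S (single w f) = single (- w) (\<lambda>x. cnj (f (\<phi> w x)))"
  unfolding skew_simps by (auto simp: single_def fun_eq_iff)

lemma single_smul: "smul S c (single w f) = single w (\<lambda>x. c * f x)"
  unfolding skew_simps by (auto simp: single_def fun_eq_iff)

lemma single_add: "add S (single w f) (single w g) = single w (\<lambda>x. f x + g x)"
  unfolding skew_simps by (auto simp: single_def fun_eq_iff)

lemma skew_add_carr: "\<lbrakk>a \<in> carr S; b \<in> carr S\<rbrakk> \<Longrightarrow> add S a b \<in> carr S"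
proof -
  assume a: "a \<in> carr S" "b \<in> carr S"
  have "supp (add S a b) \<subseteq> supp a \<union> supp b" by (auto simp: skew_simps)
  then have "finite (supp (add S a b))" using a finite_subset unfolding skew_carr by blast
  then show ?thesis using a by (auto simp: skew_carr skew_simps intro!: continuous_intros)
qed

lemma skew_smul_carr: "a \<in> carr S \<Longrightarrow> smul S c a \<in> carr S"
proof -
  assume a: "a \<in> carr S"
  have "supp (smul S c a) \<subseteq> supp a" by (auto simp: skew_simps)
  then have "finite (supp (smul S c a))" using a finite_subset unfolding skew_carr by blast
  then show ?thesis using a by (auto simp: skew_carr skew_simps intro!: continuous_intros)
qed

lemma skew_adj_carr: "a \<in> carr S \<Longrightarrow> adj S a \<in> carr S"
proof -
  assume a: "a \<in> carr S"
  have "supp (adj S a) \<subseteq> uminus ` supp a"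
  proof
    fix z assume "z \<in> supp (adj S a)"
    then have "- z \<in> supp a" by (auto simp: skew_simps)
    then show "z \<in> uminus ` supp a" by (metis imageI minus_minus)
  qed
  then have "finite (supp (adj S a))" using a finite_subset unfolding skew_carr by blast
  then show ?thesis using a by (auto simp: skew_carr skew_simps intro!: continuous_intros cont_phi)
qed

lemma skew_mul_carr: assumes a: "a \<in> carr S" "b \<in> carr S" shows "mul S a b \<in> carr S"
proof -
  have fin: "finite (supp a)" "finite (supp b)" using a by (auto simp: skew_carr)
  have eq: "mul S a b z x = (\<Sum>w\<in>supp a. a w x * b (z - w) (\<phi> (- w) x))" for z x
    by (rule skew_mul[OF fin(1)]) simp
  have "supp (mul S a b) \<subseteq> (\<lambda>(w, v). w + v) ` (supp a \<times> supp b)"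
  proof
    fix z assume "z \<in> supp (mul S a b)"
    then obtain x where "mul S a b z x \<noteq> 0" by auto
    then obtain w where w: "w \<in> supp a" "a w x * b (z - w) (\<phi> (- w) x) \<noteq> 0"
      unfolding eq using sum.not_neutral_contains_not_neutral by blast
    then have "z - w \<in> supp b" by auto
    then show "z \<in> (\<lambda>(w, v). w + v) ` (supp a \<times> supp b)"
      using w(1) by (intro image_eqI[of _ _ "(w, z - w)"]) auto
  qed
  then have "finite (supp (mul S a b))" using fin finite_subset by blast
  moreover have "continuous_on UNIV (\<lambda>x. mul S a b z x)" for z
    unfolding eq using a by (intro continuous_intros cont_phi) (auto simp: skew_carr)
  ultimately show ?thesis unfolding skew_carr by blast
qed

lemma skew_induct [consumes 1, case_names single add]:
  assumes a: "a \<in> carr S"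
    and single: "\<And>w f. continuous_on UNIV f \<Longrightarrow> P (single w f)"
    and add: "\<And>b c. \<lbrakk>b \<in> carr S; c \<in> carr S; P b; P c\<rbrakk> \<Longrightarrow> P (add S b c)"
  shows "P a"
proof -
  have "\<forall>a. supp a \<subseteq> F \<longrightarrow> a \<in> carr S \<longrightarrow> P a" if "finite F" for F
    using that
  proof (induction F rule: finite_induct)
    case empty
    show ?case
    proof (intro allI impI)
      fix a :: "int ^ 'd \<Rightarrow> 'x \<Rightarrow> complex" assume "supp a \<subseteq> {}"
      then have "a = single 0 (\<lambda>x. 0)" by (auto simp: single_def fun_eq_iff)
      then show "P a" using single[of "\<lambda>x. 0" 0] by simp
    qed
  next
    case (insert v F)
    show ?case
    proof (intro allI impI)
      fix a :: "int ^ 'd \<Rightarrow> 'x \<Rightarrow> complex" assume s: "supp a \<subseteq> insert v F" and c: "a \<in> carr S"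
      define b where "b = a(v := (\<lambda>x. 0))"
      have "supp b \<subseteq> F" using s by (auto simp: b_def)
      moreover have bc: "b \<in> carr S"
        unfolding skew_carr
      proof (intro conjI allI)
        have "supp b \<subseteq> supp a" by (auto simp: b_def)
        then show "finite (supp b)" using c finite_subset unfolding skew_carr by blast
        show "continuous_on UNIV (b z)" for z using c by (auto simp: b_def skew_carr)
      qed
      ultimately have "P b" using insert.IH by blast
      moreover have av: "continuous_on UNIV (a v)" using c by (simp add: skew_carr)
      ultimately have "P (add S b (single v (a v)))"
        using add[OF bc single_carr[OF av]] single[OF av] by blast
      moreover have "add S b (single v (a v)) = a"
        by (auto simp: skew_simps b_def single_def fun_eq_iff)
      ultimately show "P a" by simp
    qed
  qed
  then show ?thesis using a unfolding skew_carr by blast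
qed

lemma skew_mul_add: "mul S a (add S b c) = add S (mul S a b) (mul S a c)"
  by (simp add: skew_group_algebra_def fun_eq_iff algebra_simps sum.distrib)

lemma skew_add_mul: assumes "a \<in> carr S" "b \<in> carr S"
  shows "mul S (add S a b) c = add S (mul S a c) (mul S b c)"
proof (intro ext)
  fix z x
  let ?F = "supp a \<union> supp b"
  have F: "finite ?F" using assms by (simp add: skew_carr)
  have s: "supp (add S a b) \<subseteq> ?F" by (auto simp: skew_simps)
  have sa: "supp a \<subseteq> ?F" and sb: "supp b \<subseteq> ?F" by auto
  show "mul S (add S a b) c z x = add S (mul S a c) (mul S b c) z x"
    unfolding skew_simps(3)[of "mul S a c"] skew_mul[OF F s] skew_mul[OF F sa] skew_mul[OF F sb]
    by (simp add: skew_simps algebra_simps sum.distrib)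
qed

lemma skew_smul_mul: assumes "a \<in> carr S" shows "mul S (smul S c a) b = smul S c (mul S a b)"
proof (intro ext)
  fix z x
  have F: "finite (supp a)" using assms by (simp add: skew_carr)
  have s: "supp (smul S c a) \<subseteq> supp a" by (auto simp: skew_simps)
  show "mul S (smul S c a) b z x = smul S c (mul S a b) z x"
    unfolding skew_simps(4)[of c "mul S a b"] skew_mul[OF F s] skew_mul[OF F subset_refl]
    by (simp add: skew_simps sum_distrib_left mult.assoc)
qed

lemma skew_mul_smul: "mul S a (smul S c b) = smul S c (mul S a b)"
  by (simp add: skew_group_algebra_def fun_eq_iff sum_distrib_left algebra_simps)

lemma skew_adj_add: "adj S (add S a b) = add S (adj S a) (adj S b)"
  by (simp add: skew_simps)

lemma skew_mul_assoc:
  assumes "a \<in> carr S" "b \<in> carr S" "c \<in> carr S"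
  shows "mul S (mul S a b) c = mul S a (mul S b c)"
  using assms(1)
proof (induction rule: skew_induct)
  case (single w f)
  show ?case using assms(2)
  proof (induction rule: skew_induct)
    case (single v g)
    show ?case by (simp add: single_single) (simp add: single_mul fun_eq_iff algebra_simps)
  next
    case (add b b')
    then show ?case using single by (simp add: skew_mul_add skew_add_mul skew_mul_carr)
  qed
next
  case (add a a')
  then show ?case using assms(2,3) by (simp add: skew_add_mul skew_mul_carr)
qed

lemma skew_adj_mul:
  assumes "a \<in> carr S" "b \<in> carr S"
  shows "adj S (mul S a b) = mul S (adj S b) (adj S a)"
  using assms(1)
proof (induction rule: skew_induct)
  case (single w f)
  show ?case using assms(2)
  proof (induction rule: skew_induct)
    case (single v g)
    have e: "- w - v = - v - w" by simp
    show ?case by (simp add: single_single single_adj mult.commute) (simp only: e)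
  next
    case (add b b')
    then show ?case using single by (simp add: skew_mul_add skew_adj_add skew_add_mul skew_adj_carr)
  qed
next
  case (add a a')
  then show ?case using assms(2) by (simp add: skew_add_mul skew_adj_add skew_mul_add)
qed

lemma skew_star_algebra: "star_algebra S"
proof
  show "zer S \<in> carr S" "unt S \<in> carr S" by (simp_all add: skew_carr skew_simps) (auto simp: single_def)
  show "mul S (unt S) a = a" for a by (simp add: skew_simps(2) single_mul)
  show "mul S a (unt S) = a" if "a \<in> carr S" for a
    using that
  proof (induction rule: skew_induct)
    case (single w f)
    show ?case unfolding skew_simps(2) single_single by simp
  next
    case (add b c)
    then show ?case by (simp add: skew_add_mul)
  qed
qed (simp_all add: skew_add_carr skew_smul_carr skew_adj_carr skew_mul_carr skew_mul_assoc skew_mul_add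
    skew_add_mul skew_smul_mul skew_mul_smul skew_adj_mul, simp_all add: skew_simps algebra_simps)

lemma skew_seminorm_bounded: "seminorm_bounded S"
  unfolding seminorm_bounded_def
proof
  interpret star_algebra S by (rule skew_star_algebra)
  have unit1: "q (unt S) \<le> 1" if q: "cstar_seminorm S q" for q
  proof -
    have "q (unt S) = (q (unt S))\<^sup>2"
      using q unt_mul[OF unt_closed] adj_unt unt_closed unfolding cstar_seminorm_def by metis
    then have "q (unt S) = 0 \<or> q (unt S) = 1" by (simp add: power2_eq_square)
    then show ?thesis by auto
  qed
  have unitary: "q u \<le> 1" if q: "cstar_seminorm S q" and u: "u \<in> carr S" "mul S (adj S u) u = unt S" for q u
  proof -
    have "(q u)\<^sup>2 \<le> 1" using q u unit1[OF q] unfolding cstar_seminorm_def by metis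
    then show ?thesis by (simp add: abs_square_le_1)
  qed
  fix a assume "a \<in> carr S"
  then show "\<exists>K. \<forall>q. cstar_seminorm S q \<longrightarrow> q a \<le> K"
  proof (induction rule: skew_induct)
    case (add b c)
    then obtain K L where K: "\<And>q. cstar_seminorm S q \<Longrightarrow> q b \<le> K"
      and L: "\<And>q. cstar_seminorm S q \<Longrightarrow> q c \<le> L" by blast
    have "q (add S b c) \<le> K + L" if q: "cstar_seminorm S q" for q
    proof -
      have "q (add S b c) \<le> q b + q c" using q add(1,2) by (simp add: cstar_seminorm_def)
      then show ?thesis using K[OF q] L[OF q] by linarith
    qed
    then show ?case by blast
  next
    case (single w f)
    have "bounded (range f)"
      using dyn compact_continuous_image[OF single] compact_imp_bounded
      unfolding dynamical_system_def by blast
    then obtain M where M: "M > 0" "\<And>x. norm (f x) \<le> M" unfolding bounded_pos by auto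
    define g where "g x = f x / of_real M" for x
    define h where "h x = (norm (g x))\<^sup>2" for x
    define u where "u x = complex_of_real (h x) + \<i> * complex_of_real (sqrt (1 - (h x)\<^sup>2))" for x
    have gc: "continuous_on UNIV g" unfolding g_def using single M(1) by (intro continuous_intros) auto
    have hc: "continuous_on UNIV h" unfolding h_def by (intro continuous_intros gc)
    have uc: "continuous_on UNIV u" unfolding u_def by (intro continuous_intros hc)
    have g1: "norm (g x) \<le> 1" for x using M by (simp add: g_def norm_divide)
    have h1: "0 \<le> h x" "h x \<le> 1" for x using g1[of x] by (simp_all add: h_def power_le_one)
    have uu: "cnj (u x) * u x = 1" for x
    proof -
      have "(h x)\<^sup>2 \<le> 1" using h1[of x] by (simp add: power_le_one)
      then have "(h x)\<^sup>2 + (sqrt (1 - (h x)\<^sup>2))\<^sup>2 = 1" by simp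
      then show ?thesis by (simp add: u_def complex_eq_iff power2_eq_square)
    qed
    have "q (single w f) \<le> M" if q: "cstar_seminorm S q" for q
    proof -
      interpret seminormed_star_algebra S q
        by (intro seminormed_star_algebra.intro skew_star_algebra seminormed_star_algebra_axioms.intro q)
      have qw: "q (single w (\<lambda>x. 1)) \<le> 1"
        by (rule unitary[OF q]) (simp_all add: single_adj single_single skew_simps(2))
      have qu: "q (single 0 u) \<le> 1"
        by (rule unitary[OF q]) (simp_all add: single_adj single_single skew_simps(2) uc uu)
      have hu: "single 0 (\<lambda>x. complex_of_real (h x)) = smul S (1/2) (add S (single 0 u) (adj S (single 0 u)))"
        unfolding single_adj by (simp add: single_add single_smul) (simp add: u_def)
      have "q (single 0 (\<lambda>x. complex_of_real (h x))) = 1/2 * q (add S (single 0 u) (adj S (single 0 u)))"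
        unfolding hu by (subst q_smul) (simp_all add: uc norm_divide)
      also have "\<dots> \<le> 1/2 * (q (single 0 u) + q (adj S (single 0 u)))"
        by (intro mult_left_mono q_add) (simp_all add: uc)
      also have "\<dots> \<le> 1" using qu by (simp add: uc)
      finally have qh: "q (single 0 (\<lambda>x. complex_of_real (h x))) \<le> 1" .
      have hg: "mul S (adj S (single 0 g)) (single 0 g) = single 0 (\<lambda>x. complex_of_real (h x))"
      proof -
        have "cnj (g x) * g x = complex_of_real (h x)" for x
          unfolding h_def complex_norm_square by (rule mult.commute)
        then show ?thesis unfolding single_adj single_single by simp
      qed
      have "(q (single 0 g))\<^sup>2 \<le> 1" using q_cstar[OF single_carr[OF gc, of 0]] qh unfolding hg by simp
      then have qg: "q (single 0 g) \<le> 1" by (simp add: abs_square_le_1)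
      have "single w f = smul S (of_real M) (mul S (single 0 g) (single w (\<lambda>x. 1)))"
        using M(1) by (simp add: single_single single_smul) (simp add: g_def)
      then have "q (single w f) = M * q (mul S (single 0 g) (single w (\<lambda>x. 1)))"
        using M(1) gc by (simp add: q_smul)
      also have "\<dots> \<le> M * (q (single 0 g) * q (single w (\<lambda>x. 1)))"
        using M(1) gc by (intro mult_left_mono q_mul) simp_all
      also have "\<dots> \<le> M * (1 * 1)"
        using M(1) qg qw gc by (intro mult_left_mono mult_mono) simp_all
      finally show ?thesis by simp
    qed
    then show ?case by blast
  qed
qed

theorem crossed_product_cstar_algebra: "cstar_algebra (crossed_product \<phi>)"
  unfolding crossed_product_def by (rule enveloping_cstar_algebra[OF skew_star_algebra skew_seminorm_bounded])

theorem crossed_product_covariant_pair: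
  "covariant_pair \<phi> (crossed_product \<phi>) (function_elem \<phi>) (unitary_elem \<phi>)"
proof -
  let ?E = "enveloping_cstar S" and ?e = "envelope_embed S"
  have hom: "star_hom S ?E ?e" and un: "?e (unt S) = unt ?E"
    by (rule envelope_embed_hom[OF skew_star_algebra skew_seminorm_bounded])+
  have ea: "add ?E (?e a) (?e b) = ?e (add S a b)" "mul ?E (?e a) (?e b) = ?e (mul S a b)" 
     if "a \<in> carr S" "b \<in> carr S" for a b using hom that by (simp_all add: star_hom_def)
  have es: "smul ?E c (?e a) = ?e (smul S c a)" "adj ?E (?e a) = ?e (adj S a)" "?e a \<in> carr ?E"
     if "a \<in> carr S" for a c using hom that by (simp_all add: star_hom_def)
  have un': "unt ?E = ?e (single 0 (\<lambda>x. 1))" using un by (simp add: skew_simps)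
  show ?thesis
    unfolding covariant_pair_def crossed_product_def function_elem_def unitary_elem_def un' star_hom_def function_algebra_def
    by (simp add: ea es single_adj single_single single_add single_smul
        continuous_on_mult continuous_on_add continuous_on_cnj cont_phi comp_def)
qed

text \<open>Every element is a norm limit of finite sums of elements \<open>f U\<^sup>w\<close>.\<close>

theorem crossed_product_generated:
  assumes "x \<in> carr (crossed_product \<phi>)" "e > 0"
  shows "\<exists>a\<in>carr S. nrm (crossed_product \<phi>)
           (sub (crossed_product \<phi>) x (envelope_embed S a)) < e"
  using envelope_embed_hom(3)[OF skew_star_algebra skew_seminorm_bounded] assms
  unfolding crossed_product_def .

lemma function_algebra_star_algebra: "star_algebra (function_algebra :: ('x \<Rightarrow> complex) star_algebra)"
  by unfold_locales (auto simp: function_algebra_def algebra_simps continuous_on_mult continuous_on_add continuous_on_cnj)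

theorem crossed_product_universal:
  fixes B :: "('b, 'n) cstar_algebra_scheme"
  assumes B: "cstar_algebra B" and cov: "covariant_pair \<phi> B \<pi> V"
  shows "\<exists>\<Phi>. star_hom (crossed_product \<phi>) B \<Phi> \<and>
           (\<forall>f. continuous_on UNIV f \<longrightarrow> \<Phi> (function_elem \<phi> f) = \<pi> f) \<and>
           (\<forall>w. \<Phi> (unitary_elem \<phi> w) = V w)"
proof -
  interpret B: cstar_algebra B by (rule B)
  have \<pi>: "\<pi> f \<in> carr B" "\<pi> (\<lambda>x. c * f x) = smul B c (\<pi> f)" "\<pi> (\<lambda>x. cnj (f x)) = adj B (\<pi> f)"
    if "continuous_on UNIV f" for f c
    using cov that by (simp_all add: covariant_pair_def star_hom_def function_algebra_def)
  have \<pi>2: "\<pi> (\<lambda>x. f x + g x) = add B (\<pi> f) (\<pi> g)" "\<pi> (\<lambda>x. f x * g x) = mul B (\<pi> f) (\<pi> g)"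
    if "continuous_on UNIV f" "continuous_on UNIV g" for f g
    using cov that by (simp_all add: covariant_pair_def star_hom_def function_algebra_def)
  have \<pi>1: "\<pi> (\<lambda>x. 1) = unt B" using cov by (simp add: covariant_pair_def)
  have \<pi>0: "\<pi> (\<lambda>x. 0) = zer B" using \<pi>(2)[of "\<lambda>x. 0" 0] \<pi>(1)[of "\<lambda>x. 0"] by simp
  have V: "V z \<in> carr B" "mul B (V z) (adj B (V z)) = unt B" "mul B (adj B (V z)) (V z) = unt B"
    "mul B (V z) (V w) = V (z + w)" "V 0 = unt B" for z w
    using cov by (simp_all add: covariant_pair_def)
  note [simp] = V(1)
  have Vadj: "adj B (V z) = V (- z)" for z
  proof -
    have "adj B (V z) = mul B (adj B (V z)) (mul B (V z) (V (- z)))" by (simp add: V)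
    also have "\<dots> = mul B (mul B (adj B (V z)) (V z)) (V (- z))" by (simp add: B.mul_assoc)
    finally show ?thesis by (simp add: V)
  qed
  have comm: "mul B (V z) (\<pi> f) = mul B (\<pi> (\<lambda>x. f (\<phi> (- z) x))) (V z)" if f: "continuous_on UNIV f" for z f
  proof -
    have "mul B (V z) (\<pi> f) = mul B (mul B (V z) (\<pi> f)) (mul B (adj B (V z)) (V z))"
      using f by (simp add: V \<pi>)
    also have "\<dots> = mul B (mul B (mul B (V z) (\<pi> f)) (adj B (V z))) (V z)"
      using f by (simp add: B.mul_assoc \<pi>)
    also have "mul B (mul B (V z) (\<pi> f)) (adj B (V z)) = \<pi> (f \<circ> \<phi> (- z))"
      using cov f by (simp add: covariant_pair_def)
    finally show ?thesis by (simp add: comp_def)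
  qed
  define M where "M = \<lparr>carrier = carr B, monoid.mult = add B, one = zer B\<rparr>"
  interpret M: comm_monoid M
    by (rule comm_monoidI) (simp_all add: M_def B.add_assoc, simp add: B.add_comm)
  have Msimps [simp]: "carrier M = carr B" "monoid.mult M = add B" "one M = zer B" by (simp_all add: M_def)
  define t where "t a z = mul B (\<pi> (a z)) (V z)" for a z
  define \<Phi> where "\<Phi> a = finprod M (t a) (supp a)" for a
  have tc: "t a z \<in> carr B" if "a \<in> carr S" for a z using that by (simp add: t_def \<pi> skew_carr)
  have zmul: "mul B (zer B) y = zer B" if "y \<in> carr B" for y
    using B.smul_mul[OF B.zer_closed that, of 0] that by simp
  have \<Phi>F: "\<Phi> a = finprod M (t a) F" if "a \<in> carr S" "finite F" "supp a \<subseteq> F" for a F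
    unfolding \<Phi>_def
  proof (rule M.finprod_mono_neutral_cong_left[OF that(2,3)])
    show "t a z = \<one>\<^bsub>M\<^esub>" if "z \<in> F - supp a" for z
      using that by (simp add: t_def \<pi>0 zmul)
  qed (use that tc in auto)
  have \<Phi>c: "\<Phi> a \<in> carr B" if "a \<in> carr S" for a
    using M.finprod_closed[of "t a" "supp a"] tc[OF that] by (simp add: \<Phi>_def Pi_def)
  have \<Phi>s: "\<Phi> (single w f) = mul B (\<pi> f) (V w)" if f: "continuous_on UNIV f" for w f
  proof -
    have "t (single w f) w = mul B (\<pi> f) (V w)" by (simp add: t_def single_def)
    then show ?thesis
      using \<Phi>F[OF single_carr[OF f] _ single_supp, of w] M.finprod_insert[of "{}" w "t (single w f)"] f \<pi>
      by simp
  qed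
  have \<Phi>a: "\<Phi> (add S a b) = add B (\<Phi> a) (\<Phi> b)" if "a \<in> carr S" "b \<in> carr S" for a b
  proof -
    let ?F = "supp a \<union> supp b"
    have F: "finite ?F" using that by (simp add: skew_carr)
    have s: "supp (add S a b) \<subseteq> ?F" by (auto simp: skew_simps)
    have t: "t (add S a b) z = add B (t a z) (t b z)" for z
      using that by (simp add: t_def skew_simps \<pi> \<pi>2 B.add_mul skew_carr)
    have "\<Phi> (add S a b) = finprod M (\<lambda>z. add B (t a z) (t b z)) ?F"
      unfolding \<Phi>F[OF skew_add_carr[OF that] F s] t[abs_def] ..
    also have "\<dots> = add B (finprod M (t a) ?F) (finprod M (t b) ?F)"
      using M.finprod_multf[of "t a" ?F "t b"] tc that by (simp add: Pi_def)
    also have "\<dots> = add B (\<Phi> a) (\<Phi> b)"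
      using \<Phi>F[OF that(1) F] \<Phi>F[OF that(2) F] by simp
    finally show ?thesis .
  qed
  have hom: "star_hom S B \<Phi>"
    unfolding star_hom_def
  proof (intro conjI ballI allI)
    fix a c assume a: "a \<in> carr S"
    show "\<Phi> a \<in> carr B" by (rule \<Phi>c[OF a])
    show "\<Phi> (smul S c a) = smul B c (\<Phi> a)" using a
    proof (induction rule: skew_induct)
      case (single w f)
      then show ?case by (simp add: single_smul \<Phi>s \<pi> B.smul_mul continuous_on_mult_left)
    next
      case (add a b)
      have "smul S c (add S a b) = add S (smul S c a) (smul S c b)"
        using add by (intro star_algebra.smul_add[OF skew_star_algebra])
      then show ?case using add by (simp add: \<Phi>a \<Phi>c skew_smul_carr B.smul_add)
    qed
    show "\<Phi> (adj S a) = adj B (\<Phi> a)" using a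
    proof (induction rule: skew_induct)
      case (single w f)
      note f = \<open>continuous_on UNIV f\<close>
      have f': "continuous_on UNIV (\<lambda>x. cnj (f x))" using f by (rule continuous_on_cnj)
      have "adj B (mul B (\<pi> f) (V w)) = mul B (V (- w)) (\<pi> (\<lambda>x. cnj (f x)))"
        using f by (simp add: \<pi> B.adj_mul Vadj)
      also have "\<dots> = mul B (\<pi> (\<lambda>x. cnj (f (\<phi> w x)))) (V (- w))"
        using comm[OF f', of "- w"] by simp
      finally show ?case
        using f \<Phi>s[OF cont_phi[OF f'], of "- w"] by (simp add: single_adj \<Phi>s)
    next
      case (add a b)
      then show ?case by (simp add: skew_adj_add \<Phi>a \<Phi>c skew_adj_carr B.adj_add)
    qed
    fix b assume b: "b \<in> carr S"
    show "\<Phi> (add S a b) = add B (\<Phi> a) (\<Phi> b)" by (rule \<Phi>a[OF a b])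
    show "\<Phi> (mul S a b) = mul B (\<Phi> a) (\<Phi> b)" using a
    proof (induction rule: skew_induct)
      case (single w f)
      show ?case using b
      proof (induction rule: skew_induct)
        case (single v g)
        note f = \<open>continuous_on UNIV f\<close> and g = \<open>continuous_on UNIV g\<close>
        have g': "continuous_on UNIV (\<lambda>x. g (\<phi> (- w) x))" by (rule cont_phi[OF g])
        have "mul B (mul B (\<pi> f) (V w)) (mul B (\<pi> g) (V v)) = mul B (\<pi> f) (mul B (mul B (V w) (\<pi> g)) (V v))"
          using f g by (simp add: B.mul_assoc \<pi>)
        also have "\<dots> = mul B (mul B (\<pi> f) (\<pi> (\<lambda>x. g (\<phi> (- w) x)))) (mul B (V w) (V v))"
          unfolding comm[OF g] using f g g' by (simp add: B.mul_assoc \<pi> del: V(4))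
        finally show ?case
          using f g g' by (simp add: single_single \<Phi>s \<pi>2 V(4) continuous_on_mult)
      next
        case (add b b')
        then show ?case using single
          by (simp add: skew_mul_add \<Phi>a \<Phi>c skew_mul_carr B.mul_add)
      qed
    next
      case (add a a')
      then show ?case using b by (simp add: skew_add_mul \<Phi>a \<Phi>c skew_mul_carr B.add_mul)
    qed
  qed
  from enveloping_cstar_universal[OF skew_star_algebra skew_seminorm_bounded B hom]
  obtain \<Psi> where \<Psi>: "star_hom (enveloping_cstar S) B \<Psi>" "\<And>a. a \<in> carr S \<Longrightarrow> \<Psi> (envelope_embed S a) = \<Phi> a" by blast
  show ?thesis
    by (rule exI[of _ \<Psi>])
      (use \<Psi> in \<open>simp add: crossed_product_def function_elem_def unitary_elem_def \<Phi>s \<pi> \<pi>1 V(5)\<close>)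
qed

end

end

theory Submission
  imports Defs
begin

text \<open>Write \<open>S\<close> for the skew group algebra. Its universal seminorm \<open>u\<close> is determined by the
  coefficients: if a C*-seminorm \<open>q\<close> dominates every coefficient, then \<open>u (h ^ n)\<close> is at most the
  number of nonzero coefficients of \<open>h ^ n\<close> times \<open>q (h ^ n)\<close>, and this number grows polynomially, so
  \<open>u \<le> q\<close>. With the GNS seminorm of the states \<open>a \<mapsto> a\<^sub>0(x)\<close> as \<open>q\<close>, this shows that elements of the
  crossed product are determined by their coefficients.

  A bounded orbit injection \<open>\<theta>\<close> identifies \<open>S \<phi>\<close> with the corner \<open>p (S \<psi>) p\<close>, where \<open>p\<close> is the
  indicator of the range of \<open>\<theta>\<close>, by relabelling coefficients along orbits. The relabelling is
  isometric by the previous remark, since the universal seminorm of \<open>S \<psi>\<close>, pulled back to \<open>S \<phi>\<close>,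
  dominates the coefficients.

  Conversely, \<open>C(X)\<close> is maximal abelian by freeness, so \<open>\<alpha>\<close> maps it onto \<open>C(Y)\<close> for a clopen set \<open>Y\<close>
  and is dual to a homeomorphism \<open>\<theta>\<close> from \<open>X\<close> to \<open>Y\<close>. The images of the unitaries normalize \<open>C(Y)\<close>, so
  their nonvanishing coefficients show where \<open>\<theta>\<close> sends the translates of a point, and the supports of
  these coefficients are open: the cocycle is continuous.\<close>


section \<open>The GNS seminorm of a family of positive functionals\<close>

text \<open>The assumption \<open>\<tau>_bounded\<close> says that left multiplication by an element
  is bounded on all GNS spaces, with a bound independent of \<open>i\<close>. It makes the supremum
  of the operator norms finite.\<close>

locale positive_functionals = star_algebra A for A :: "('a, 'm) star_algebra_scheme" +
  fixes \<tau> :: "'i \<Rightarrow> 'a \<Rightarrow> complex"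
  assumes \<tau>_add: "\<lbrakk>x \<in> carr A; y \<in> carr A\<rbrakk> \<Longrightarrow> \<tau> i (add A x y) = \<tau> i x + \<tau> i y"
    and \<tau>_smul: "x \<in> carr A \<Longrightarrow> \<tau> i (smul A c x) = c * \<tau> i x"
    and \<tau>_adj: "x \<in> carr A \<Longrightarrow> \<tau> i (adj A x) = cnj (\<tau> i x)"
    and \<tau>_pos: "x \<in> carr A \<Longrightarrow> 0 \<le> Re (\<tau> i (mul A (adj A x) x))"
    and \<tau>_bounded: "x \<in> carr A \<Longrightarrow> \<exists>K. \<forall>i. \<forall>b\<in>carr A.
          Re (\<tau> i (mul A (adj A (mul A x b)) (mul A x b))) \<le> K * Re (\<tau> i (mul A (adj A b) b))"
begin

text \<open>The GNS inner product, conjugate linear in its first argument. Null vectors are not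
  divided out, so \<open>hnorm\<close> is only a seminorm.\<close>

definition inner where "inner i c b = \<tau> i (mul A (adj A c) b)"
definition hnorm where "hnorm i b = sqrt (Re (inner i b b))"

lemma inner_pos: "b \<in> carr A \<Longrightarrow> 0 \<le> Re (inner i b b)"
  by (simp add: inner_def \<tau>_pos)

lemma hnorm_nonneg: "b \<in> carr A \<Longrightarrow> 0 \<le> hnorm i b"
  by (simp add: hnorm_def inner_pos)

lemma hnorm_sq: "b \<in> carr A \<Longrightarrow> (hnorm i b)\<^sup>2 = Re (inner i b b)"
  by (simp add: hnorm_def inner_pos)

lemma inner_add_left: "\<lbrakk>a \<in> carr A; b \<in> carr A; c \<in> carr A\<rbrakk> \<Longrightarrow> inner i (add A a b) c = inner i a c + inner i b c"
  and inner_add_right: "\<lbrakk>a \<in> carr A; b \<in> carr A; c \<in> carr A\<rbrakk> \<Longrightarrow> inner i c (add A a b) = inner i c a + inner i c b"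
  and inner_smul_left: "\<lbrakk>a \<in> carr A; b \<in> carr A\<rbrakk> \<Longrightarrow> inner i (smul A k a) b = cnj k * inner i a b"
  and inner_smul_right: "\<lbrakk>a \<in> carr A; b \<in> carr A\<rbrakk> \<Longrightarrow> inner i a (smul A k b) = k * inner i a b"

  and inner_mul: "\<lbrakk>a \<in> carr A; b \<in> carr A; c \<in> carr A\<rbrakk> \<Longrightarrow> inner i (mul A a b) c = inner i b (mul A (adj A a) c)"
  unfolding inner_def
  by (simp_all add: adj_add add_mul mul_add \<tau>_add adj_smul smul_mul mul_smul \<tau>_smul adj_mul mul_assoc)

lemma inner_cnj: "\<lbrakk>a \<in> carr A; b \<in> carr A\<rbrakk> \<Longrightarrow> inner i b a = cnj (inner i a b)"
  unfolding inner_def using \<tau>_adj[of "mul A (adj A a) b" i] by (simp add: adj_mul)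

text \<open>With \<open>s\<close> the inner product of \<open>c\<close> and \<open>b\<close>, the
  vector b - l s c has nonnegative squared length for every real \<open>l\<close>. This is a
  polynomial in \<open>l\<close> of degree at most two, and a suitable \<open>l\<close> gives the
  bound.\<close>

lemma cauchy_schwarz:
  assumes b: "b \<in> carr A" and c: "c \<in> carr A"
  shows "norm (inner i c b) \<le> hnorm i c * hnorm i b"
proof -
  define s where "s = inner i c b"
  define B where "B = Re (inner i b b)"
  define C where "C = Re (inner i c c)"
  have quad: "0 \<le> B - 2 * l * (norm s)\<^sup>2 + l\<^sup>2 * (norm s)\<^sup>2 * C" for l :: real
  proof -
    define k where "k = - (of_real l * s)"
    have e: "inner i b c = cnj s" unfolding s_def by (rule inner_cnj[OF c b])
    have Im: "Im (inner i c c) = 0" using inner_cnj[OF c c, of i] by (simp add: complex_eq_iff)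
    have ic: "inner i c c = of_real C" by (simp add: complex_eq_iff C_def Im)
    have "0 \<le> Re (inner i (add A b (smul A k c)) (add A b (smul A k c)))"
      using b c by (intro inner_pos) simp
    also have "inner i (add A b (smul A k c)) (add A b (smul A k c))
        = inner i b b + k * cnj s + cnj k * s + cnj k * k * of_real C"
      using b c by (simp add: inner_add_left inner_add_right inner_smul_left inner_smul_right e ic s_def[symmetric] algebra_simps)
    also have "Re \<dots> = B - 2 * l * (norm s)\<^sup>2 + l\<^sup>2 * (norm s)\<^sup>2 * C"
      unfolding cmod_power2 by (simp add: k_def B_def power2_eq_square algebra_simps)
    finally show ?thesis .
  qed
  have BC: "B \<ge> 0" "C \<ge> 0" using inner_pos b c by (auto simp: B_def C_def)
  have "(norm s)\<^sup>2 \<le> C * B"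
  proof (cases "C = 0")
    case True
    show ?thesis
    proof (rule ccontr)
      assume "\<not> ?thesis"
      then have p: "(norm s)\<^sup>2 > 0" using True by simp
      \<comment> \<open>For \<open>C = 0\<close> the polynomial is linear in \<open>l\<close>, and
        this \<open>l\<close> gives it the value -1.\<close>
      show False using quad[of "(B + 1) / (2 * (norm s)\<^sup>2)"] p True by (simp add: field_simps)
    qed
  next
    case False
    then have "C > 0" using BC by simp
    \<comment> \<open>The polynomial is smallest at \<open>l = 1 / C\<close>.\<close>
    then show ?thesis using quad[of "1 / C"] by (simp add: field_simps power2_eq_square)
  qed
  then have "sqrt ((norm s)\<^sup>2) \<le> sqrt (C * B)" by (rule real_sqrt_le_mono)
  then show ?thesis by (simp add: real_sqrt_mult hnorm_def B_def C_def s_def)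
qed

lemma Re_inner_le: "\<lbrakk>b \<in> carr A; c \<in> carr A\<rbrakk> \<Longrightarrow> Re (inner i c b) \<le> hnorm i c * hnorm i b"
  using complex_Re_le_cmod cauchy_schwarz by (rule order_trans)

lemma hnorm_triangle:
  assumes b: "b \<in> carr A" and c: "c \<in> carr A"
  shows "hnorm i (add A b c) \<le> hnorm i b + hnorm i c"
proof (rule power2_le_imp_le)
  have r: "Re (inner i b c) \<le> hnorm i b * hnorm i c" "Re (inner i c b) \<le> hnorm i c * hnorm i b"
    using Re_inner_le b c by blast+
  show "(hnorm i (add A b c))\<^sup>2 \<le> (hnorm i b + hnorm i c)\<^sup>2"
    using b c r by (simp add: power2_sum hnorm_sq inner_add_left inner_add_right mult.assoc)
      (simp add: mult.commute)
  show "0 \<le> hnorm i b + hnorm i c" using hnorm_nonneg b c by simp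
qed

lemma hnorm_smul: "b \<in> carr A \<Longrightarrow> hnorm i (smul A k b) = norm k * hnorm i b"
proof -
  assume b: "b \<in> carr A"
  have "Re (cnj k * (k * inner i b b)) = (norm k)\<^sup>2 * Re (inner i b b)"
    unfolding cmod_power2 by (simp add: power2_eq_square algebra_simps)
  then have "Re (inner i (smul A k b) (smul A k b)) = (norm k)\<^sup>2 * Re (inner i b b)"
    using b by (simp add: inner_smul_left inner_smul_right mult.left_commute)
  then show ?thesis by (simp add: hnorm_def real_sqrt_mult)
qed

definition dominates where
  "dominates K a \<longleftrightarrow> 0 \<le> K \<and> (\<forall>i. \<forall>b\<in>carr A. hnorm i (mul A a b) \<le> K * hnorm i b)"

text \<open>The supremum over \<open>i\<close> of the operator norms of left multiplication by
  \<open>a\<close> in the GNS representations. Written as an infimum of bounds, it needs no quotient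
  by null vectors.\<close>

definition gns_seminorm where "gns_seminorm a = Inf {K. dominates K a}"

lemma dominates_ex: assumes a: "a \<in> carr A" shows "\<exists>K. dominates K a"
proof -
  obtain K where K: "\<And>i b. b \<in> carr A \<Longrightarrow> Re (inner i (mul A a b) (mul A a b)) \<le> K * Re (inner i b b)"
    using \<tau>_bounded[OF a] unfolding inner_def by blast
  have "hnorm i (mul A a b) \<le> sqrt \<bar>K\<bar> * hnorm i b" if "b \<in> carr A" for i b
  proof -
    have "Re (inner i (mul A a b) (mul A a b)) \<le> \<bar>K\<bar> * Re (inner i b b)"
      using K[OF that, of i] inner_pos[OF that, of i] mult_right_mono[of K "\<bar>K\<bar>"]
      by (meson abs_ge_self order_trans)
    then show ?thesis unfolding hnorm_def real_sqrt_mult[symmetric] by (rule real_sqrt_le_mono)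
  qed
  then have "dominates (sqrt \<bar>K\<bar>) a" by (simp add: dominates_def)
  then show ?thesis by blast
qed

lemma gns_seminorm_le: "dominates K a \<Longrightarrow> gns_seminorm a \<le> K"
  unfolding gns_seminorm_def by (rule cInf_lower) (auto simp: dominates_def intro!: bdd_belowI[of _ 0])

text \<open>Where \<open>hnorm i b\<close> is positive one divides by it; where it is zero, any
  bound already forces \<open>hnorm i (mul A a b)\<close> to vanish. So the infimum is
  attained.\<close>

lemma gns_seminorm_dominates: assumes a: "a \<in> carr A" shows "dominates (gns_seminorm a) a"
  unfolding dominates_def
proof (intro conjI allI ballI)
  have ne: "{K. dominates K a} \<noteq> {}" using dominates_ex[OF a] by auto
  show "0 \<le> gns_seminorm a"
    unfolding gns_seminorm_def using ne by (rule cInf_greatest) (simp add: dominates_def)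
  fix i b assume b: "b \<in> carr A"
  show "hnorm i (mul A a b) \<le> gns_seminorm a * hnorm i b"
  proof (cases "hnorm i b = 0")
    case True
    moreover obtain K where "dominates K a" using dominates_ex[OF a] ..
    ultimately have "hnorm i (mul A a b) \<le> 0" using b unfolding dominates_def by (metis mult_zero_right)
    then show ?thesis using True by simp
  next
    case False
    then have p: "hnorm i b > 0" using hnorm_nonneg[OF b, of i] by simp
    have "hnorm i (mul A a b) / hnorm i b \<le> gns_seminorm a"
      unfolding gns_seminorm_def using ne
      by (rule cInf_greatest) (use p b in \<open>auto simp: dominates_def divide_le_eq\<close>)
    then show ?thesis using p by (simp add: divide_le_eq)
  qed
qed

lemma gns_seminorm_nonneg: "a \<in> carr A \<Longrightarrow> 0 \<le> gns_seminorm a"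
  using gns_seminorm_dominates by (simp add: dominates_def)

lemma hnorm_mul: "\<lbrakk>a \<in> carr A; b \<in> carr A\<rbrakk> \<Longrightarrow> hnorm i (mul A a b) \<le> gns_seminorm a * hnorm i b"
  using gns_seminorm_dominates by (simp add: dominates_def)

lemma gns_seminorm_leI:
  assumes "0 \<le> K" "\<And>i b. b \<in> carr A \<Longrightarrow> hnorm i (mul A a b) \<le> K * hnorm i b"
  shows "gns_seminorm a \<le> K"
  using assms by (intro gns_seminorm_le) (simp add: dominates_def)

lemma gns_smul_le: "a \<in> carr A \<Longrightarrow> gns_seminorm (smul A c a) \<le> norm c * gns_seminorm a"
  by (rule gns_seminorm_leI)
    (simp_all add: gns_seminorm_nonneg smul_mul hnorm_smul mult.assoc mult_left_mono hnorm_mul)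

text \<open>The square of \<open>h\<close>, the length of \<open>adj a\<close> times
  \<open>b\<close>, is the inner product of \<open>b\<close> with \<open>a\<close> applied to that
  vector. Cauchy-Schwarz bounds it by a multiple of \<open>h\<close>, and one factor
  \<open>h\<close> cancels.\<close>

lemma gns_adj_le: assumes a: "a \<in> carr A" shows "gns_seminorm (adj A a) \<le> gns_seminorm a"
proof (rule gns_seminorm_leI[OF gns_seminorm_nonneg[OF a]])
  fix i b assume b: "b \<in> carr A"
  define h where "h = hnorm i (mul A (adj A a) b)"
  have h0: "h \<ge> 0" using a b by (simp add: h_def hnorm_nonneg)
  have "h\<^sup>2 = Re (inner i b (mul A a (mul A (adj A a) b)))"
    using a b by (simp add: h_def hnorm_sq inner_mul)
  also have "\<dots> \<le> hnorm i b * hnorm i (mul A a (mul A (adj A a) b))"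
    using a b by (intro Re_inner_le) simp_all
  also have "\<dots> \<le> hnorm i b * (gns_seminorm a * h)"
    unfolding h_def using a b by (intro mult_left_mono hnorm_mul hnorm_nonneg) simp_all
  finally have "h * h \<le> (gns_seminorm a * hnorm i b) * h" by (simp add: power2_eq_square algebra_simps)
  moreover have "0 \<le> gns_seminorm a * hnorm i b" using a b by (simp add: gns_seminorm_nonneg hnorm_nonneg)
  ultimately show "h \<le> gns_seminorm a * hnorm i b"
    using h0 by (metis mult_right_le_imp_le order_le_less)
qed

text \<open>For the C*-identity, one direction is submultiplicativity and \<open>gns_adj_le\<close>.
  For the other, the squared length of \<open>a\<close> times \<open>b\<close> is the inner product
  of \<open>b\<close> with \<open>adj a\<close> times \<open>a\<close> times \<open>b\<close>, and
  Cauchy-Schwarz applies.\<close>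

lemma cstar_seminorm_gns: "cstar_seminorm A gns_seminorm"
  unfolding cstar_seminorm_def
proof (intro conjI ballI allI)
  fix a c assume a: "a \<in> carr A"
  show "0 \<le> gns_seminorm a" by (rule gns_seminorm_nonneg[OF a])
  show "gns_seminorm (smul A c a) = norm c * gns_seminorm a"
  proof (cases "c = 0")
    case True
    then show ?thesis using gns_smul_le[OF a, of 0] gns_seminorm_nonneg[OF smul_closed[OF a], of 0] by simp
  next
    case False
    \<comment> \<open>Scaling by \<open>inverse c\<close> undoes scaling by \<open>c\<close>, so
      \<open>gns_smul_le\<close> yields its own converse.\<close>
    have "gns_seminorm a \<le> norm (inverse c) * gns_seminorm (smul A c a)"
      using gns_smul_le[of "smul A c a" "inverse c"] a False by simp
    then have "norm c * gns_seminorm a \<le> gns_seminorm (smul A c a)"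
      using False by (simp add: norm_inverse norm_divide field_simps)
    then show ?thesis using gns_smul_le[OF a, of c] by simp
  qed
  show "gns_seminorm (mul A (adj A a) a) = (gns_seminorm a)\<^sup>2"
  proof (rule antisym)
    have "gns_seminorm (mul A (adj A a) a) \<le> gns_seminorm (adj A a) * gns_seminorm a"
    proof (rule gns_seminorm_leI)
      fix i b assume b: "b \<in> carr A"
      have "hnorm i (mul A (adj A a) (mul A a b)) \<le> gns_seminorm (adj A a) * (gns_seminorm a * hnorm i b)"
        using a b by (intro order_trans[OF hnorm_mul] mult_left_mono hnorm_mul gns_seminorm_nonneg) simp_all
      then show "hnorm i (mul A (mul A (adj A a) a) b) \<le> gns_seminorm (adj A a) * gns_seminorm a * hnorm i b"
        using a b by (simp add: mul_assoc mult.assoc)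
    qed (use a in \<open>simp add: gns_seminorm_nonneg\<close>)
    also have "\<dots> \<le> (gns_seminorm a)\<^sup>2"
      unfolding power2_eq_square using a by (intro mult_right_mono gns_adj_le gns_seminorm_nonneg)
    finally show "gns_seminorm (mul A (adj A a) a) \<le> (gns_seminorm a)\<^sup>2" .
    let ?r = "gns_seminorm (mul A (adj A a) a)"
    have r: "?r \<ge> 0" using a by (simp add: gns_seminorm_nonneg)
    have "gns_seminorm a \<le> sqrt ?r"
    proof (rule gns_seminorm_leI)
      fix i b assume b: "b \<in> carr A"
      have "(hnorm i (mul A a b))\<^sup>2 = Re (inner i b (mul A (mul A (adj A a) a) b))"
        using a b by (simp add: hnorm_sq inner_mul mul_assoc)
      also have "\<dots> \<le> hnorm i b * hnorm i (mul A (mul A (adj A a) a) b)"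
        using a b by (intro Re_inner_le) simp_all
      also have "\<dots> \<le> hnorm i b * (?r * hnorm i b)"
        using a b by (intro mult_left_mono hnorm_mul hnorm_nonneg) simp_all
      finally have "hnorm i (mul A a b) \<le> sqrt (hnorm i b * (?r * hnorm i b))" by (rule real_le_rsqrt)
      then show "hnorm i (mul A a b) \<le> sqrt ?r * hnorm i b"
        using hnorm_nonneg[OF b, of i]
        by (simp add: mult.left_commute[of "hnorm i b"] real_sqrt_mult)
    qed (simp add: r)
    then have "(gns_seminorm a)\<^sup>2 \<le> (sqrt ?r)\<^sup>2" using a by (intro power_mono gns_seminorm_nonneg)
    then show "(gns_seminorm a)\<^sup>2 \<le> ?r" using r by simp
  qed
  fix b assume b: "b \<in> carr A"
  show "gns_seminorm (add A a b) \<le> gns_seminorm a + gns_seminorm b"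
  proof (rule gns_seminorm_leI)
    fix i c assume c: "c \<in> carr A"
    have "hnorm i (add A (mul A a c) (mul A b c)) \<le> gns_seminorm a * hnorm i c + gns_seminorm b * hnorm i c"
      using a b c by (intro order_trans[OF hnorm_triangle] add_mono hnorm_mul) simp_all
    then show "hnorm i (mul A (add A a b) c) \<le> (gns_seminorm a + gns_seminorm b) * hnorm i c"
      using a b c by (simp add: add_mul algebra_simps)
  qed (use a b in \<open>simp add: gns_seminorm_nonneg\<close>)
  show "gns_seminorm (mul A a b) \<le> gns_seminorm a * gns_seminorm b"
  proof (rule gns_seminorm_leI)
    fix i c assume c: "c \<in> carr A"
    have "hnorm i (mul A a (mul A b c)) \<le> gns_seminorm a * (gns_seminorm b * hnorm i c)"
      using a b c by (intro order_trans[OF hnorm_mul] mult_left_mono hnorm_mul gns_seminorm_nonneg) simp_all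
    then show "hnorm i (mul A (mul A a b) c) \<le> gns_seminorm a * gns_seminorm b * hnorm i c"
      using a b c by (simp add: mul_assoc mult.assoc)
  qed (use a b in \<open>simp add: gns_seminorm_nonneg\<close>)
qed

end


section \<open>The universal seminorm and the coefficients\<close>

lemma card_vec_box: "finite {w :: int ^ 'd. \<forall>i. \<bar>w $ i\<bar> \<le> int N}"
  "card {w :: int ^ 'd. \<forall>i. \<bar>w $ i\<bar> \<le> int N} \<le> (2 * N + 1) ^ CARD('d)"
proof -
  let ?P = "PiE (UNIV :: 'd set) (\<lambda>_. {- int N .. int N})"
  have sub: "{w :: int ^ 'd. \<forall>i. \<bar>w $ i\<bar> \<le> int N} \<subseteq> vec_lambda ` ?P"
  proof
    fix w :: "int ^ 'd" assume "w \<in> {w. \<forall>i. \<bar>w $ i\<bar> \<le> int N}"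
    then have "vec_nth w \<in> ?P" by (force simp: abs_le_iff)
    then show "w \<in> vec_lambda ` ?P" by (metis image_eqI vec_nth_inverse)
  qed
  have fin: "finite ?P" by (intro finite_PiE) simp_all
  show "finite {w :: int ^ 'd. \<forall>i. \<bar>w $ i\<bar> \<le> int N}" using sub fin finite_subset by blast
  have "card {w :: int ^ 'd. \<forall>i. \<bar>w $ i\<bar> \<le> int N} \<le> card ?P"
    using card_mono[OF finite_imageI[OF fin] sub] card_image_le[OF fin] order_trans by blast
  also have "card ?P = (2 * N + 1) ^ CARD('d)" by (simp add: card_PiE nat_add_distrib nat_mult_distrib)
  finally show "card {w :: int ^ 'd. \<forall>i. \<bar>w $ i\<bar> \<le> int N} \<le> (2 * N + 1) ^ CARD('d)" .
qed

text \<open>If \<open>Q < P\<close>, let \<open>s\<close> be the \<open>d\<close>-th root of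
  \<open>Q / P\<close>, so \<open>s < 1\<close>. With n = 2^k the assumed bound says that C (n
  s^n)^d is at least 1, but n s^n tends to 0.\<close>

lemma le_if_power_le_poly_mult_power:
  fixes P Q C :: real
  assumes "0 \<le> P" "0 \<le> Q" and d: "d > 0"
    and le: "\<And>k. P ^ 2 ^ k \<le> C * (2 ^ k) ^ d * Q ^ 2 ^ k"
  shows "P \<le> Q"
proof (rule ccontr)
  assume "\<not> P \<le> Q"
  then have QP: "Q < P" by simp
  then have P: "P > 0" using assms by simp
  define s where "s = root d (Q / P)"
  have sd: "s ^ d = Q / P" using assms P d by (simp add: s_def)
  have "0 \<le> s" using assms P by (simp add: s_def)
  moreover have "s < 1" using QP P d by (simp add: s_def)
  ultimately have "(\<lambda>n. of_nat n * s ^ n) \<longlonglongrightarrow> 0" by (intro powser_times_n_limit_0) simp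
  then have "(\<lambda>k. of_nat (2 ^ k) * s ^ 2 ^ k) \<longlonglongrightarrow> 0"
    by (rule LIMSEQ_subseq_LIMSEQ[unfolded comp_def]) (simp add: strict_mono_def)
  then have "(\<lambda>k. C * (of_nat (2 ^ k) * s ^ 2 ^ k) ^ d) \<longlonglongrightarrow> C * 0 ^ d"
    by (intro tendsto_intros)
  then have "\<forall>\<^sub>F k in sequentially. C * (of_nat (2 ^ k) * s ^ 2 ^ k) ^ d < 1"
    using d by (intro order_tendstoD(2)[where y = "C * 0 ^ d"]) (simp_all add: zero_power)
  then obtain k where k: "C * (of_nat (2 ^ k) * s ^ 2 ^ k) ^ d < 1"
    using eventually_happens'[OF sequentially_bot] by blast
  have "(s ^ 2 ^ k) ^ d = (Q / P) ^ 2 ^ k" unfolding sd[symmetric] power_mult[symmetric] by (simp only: mult.commute)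
  then have "C * (2 ^ k) ^ d * (Q / P) ^ 2 ^ k < 1" using k by (simp add: power_mult_distrib mult.assoc)
  then have "C * (2 ^ k) ^ d * Q ^ 2 ^ k < P ^ 2 ^ k" using P by (simp add: power_divide divide_less_eq)
  then show False using le[of k] by simp
qed

section \<open>C*-seminorms on the skew group algebra\<close>

context zd_system begin

lemma supp_adj: "supp (adj S a) \<subseteq> uminus ` supp a"
proof
  fix z assume "z \<in> supp (adj S a)"
  then have "- z \<in> supp a" by (auto simp: skew_simps)
  then show "z \<in> uminus ` supp a" by (metis imageI minus_minus)
qed

lemma supp_mul: assumes "a \<in> carr S" shows "supp (mul S a b) \<subseteq> {w + v | w v. w \<in> supp a \<and> v \<in> supp b}"
proof
  fix z assume "z \<in> supp (mul S a b)"
  then obtain x where "mul S a b z x \<noteq> 0" by auto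
  moreover have "mul S a b z x = (\<Sum>w\<in>supp a. a w x * b (z - w) (\<phi> (- w) x))"
    using assms by (intro skew_mul) (simp_all add: skew_carr)
  ultimately obtain w where w: "w \<in> supp a" "a w x * b (z - w) (\<phi> (- w) x) \<noteq> 0"
    using sum.not_neutral_contains_not_neutral[of "\<lambda>w. a w x * b (z - w) (\<phi> (- w) x)" "supp a"] by auto
  then have "z - w \<in> supp b" by auto
  moreover have "z = w + (z - w)" by simp
  ultimately show "z \<in> {w + v | w v. w \<in> supp a \<and> v \<in> supp b}" using w(1) by blast
qed

lemma seminormed: "cstar_seminorm S q \<Longrightarrow> seminormed_star_algebra S q"
  by (intro seminormed_star_algebra.intro skew_star_algebra seminormed_star_algebra_axioms.intro)

text \<open>Up to scaling, the squared modulus \<open>h\<close> of \<open>f\<close> is the real part of the unitary function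
  \<open>h + i sqrt (1 - h\<^sup>2)\<close>.\<close>

lemma seminorm_single_le:
  assumes q: "cstar_seminorm S q" and f: "continuous_on UNIV f" and M: "\<And>x. norm (f x) \<le> M"
  shows "q (single w f) \<le> M"
proof -
  interpret seminormed_star_algebra S q by (rule seminormed[OF q])
  have M0: "0 \<le> M" using M norm_ge_zero order_trans by blast
  show ?thesis
  proof (cases "M = 0")
    case True
    then have "single w f = zer S" using M by (auto simp: single_def skew_simps fun_eq_iff)
    then show ?thesis using M0 by simp
  next
    case False
    then have Mp: "M > 0" using M0 by simp
    \<comment> \<open>The point is moved by \<open>\<phi> w\<close> because the product of the
      adjoint of \<open>single w f\<close> with \<open>single w f\<close> is the squared modulus of
      \<open>f\<close> composed with \<open>\<phi> w\<close>.\<close>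
    define h where "h x = (norm (f (\<phi> w x)) / M)\<^sup>2" for x
    define u where "u x = complex_of_real (h x) + \<i> * complex_of_real (sqrt (1 - (h x)\<^sup>2))" for x
    have hc: "continuous_on UNIV h" unfolding h_def using Mp by (intro continuous_intros cont_phi[OF f]) auto
    have uc: "continuous_on UNIV u" unfolding u_def by (intro continuous_intros hc)
    have h1: "0 \<le> h x" "h x \<le> 1" for x using M[of "\<phi> w x"] Mp by (simp_all add: h_def power_le_one)
    have uu: "cnj (u x) * u x = 1" for x
    proof -
      have "(h x)\<^sup>2 \<le> 1" using h1[of x] by (simp add: power_le_one)
      then have "(h x)\<^sup>2 + (sqrt (1 - (h x)\<^sup>2))\<^sup>2 = 1" by simp
      then show ?thesis by (simp add: u_def complex_eq_iff power2_eq_square)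
    qed
    \<comment> \<open>The seminorm \<open>q\<close> may vanish identically, so the unit has seminorm
      0 or 1.\<close>
    have "q (unt S) = (q (unt S))\<^sup>2" using q_cstar[OF unt_closed] by simp
    then have "q (unt S) = 0 \<or> q (unt S) = 1" by (simp add: power2_eq_square)
    then have "q (unt S) \<le> 1" by auto
    moreover have "mul S (adj S (single 0 u)) (single 0 u) = unt S"
      by (simp add: single_adj single_single uu skew_simps(2))
    ultimately have "(q (single 0 u))\<^sup>2 \<le> 1" using q_cstar[OF single_carr[OF uc, of 0]] by simp
    then have qu: "q (single 0 u) \<le> 1" by (simp add: abs_square_le_1)
    have hu: "single 0 (\<lambda>x. complex_of_real (h x)) = smul S (1/2) (add S (single 0 u) (adj S (single 0 u)))"
      unfolding single_adj by (simp add: single_add single_smul) (simp add: u_def)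
    have "q (single 0 (\<lambda>x. complex_of_real (h x))) = 1/2 * q (add S (single 0 u) (adj S (single 0 u)))"
      unfolding hu by (subst q_smul) (simp_all add: uc norm_divide)
    also have "\<dots> \<le> 1/2 * (q (single 0 u) + q (single 0 u))"
      using q_add[of "single 0 u" "adj S (single 0 u)"] uc by simp
    finally have qh: "q (single 0 (\<lambda>x. complex_of_real (h x))) \<le> 1" using qu by simp
    have "mul S (adj S (single w f)) (single w f) = smul S (of_real (M\<^sup>2)) (single 0 (\<lambda>x. complex_of_real (h x)))"
    proof -
      have "cnj (f (\<phi> w x)) * f (\<phi> w x) = of_real (M\<^sup>2) * complex_of_real (h x)" for x
        using Mp unfolding h_def by (simp add: power_divide mult.commute flip: complex_norm_square of_real_mult)
      then show ?thesis by (simp add: single_adj single_single single_smul)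
    qed
    then have "(q (single w f))\<^sup>2 = M\<^sup>2 * q (single 0 (\<lambda>x. complex_of_real (h x)))"
      using q_cstar[OF single_carr[OF f, of w]] hc
      by (simp add: q_smul continuous_on_of_real flip: of_real_power)
    also have "\<dots> \<le> M\<^sup>2" using qh by (simp add: mult_left_le)
    finally show ?thesis using M0 by (rule power2_le_imp_le)
  qed
qed

text \<open>One coefficient is split off at a time, and \<open>seminorm_single_le\<close> bounds
  each by \<open>M\<close>.\<close>

lemma seminorm_le_card:
  assumes q: "cstar_seminorm S q" and F: "finite F"
  shows "\<lbrakk>a \<in> carr S; supp a \<subseteq> F; \<And>w x. norm (a w x) \<le> M\<rbrakk> \<Longrightarrow> q a \<le> real (card F) * M"
  using F
proof (induction F arbitrary: a rule: finite_induct)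
  case empty
  interpret seminormed_star_algebra S q by (rule seminormed[OF q])
  have "a = zer S" using empty by (auto simp: skew_simps)
  then have "q a = 0" using q_zer by simp
  then show ?case by simp
next
  case (insert v F)
  interpret seminormed_star_algebra S q by (rule seminormed[OF q])
  have M0: "0 \<le> M" using insert.prems(3) norm_ge_zero order_trans by blast
  define b where "b = a(v := (\<lambda>x. 0))"
  have s: "supp b \<subseteq> supp a" "supp b \<subseteq> F" using insert.prems by (auto simp: b_def)
  have bc: "b \<in> carr S"
    using insert.prems(1) finite_subset[OF s(1)] unfolding skew_carr by (auto simp: b_def)
  have "q b \<le> real (card F) * M"
  proof (rule insert.IH[OF bc s(2)])
    show "norm (b w x) \<le> M" for w x using insert.prems(3) M0 by (simp add: b_def)
  qed
  moreover have av: "continuous_on UNIV (a v)" using insert.prems(1) by (simp add: skew_carr)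
  moreover have "q (single v (a v)) \<le> M" by (rule seminorm_single_le[OF q av insert.prems(3)])
  moreover have "a = add S b (single v (a v))"
    by (auto simp: skew_simps b_def single_def fun_eq_iff)
  moreover have "q (add S b (single v (a v))) \<le> q b + q (single v (a v))" by (rule q_add[OF bc single_carr[OF av]])
  ultimately show ?case using insert.hyps by (simp add: algebra_simps)
qed

text \<open>The \<open>n\<close>-th power of an element has at most polynomially many nonzero coefficients, and for
  self-adjoint \<open>h\<close> a C*-seminorm satisfies \<open>q (h ^ n) = q h ^ n\<close> whenever \<open>n\<close> is a power of two. So the
  trivial bound by the sum of the coefficient norms loses only a polynomial factor.\<close>

theorem seminorm_le_if_coefficients_le:
  assumes p: "cstar_seminorm S p" and q: "cstar_seminorm S q"
    and coef: "\<And>a w x. a \<in> carr S \<Longrightarrow> norm (a w x) \<le> q a"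
    and a: "a \<in> carr S"
  shows "p a \<le> q a"
proof -
  interpret p: seminormed_star_algebra S p by (rule seminormed[OF p])
  interpret q: seminormed_star_algebra S q by (rule seminormed[OF q])
  \<comment> \<open>Starting from \<open>a\<close>, each step multiplies an element from the left by
    its adjoint, so the C*-identity squares the seminorm at each step. The element \<open>a\<close>
    itself need not be self-adjoint.\<close>
  define h where "h = rec_nat a (\<lambda>_ b. mul S (adj S b) b)"
  have h0: "h 0 = a" and hS: "h (Suc k) = mul S (adj S (h k)) (h k)" for k by (simp_all add: h_def)
  have hc: "h k \<in> carr S" for k by (induction k) (simp_all add: h0 hS a)
  have ph: "p (h k) = p a ^ 2 ^ k" for k
    by (induction k) (simp_all add: h0 hS p.q_cstar hc power_mult[symmetric] mult.commute)
  have qh: "q (h k) = q a ^ 2 ^ k" for k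
    by (induction k) (simp_all add: h0 hS q.q_cstar hc power_mult[symmetric] mult.commute)
  define box where "box N = {w :: int ^ 'd. \<forall>i. \<bar>w $ i\<bar> \<le> int N}" for N
  have "finite (\<Union>i. (\<lambda>w. \<bar>w $ i\<bar>) ` supp a)" using a by (auto simp: skew_carr)
  then obtain M where M: "\<forall>n \<in> (\<Union>i. (\<lambda>w. \<bar>w $ i\<bar>) ` supp a). n \<le> M"
    using bdd_above_finite unfolding bdd_above_def by blast
  \<comment> \<open>A support point of the product is the sum of one of \<open>adj S (h k)\<close>
    and one of \<open>h k\<close>, and the box is symmetric, so its size doubles.\<close>
  have supp_h: "supp (h k) \<subseteq> box (2 ^ k * nat \<bar>M\<bar>)" for k
  proof (induction k)
    case 0
    have "\<bar>w $ i\<bar> \<le> \<bar>M\<bar>" if "w \<in> supp a" for w i using M that by (blast intro: order_trans[OF _ abs_ge_self])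
    then show ?case unfolding box_def h0 by auto
  next
    case (Suc k)
    show ?case
    proof
      fix z assume "z \<in> supp (h (Suc k))"
      then obtain w v where z: "z = w + v" and w: "w \<in> supp (adj S (h k))" and v: "v \<in> supp (h k)"
        unfolding hS using supp_mul[OF p.adj_closed[OF hc], of k "h k"] by blast
      from w have "- w \<in> supp (h k)" using supp_adj[of "h k"] by force
      then have "\<bar>w $ i\<bar> \<le> int (2 ^ k * nat \<bar>M\<bar>)" "\<bar>v $ i\<bar> \<le> int (2 ^ k * nat \<bar>M\<bar>)" for i
        using Suc v unfolding box_def by force+
      then have "\<bar>w $ i + v $ i\<bar> \<le> int (2 ^ k * nat \<bar>M\<bar>) + int (2 ^ k * nat \<bar>M\<bar>)" for i
        using abs_triangle_ineq add_mono order_trans by blast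
      then show "z \<in> box (2 ^ Suc k * nat \<bar>M\<bar>)" by (simp add: box_def z algebra_simps)
    qed
  qed
  define C where "C = (2 * nat \<bar>M\<bar> + 1) ^ CARD('d)"
  have "p a ^ 2 ^ k \<le> real C * (2 ^ k) ^ CARD('d) * q a ^ 2 ^ k" for k
  proof -
    let ?N = "2 ^ k * nat \<bar>M\<bar>"
    have "card (box ?N) \<le> (2 * ?N + 1) ^ CARD('d)" unfolding box_def by (rule card_vec_box)
    also have "\<dots> \<le> ((2 * nat \<bar>M\<bar> + 1) * 2 ^ k) ^ CARD('d)" by (intro power_mono) simp_all
    finally have "card (box ?N) \<le> C * (2 ^ k) ^ CARD('d)" unfolding C_def power_mult_distrib .
    then have "real (card (box ?N)) \<le> real (C * (2 ^ k) ^ CARD('d))" by (simp only: of_nat_le_iff)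
    then have "real (card (box ?N)) \<le> real C * (2 ^ k) ^ CARD('d)" by simp
    moreover have "p (h k) \<le> real (card (box ?N)) * q (h k)"
      by (rule seminorm_le_card[OF p _ hc supp_h coef[OF hc]]) (simp only: box_def card_vec_box(1))
    moreover have "0 \<le> q (h k)" using hc by simp
    ultimately show ?thesis unfolding ph qh using mult_right_mono order_trans by blast
  qed
  then show ?thesis
    by (rule le_if_power_le_poly_mult_power[rotated 3]) (simp_all add: a)
qed

section \<open>The regular representation\<close>

text \<open>Identifies the GNS space of the state at \<open>x\<close> with square-summable functions
  on the orbit of \<open>x\<close>: the vector \<open>b\<close> becomes the function with value
  \<open>b w (\<phi> w x)\<close> at \<open>w\<close>.\<close>

lemma state_formula:
  assumes F: "finite F" "supp b \<subseteq> F"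
  shows "mul S (adj S b) b 0 x = of_real (\<Sum>w\<in>F. (norm (b w (\<phi> w x)))\<^sup>2)"
proof -
  have s: "supp (adj S b) \<subseteq> uminus ` F" using supp_adj[of b] F(2) by blast
  have "mul S (adj S b) b 0 x = (\<Sum>w\<in>uminus ` F. adj S b w x * b (0 - w) (\<phi> (- w) x))"
    using F by (intro skew_mul s) simp
  also have "\<dots> = (\<Sum>w\<in>F. cnj (b w (\<phi> w x)) * b w (\<phi> w x))"
    by (subst sum.reindex) (simp_all add: skew_simps inj_on_def)
  also have "\<dots> = of_real (\<Sum>w\<in>F. (norm (b w (\<phi> w x)))\<^sup>2)"
    unfolding of_real_sum complex_norm_square by (simp add: mult.commute)
  finally show ?thesis .
qed

text \<open>Positivity is \<open>state_formula\<close>. For boundedness, \<open>single v f\<close>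
  acts on the functions on an orbit as a shift followed by multiplication with values of
  \<open>f\<close>, and sums are handled by |s + t|^2 <= 2 |s|^2 + 2 |t|^2.\<close>

lemma positive_functionals: "positive_functionals S (\<lambda>x a. a 0 x)"
proof (intro positive_functionals.intro skew_star_algebra positive_functionals_axioms.intro)
  fix x c and a b :: "int ^ 'd \<Rightarrow> 'x \<Rightarrow> complex"
  show "add S a b 0 x = a 0 x + b 0 x" "smul S c a 0 x = c * a 0 x" "adj S a 0 x = cnj (a 0 x)"
    by (simp_all add: skew_simps)
  interpret star_algebra S by (rule skew_star_algebra)
  let ?N = "\<lambda>b x. Re (mul S (adj S b) b 0 x)"
  assume a: "a \<in> carr S"
  have N: "?N b x = (\<Sum>w\<in>F. (norm (b w (\<phi> w x)))\<^sup>2)" if "finite F" "supp b \<subseteq> F" for F b x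
    using state_formula[OF that] by simp
  show "0 \<le> ?N a x" using a by (subst N[OF _ subset_refl]) (auto simp: skew_carr intro: sum_nonneg)
  show "\<exists>K. \<forall>x. \<forall>b\<in>carr S. ?N (mul S a b) x \<le> K * ?N b x"
    using a
  proof (induction rule: skew_induct)
    case (single v f)
    have "bounded (range f)"
      using dyn compact_continuous_image[OF single] compact_imp_bounded
      unfolding dynamical_system_def by blast
    then obtain M where M: "M > 0" "\<And>x. norm (f x) \<le> M" unfolding bounded_pos by auto
    have "?N (mul S (single v f) b) x \<le> M\<^sup>2 * ?N b x" if b: "b \<in> carr S" for b x
    proof -
      have F: "finite (supp b)" using b by (simp add: skew_carr)
      have s: "supp (mul S (single v f) b) \<subseteq> (\<lambda>w. w + v) ` supp b"
      proof
        fix z assume "z \<in> supp (mul S (single v f) b)"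
        then have "z - v \<in> supp b" unfolding single_mul by auto
        then show "z \<in> (\<lambda>w. w + v) ` supp b" by (intro image_eqI[of _ _ "z - v"]) simp_all
      qed
      have "?N (mul S (single v f) b) x = (\<Sum>w\<in>supp b. (norm (f (\<phi> (w + v) x) * b w (\<phi> w x)))\<^sup>2)"
        unfolding N[OF finite_imageI[OF F] s] by (subst sum.reindex) (simp_all add: single_mul)
      also have "\<dots> \<le> (\<Sum>w\<in>supp b. M\<^sup>2 * (norm (b w (\<phi> w x)))\<^sup>2)"
        using M by (intro sum_mono) (simp add: norm_mult power_mult_distrib mult_right_mono power_mono)
      also have "\<dots> = M\<^sup>2 * ?N b x"
        unfolding N[OF F subset_refl] by (rule sum_distrib_left[symmetric])
      finally show ?thesis .
    qed
    then show ?case by blast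
  next
    case (add a a')
    then obtain K L where K: "\<And>x b. b \<in> carr S \<Longrightarrow> ?N (mul S a b) x \<le> K * ?N b x"
      and L: "\<And>x b. b \<in> carr S \<Longrightarrow> ?N (mul S a' b) x \<le> L * ?N b x" by blast
    have "?N (mul S (add S a a') b) x \<le> (2 * K + 2 * L) * ?N b x" if b: "b \<in> carr S" for b x
    proof -
      define s t where "s = mul S a b" and "t = mul S a' b"
      let ?F = "supp s \<union> supp t"
      have F: "finite ?F" using add b mul_closed unfolding s_def t_def by (auto simp: skew_carr)
      have "?N (add S s t) x = (\<Sum>w\<in>?F. (norm (s w (\<phi> w x) + t w (\<phi> w x)))\<^sup>2)"
        by (subst N[OF F]) (auto simp: skew_simps)
      also have "\<dots> \<le> (\<Sum>w\<in>?F. 2 * (norm (s w (\<phi> w x)))\<^sup>2 + 2 * (norm (t w (\<phi> w x)))\<^sup>2)"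
      proof (rule sum_mono)
        fix w
        have "(norm (s w (\<phi> w x) + t w (\<phi> w x)))\<^sup>2 \<le> (norm (s w (\<phi> w x)) + norm (t w (\<phi> w x)))\<^sup>2"
          by (intro power_mono norm_triangle_ineq norm_ge_zero)
        also have "\<dots> \<le> 2 * (norm (s w (\<phi> w x)))\<^sup>2 + 2 * (norm (t w (\<phi> w x)))\<^sup>2"
          using sum_squares_bound[of "norm (s w (\<phi> w x))" "norm (t w (\<phi> w x))"] by (simp add: power2_sum)
        finally show "(norm (s w (\<phi> w x) + t w (\<phi> w x)))\<^sup>2
            \<le> 2 * (norm (s w (\<phi> w x)))\<^sup>2 + 2 * (norm (t w (\<phi> w x)))\<^sup>2" .
      qed
      also have "\<dots> = 2 * ?N s x + 2 * ?N t x"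
        by (subst (1 2) N[OF F]) (auto simp: sum.distrib sum_distrib_left)
      also have "\<dots> \<le> (2 * K + 2 * L) * ?N b x"
        using K[OF b, of x] L[OF b, of x] by (simp add: s_def t_def algebra_simps)
      finally show ?thesis using add b by (simp add: add_mul s_def t_def)
    qed
    then show ?case by blast
  qed
qed

sublocale regular: positive_functionals S "\<lambda>x a. a 0 x"
  by (rule positive_functionals)

text \<open>In the state at \<open>?y\<close> the unit is a vector of length 1. The element
  \<open>a\<close> maps it to a function on the orbit that has \<open>a w x\<close> among its
  values.\<close>

lemma coefficient_le_gns: assumes a: "a \<in> carr S" shows "norm (a w x) \<le> regular.gns_seminorm a"
proof -
  let ?y = "\<phi> (- w) x"
  have F: "finite (insert w (supp a))" using a by (simp add: skew_carr)
  have one: "regular.hnorm ?y (unt S) = 1"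
    unfolding regular.hnorm_def regular.inner_def by (simp, simp add: skew_simps single_def)
  have "(norm (a w x))\<^sup>2 = (norm (a w (\<phi> w ?y)))\<^sup>2" by simp
  also have "\<dots> \<le> (\<Sum>w\<in>insert w (supp a). (norm (a w (\<phi> w ?y)))\<^sup>2)"
    using F by (intro member_le_sum) simp_all
  also have "\<dots> = (regular.hnorm ?y a)\<^sup>2"
    using a state_formula[OF F, of a ?y] by (simp add: regular.hnorm_sq regular.inner_def subset_insertI)
  finally have "norm (a w x) \<le> regular.hnorm ?y a"
    by (rule power2_le_imp_le) (simp add: a regular.hnorm_nonneg)
  also have "\<dots> \<le> regular.gns_seminorm a * regular.hnorm ?y (unt S)"
    using regular.hnorm_mul[OF a regular.unt_closed, of ?y] a by simp
  finally show ?thesis by (simp add: one)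
qed

text \<open>For the group \<open>\<int>\<^sup>d\<close> the full and the reduced crossed product coincide.\<close>

lemma universal_eq_gns: assumes "a \<in> carr S" shows "universal_seminorm S a = regular.gns_seminorm a"
proof (rule antisym)
  show "universal_seminorm S a \<le> regular.gns_seminorm a"
    by (rule seminorm_le_if_coefficients_le[OF _ regular.cstar_seminorm_gns coefficient_le_gns assms])
      (rule cstar_seminorm_universal[OF skew_star_algebra skew_seminorm_bounded])
  show "regular.gns_seminorm a \<le> universal_seminorm S a"
    by (rule universal_seminorm_upper[OF skew_seminorm_bounded assms regular.cstar_seminorm_gns])
qed

end


section \<open>Coefficients in the crossed product\<close>

context zd_system begin

abbreviation "A \<equiv> crossed_product \<phi>"
abbreviation "emb \<equiv> envelope_embed S"

sublocale env: seminormed_star_algebra S "universal_seminorm S"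
  by (rule seminormed[OF cstar_seminorm_universal[OF skew_star_algebra skew_seminorm_bounded]])

sublocale crossed: cstar_algebra A
  by (rule crossed_product_cstar_algebra)

sublocale crossed: seminormed_star_algebra A "nrm A"
  by unfold_locales (rule crossed.cstar_norm)

lemma crossed_product_completion: "A = env.C"
  by (simp add: crossed_product_def enveloping_cstar_def)

lemma emb_cls: "emb a = env.cl (\<lambda>n. a)"
  by (simp add: envelope_embed_def)

lemma emb_hom: "star_hom S A emb"
  and emb_unt: "emb (unt S) = unt A"
  unfolding crossed_product_def by (rule envelope_embed_hom[OF skew_star_algebra skew_seminorm_bounded])+

lemma emb_simps:
  "a \<in> carr S \<Longrightarrow> emb a \<in> carr A"
  "\<lbrakk>a \<in> carr S; b \<in> carr S\<rbrakk> \<Longrightarrow> emb (add S a b) = add A (emb a) (emb b)"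
  "a \<in> carr S \<Longrightarrow> emb (smul S c a) = smul A c (emb a)"
  "\<lbrakk>a \<in> carr S; b \<in> carr S\<rbrakk> \<Longrightarrow> emb (mul S a b) = mul A (emb a) (emb b)"
  "a \<in> carr S \<Longrightarrow> emb (adj S a) = adj A (emb a)"
  using emb_hom by (simp_all add: star_hom_def)

lemma nrm_emb: "a \<in> carr S \<Longrightarrow> nrm A (emb a) = universal_seminorm S a"
  unfolding crossed_product_completion emb_cls by (rule env.nrm_C_const)

lemma emb_dense: "\<lbrakk>X \<in> carr A; e > 0\<rbrakk> \<Longrightarrow> \<exists>a\<in>carr S. nrm A (sub A X (emb a)) < e"
  by (rule crossed_product_generated)

text \<open>The continuous extension of the coefficient maps to the completion. For
  \<open>w = 0\<close> it is the conditional expectation onto C(X).\<close>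

definition coef :: "(nat \<Rightarrow> int ^ 'd \<Rightarrow> 'x \<Rightarrow> complex) set \<Rightarrow> int ^ 'd \<Rightarrow> 'x \<Rightarrow> complex" where
  "coef X w x = lim (\<lambda>n. rep X n w x)"

lemma coefficient_le_universal: "a \<in> carr S \<Longrightarrow> norm (a w x) \<le> universal_seminorm S a"
  using coefficient_le_gns universal_eq_gns by simp

lemma coefficient_diff_le:
  "\<lbrakk>a \<in> carr S; b \<in> carr S\<rbrakk> \<Longrightarrow> norm (a w x - b w x) \<le> universal_seminorm S (sub S a b)"
  using coefficient_le_universal[of "sub S a b" w x] by (simp, simp add: skew_simps)

text \<open>Coefficients are contractive for the universal seminorm. Hence they converge along
  Cauchy sequences, to the same limit for equivalent ones.\<close>

lemma coef_cls:
  assumes s: "env.cauchy s"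
  shows "(\<lambda>n. s n w x) \<longlonglongrightarrow> coef (env.cl s) w x"
proof -
  let ?r = "rep (env.cl s)"
  note r = env.rep_cls[OF s]
  have "Cauchy (\<lambda>n. ?r n w x)"
  proof (rule metric_CauchyI)
    fix e :: real assume "e > 0"
    then obtain N where N: "\<forall>m\<ge>N. \<forall>n\<ge>N. universal_seminorm S (sub S (?r m) (?r n)) < e"
      using r(1) unfolding cauchy_seq_def by blast
    have "dist (?r m w x) (?r n w x) < e" if "m \<ge> N" "n \<ge> N" for m n
      unfolding dist_norm
      using N that coefficient_diff_le[OF env.cauchyD[OF r(1)] env.cauchyD[OF r(1)]] le_less_trans by blast
    then show "\<exists>M. \<forall>m\<ge>M. \<forall>n\<ge>M. dist (?r m w x) (?r n w x) < e" by blast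
  qed
  then have lim: "(\<lambda>n. ?r n w x) \<longlonglongrightarrow> coef (env.cl s) w x"
    unfolding coef_def by (simp add: Cauchy_convergent_iff convergent_LIMSEQ_iff)
  have "(\<lambda>n. s n w x - ?r n w x) \<longlonglongrightarrow> 0"
  proof (rule Lim_null_comparison)
    show "\<forall>\<^sub>F n in sequentially. norm (s n w x - ?r n w x) \<le> universal_seminorm S (sub S (s n) (?r n))"
      using coefficient_diff_le[OF env.cauchyD[OF s] env.cauchyD[OF r(1)]] by simp
    show "(\<lambda>n. universal_seminorm S (sub S (s n) (?r n))) \<longlonglongrightarrow> 0"
      using r(2) by (simp add: env.null_def)
  qed
  from tendsto_add[OF this lim] show ?thesis by simp
qed

lemma coef_cls_eqI: "\<lbrakk>env.cauchy s; (\<lambda>n. s n w x) \<longlonglongrightarrow> l\<rbrakk> \<Longrightarrow> coef (env.cl s) w x = l"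
  using coef_cls LIMSEQ_unique by blast

lemma crossed_cases:
  assumes "X \<in> carr A" obtains s where "env.cauchy s" "X = env.cl s"
  using assms unfolding crossed_product_completion by (rule env.carr_CE)

lemma coef_emb: "a \<in> carr S \<Longrightarrow> coef (emb a) w x = a w x"
  unfolding emb_cls by (rule coef_cls_eqI) simp_all

lemma coef_norm: assumes "X \<in> carr A" shows "norm (coef X w x) \<le> nrm A X"
  using assms
proof (rule crossed_cases)
  fix s assume s: "env.cauchy s" "X = env.cl s"
  have "norm (coef (env.cl s) w x) \<le> nrm env.C (env.cl s)"
    by (rule LIMSEQ_le[OF tendsto_norm[OF coef_cls[OF s(1)]] env.nrm_C_lim[OF s(1)]])
      (auto intro: coefficient_le_universal env.cauchyD[OF s(1)])
  then show ?thesis using s crossed_product_completion by simp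
qed

lemma coef_add:
  assumes "X \<in> carr A" "Y \<in> carr A"
  shows "coef (add A X Y) w x = coef X w x + coef Y w x"
proof -
  obtain s where s: "env.cauchy s" "X = env.cl s" using assms(1) by (rule crossed_cases)
  obtain t where t: "env.cauchy t" "Y = env.cl t" using assms(2) by (rule crossed_cases)
  show ?thesis
    unfolding s(2) t(2) crossed_product_completion env.add_C[OF s(1) t(1)]
    using tendsto_add[OF coef_cls[OF s(1)] coef_cls[OF t(1)]]
    by (intro coef_cls_eqI env.cauchy_add s t) (simp add: skew_simps)
qed

lemma coef_smul:
  assumes "X \<in> carr A"
  shows "coef (smul A c X) w x = c * coef X w x"
proof -
  obtain s where s: "env.cauchy s" "X = env.cl s" using assms(1) by (rule crossed_cases)
  show ?thesis
    unfolding s(2) crossed_product_completion env.smul_C[OF s(1)]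
    using tendsto_mult_left[OF coef_cls[OF s(1)]]
    by (intro coef_cls_eqI env.cauchy_smul s) (simp add: skew_simps)
qed

lemma coef_sub: "\<lbrakk>X \<in> carr A; Y \<in> carr A\<rbrakk> \<Longrightarrow> coef (sub A X Y) w x = coef X w x - coef Y w x"
  by (simp add: coef_add coef_smul)

lemma coef_single_mul:
  assumes f: "continuous_on UNIV f" and X: "X \<in> carr A"
  shows "coef (mul A (emb (single v f)) X) z x = f x * coef X (z - v) (\<phi> (- v) x)"
proof -
  obtain s where s: "env.cauchy s" "X = env.cl s" using X by (rule crossed_cases)
  have c: "env.cauchy (\<lambda>n. single v f)" using f by simp
  show ?thesis
    unfolding s(2) crossed_product_completion emb_cls env.mul_C[OF c s(1)]
    using tendsto_mult_left[OF coef_cls[OF s(1)]]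
    by (intro coef_cls_eqI env.cauchy_mul c s) (simp add: single_mul)
qed

lemma mul_single:
  assumes b: "b \<in> carr S"
  shows "mul S b (single v f) z x = b (z - v) x * f (\<phi> (v - z) x)"
proof -
  have "mul S b (single v f) z x
      = (\<Sum>w\<in>insert (z - v) (supp b). b w x * single v f (z - w) (\<phi> (- w) x))"
    using b by (intro skew_mul) (auto simp: skew_carr)
  also have "\<dots> = (\<Sum>w\<in>{z - v}. b w x * single v f (z - w) (\<phi> (- w) x))"
    using b by (intro sum.mono_neutral_right) (auto simp: skew_carr single_def)
  also have "\<dots> = b (z - v) x * f (\<phi> (v - z) x)" by (simp add: single_def)
  finally show ?thesis .
qed

lemma coef_mul_single:
  assumes f: "continuous_on UNIV f" and X: "X \<in> carr A"
  shows "coef (mul A X (emb (single v f))) z x = coef X (z - v) x * f (\<phi> (v - z) x)"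
proof -
  obtain s where s: "env.cauchy s" "X = env.cl s" using X by (rule crossed_cases)
  have c: "env.cauchy (\<lambda>n. single v f)" using f by simp
  show ?thesis
    unfolding s(2) crossed_product_completion emb_cls env.mul_C[OF s(1) c]
    using tendsto_mult_right[OF coef_cls[OF s(1)]]
    by (intro coef_cls_eqI env.cauchy_mul c s) (simp add: mul_single env.cauchyD[OF s(1)])
qed

text \<open>Norm approximation by finite sums is uniform approximation of each coefficient by
  continuous functions.\<close>

lemma coef_continuous: assumes X: "X \<in> carr A" shows "continuous_on UNIV (coef X w)"
proof -
  have "\<exists>a\<in>carr S. nrm A (sub A X (emb a)) < inverse (real (Suc n))" for n
    using X by (intro emb_dense) simp_all
  then obtain a where a: "\<And>n. a n \<in> carr S" "\<And>n. nrm A (sub A X (emb (a n))) < inverse (real (Suc n))"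
    by metis
  have bound: "norm (a n w x - coef X w x) < inverse (real (Suc n))" for n x
    using coef_norm[of "sub A X (emb (a n))" w x] a(1)[of n] a(2)[of n] X
    by (simp add: coef_add coef_smul coef_emb emb_simps norm_minus_commute)
  have "uniform_limit UNIV (\<lambda>n. a n w) (coef X w) sequentially"
  proof (rule uniform_limitI)
    fix e :: real assume "e > 0"
    then obtain N where N: "inverse (real (Suc N)) < e" using reals_Archimedean by blast
    have "dist (a n w x) (coef X w x) < e" if "n \<ge> N" for n x
    proof -
      have "inverse (real (Suc n)) \<le> inverse (real (Suc N))" using that by (intro le_imp_inverse_le) simp_all
      then show ?thesis unfolding dist_norm using bound[of n x] N by linarith
    qed
    then show "\<forall>\<^sub>F n in sequentially. \<forall>x\<in>UNIV. dist (a n w x) (coef X w x) < e"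
      unfolding eventually_sequentially by blast
  qed
  moreover have "\<forall>\<^sub>F n in sequentially. continuous_on UNIV (a n w)"
    using a(1) by (simp add: skew_carr)
  ultimately show ?thesis using sequentially_bot by (intro uniform_limit_theorem)
qed

text \<open>Right multiplication by \<open>single v f\<close> only rescales and shifts the
  coefficients at a fixed point \<open>x\<close>, so their vanishing at this one point persists.
  Density of the finite sums extends this to all \<open>Y\<close>.\<close>

lemma coef_mul_zero:
  assumes X: "X \<in> carr A" and Y: "Y \<in> carr A" and zero: "\<And>w. coef X w x = 0"
  shows "coef (mul A X Y) z x = 0"
proof -
  have emb0: "coef (mul A X (emb b)) z x = 0" if "b \<in> carr S" for b z
    using that
  proof (induction rule: skew_induct)
    case (single v f)
    then show ?case using X by (simp add: coef_mul_single zero)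
  next
    case (add b c)
    then show ?case using X by (simp add: emb_simps crossed.mul_add coef_add)
  qed
  have "norm (coef (mul A X Y) z x) \<le> 0 + e" if e: "e > 0" for e
  proof -
    \<comment> \<open>Adding 1 keeps the denominator positive when \<open>X\<close> has norm
      0.\<close>
    have pos: "0 < e / (nrm A X + 1)" using e X by (simp add: add_nonneg_pos)
    obtain b where b: "b \<in> carr S" "nrm A (sub A Y (emb b)) < e / (nrm A X + 1)"
      using emb_dense[OF Y pos] by blast
    note [simp] = emb_simps(1)[OF b(1)] X Y
    have "sub A (mul A X Y) (mul A X (emb b)) = mul A X (sub A Y (emb b))"
      by (simp add: crossed.mul_add crossed.mul_smul)
    then have "norm (coef (mul A X Y) z x) = norm (coef (mul A X (sub A Y (emb b))) z x)"
      using coef_sub[of "mul A X Y" "mul A X (emb b)" z x] emb0[OF b(1)] by simp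
    also have "\<dots> \<le> nrm A (mul A X (sub A Y (emb b)))" by (intro coef_norm) simp
    also have "\<dots> \<le> nrm A X * nrm A (sub A Y (emb b))" by (intro crossed.q_mul) simp_all
    also have "\<dots> \<le> (nrm A X + 1) * (e / (nrm A X + 1))"
      using b(2) e by (intro mult_mono) simp_all
    also have "\<dots> = e" using crossed.q_nonneg[OF X] by (simp add: add_nonneg_eq_0_iff)
    finally show ?thesis by simp
  qed
  then have "norm (coef (mul A X Y) z x) \<le> 0" by (rule field_le_epsilon)
  then show ?thesis by simp
qed

text \<open>Left multiplication moves the point of evaluation, so here the coefficients vanish at
  all points.\<close>

lemma coef_emb_mul_zero:
  assumes X: "X \<in> carr A" and zero: "\<And>w x. coef X w x = 0" and c: "c \<in> carr S"
  shows "coef (mul A (emb c) X) z x = 0"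
  using c
proof (induction rule: skew_induct)
  case (single v f)
  then show ?case using X by (simp add: coef_single_mul zero)
next
  case (add b c)
  then show ?case using X by (simp add: emb_simps crossed.add_mul coef_add)
qed

text \<open>For finite sums in place of \<open>D\<close> this is Cauchy-Schwarz, since the universal
  seminorm is the GNS seminorm. Both sides pass to the limit.\<close>

lemma coef_inner_le:
  assumes D: "D \<in> carr A" and b: "b \<in> carr S" and c: "c \<in> carr S"
  shows "norm (coef (mul A (emb (adj S c)) (mul A D (emb b))) 0 x)
    \<le> nrm A D * (regular.hnorm x c * regular.hnorm x b)"
proof -
  obtain d where d: "env.cauchy d" "D = env.cl d" using D by (rule crossed_cases)
  have cb: "env.cauchy (\<lambda>n. adj S c)" "env.cauchy (\<lambda>n. b)" using b c by simp_all
  have e: "mul A (emb (adj S c)) (mul A D (emb b)) = env.cl (\<lambda>n. mul S (adj S c) (mul S (d n) b))"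
    unfolding d(2) crossed_product_completion emb_cls
    by (simp only: env.mul_C env.cauchy_mul d(1) cb)
  have le: "norm (mul S (adj S c) (mul S (d n) b) 0 x)
      \<le> universal_seminorm S (d n) * (regular.hnorm x c * regular.hnorm x b)" for n
  proof -
    have dn: "d n \<in> carr S" by (rule env.cauchyD[OF d(1)])
    have "norm (regular.inner x c (mul S (d n) b)) \<le> regular.hnorm x c * regular.hnorm x (mul S (d n) b)"
      using b c dn by (intro regular.cauchy_schwarz) simp_all
    also have "\<dots> \<le> regular.hnorm x c * (regular.gns_seminorm (d n) * regular.hnorm x b)"
      using b c dn by (intro mult_left_mono regular.hnorm_mul regular.hnorm_nonneg)
    finally show ?thesis using universal_eq_gns[OF dn] by (simp add: regular.inner_def mult.left_commute)
  qed
  show ?thesis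
    unfolding e
  proof (rule LIMSEQ_le)
    show "(\<lambda>n. norm (mul S (adj S c) (mul S (d n) b) 0 x))
        \<longlonglongrightarrow> norm (coef (env.cl (\<lambda>n. mul S (adj S c) (mul S (d n) b))) 0 x)"
      by (intro tendsto_norm coef_cls env.cauchy_mul cb d)
    show "(\<lambda>n. universal_seminorm S (d n) * (regular.hnorm x c * regular.hnorm x b))
        \<longlonglongrightarrow> nrm A D * (regular.hnorm x c * regular.hnorm x b)"
      unfolding d(2) crossed_product_completion by (intro tendsto_mult_right env.nrm_C_lim d)
  qed (use le in blast)
qed

text \<open>Faithfulness of the regular representation on the completion. Let \<open>s\<close> be a
  finite sum near \<open>X\<close> and \<open>D\<close> the difference. As \<open>X\<close> has no
  coefficients, the squared length of \<open>s\<close> times \<open>b\<close> is the inner product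
  of that vector with \<open>D\<close> times \<open>b\<close>. So \<open>s\<close> has small GNS
  seminorm, and \<open>X\<close> has small norm.\<close>

theorem zero_if_coef_zero:
  assumes X: "X \<in> carr A" and zero: "\<And>w x. coef X w x = 0"
  shows "X = zer A"
proof (rule crossed.nrm_zero[OF X])
  have "nrm A X \<le> 0 + e" if "e > 0" for e
  proof -
    obtain s where s: "s \<in> carr S" "nrm A (sub A X (emb s)) < e / 2"
      using emb_dense[OF X, of "e / 2"] \<open>e > 0\<close> by auto
    note [simp] = s(1) emb_simps(1)[OF s(1)] X
    define D where "D = sub A (emb s) X"
    have D: "D \<in> carr A" "nrm A D < e / 2"
      using s(2) crossed.q_sub_commute[of "emb s" X] by (simp_all add: D_def)
    have "regular.gns_seminorm s \<le> e / 2"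
    proof (rule regular.gns_seminorm_leI)
      fix x b assume b: "b \<in> carr S"
      let ?c = "mul S s b"
      have c: "?c \<in> carr S" using b by simp
      note [simp] = b c emb_simps(1)[OF b] emb_simps(1)[OF regular.adj_closed[OF c]]
      let ?z = "emb (adj S ?c)"
      have "mul A X (emb b) \<in> carr A" "\<And>w x. coef (mul A X (emb b)) w x = 0"
        using zero by (auto intro: coef_mul_zero)
      from coef_emb_mul_zero[OF this regular.adj_closed[OF c]]
      have z0: "coef (mul A ?z (mul A X (emb b))) 0 x = 0" .
      have "mul A ?z (mul A D (emb b)) = sub A (mul A ?z (mul A (emb s) (emb b))) (mul A ?z (mul A X (emb b)))"
        unfolding D_def by (simp add: crossed.add_mul crossed.smul_mul crossed.mul_add crossed.mul_smul)
      then have "coef (mul A ?z (mul A D (emb b))) 0 x = coef (mul A ?z (mul A (emb s) (emb b))) 0 x"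
        using z0 by (simp add: coef_add coef_smul)
      also have "mul A ?z (mul A (emb s) (emb b)) = emb (mul S (adj S ?c) ?c)"
        by (simp add: emb_simps)
      also have "coef \<dots> 0 x = mul S (adj S ?c) ?c 0 x" by (rule coef_emb) simp
      finally have "norm (mul S (adj S ?c) ?c 0 x) \<le> nrm A D * (regular.hnorm x ?c * regular.hnorm x b)"
        using coef_inner_le[OF D(1) b c, of x] by simp
      also have "\<dots> \<le> e / 2 * (regular.hnorm x ?c * regular.hnorm x b)"
        using D(2) by (intro mult_right_mono mult_nonneg_nonneg regular.hnorm_nonneg) simp_all
      finally have "(regular.hnorm x ?c)\<^sup>2 \<le> e / 2 * (regular.hnorm x ?c * regular.hnorm x b)"
        using complex_Re_le_cmod[of "mul S (adj S ?c) ?c 0 x"] by (simp add: regular.hnorm_sq regular.inner_def)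
      then have *: "regular.hnorm x ?c * regular.hnorm x ?c \<le> (e / 2 * regular.hnorm x b) * regular.hnorm x ?c"
        by (simp add: power2_eq_square mult.commute mult.left_commute)
      show "regular.hnorm x ?c \<le> e / 2 * regular.hnorm x b"
      proof (cases "regular.hnorm x ?c = 0")
        case True
        then show ?thesis using \<open>e > 0\<close> by (simp add: regular.hnorm_nonneg)
      next
        case False
        then have "regular.hnorm x ?c > 0" using regular.hnorm_nonneg[OF c, of x] by simp
        then show ?thesis using * mult_right_le_imp_le by blast
      qed
    qed (use \<open>e > 0\<close> in simp)
    then have "nrm A (emb s) \<le> e / 2" using nrm_emb[OF s(1)] universal_eq_gns[OF s(1)] by simp
    then show ?thesis
      using crossed.q_diff[of X "emb s"] s(2) by simp
  qed
  then have "nrm A X \<le> 0" by (rule field_le_epsilon)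
  then show "nrm A X = 0" using crossed.q_nonneg[OF X] by simp
qed

corollary coef_inject:
  assumes "X \<in> carr A" "Y \<in> carr A" "\<And>w x. coef X w x = coef Y w x"
  shows "X = Y"
proof (rule crossed.eq_if_sub_zero[OF assms(1,2)])
  show "sub A X Y = zer A"
    using assms by (intro zero_if_coef_zero) (simp_all add: coef_add coef_smul)
qed

end


section \<open>From orbit injections to corner embeddings\<close>

lemma open_singleton_int_vec: "open {v :: int ^ 'd}"
proof -
  have "open {x :: int ^ 'd. \<forall>i. x $ i \<in> {v $ i}}" by (intro open_vector_box) (simp add: open_discrete)
  moreover have "{x :: int ^ 'd. \<forall>i. x $ i \<in> {v $ i}} = {v}" by (auto simp: vec_eq_iff)
  ultimately show ?thesis by simp
qed

text \<open>A point of \<open>K\<close> lies in only one member of the cover, so a finite subcover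
  contains every member that meets \<open>K\<close>.\<close>

lemma finite_disjoint_open_cover:
  assumes K: "compact K" and op: "\<And>i. open (U i)" and cov: "K \<subseteq> (\<Union>i. U i)"
    and dis: "\<And>i j. i \<noteq> j \<Longrightarrow> U i \<inter> U j = {}"
  shows "finite {i. U i \<inter> K \<noteq> {}}"
proof -
  obtain I where I: "finite I" "K \<subseteq> (\<Union>i\<in>I. U i)"
    using compactE_image[OF K op cov] by metis
  have "{i. U i \<inter> K \<noteq> {}} \<subseteq> I"
  proof
    fix i assume "i \<in> {i. U i \<inter> K \<noteq> {}}"
    then obtain x j where "x \<in> U i" "j \<in> I" "x \<in> U j" using I(2) by blast
    then show "i \<in> I" using dis[of i j] by blast
  qed
  then show ?thesis using I(1) finite_subset by blast
qed

lemma continuous_on_UNIV_local: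
  assumes "\<And>z. \<exists>U. open U \<and> z \<in> U \<and> continuous_on U f"
  shows "continuous_on UNIV f"
proof -
  have "continuous_on (\<Union>{U. open U \<and> continuous_on U f}) f" by (intro continuous_on_open_Union) auto
  moreover have "\<Union>{U. open U \<and> continuous_on U f} = UNIV" using assms by blast
  ultimately show ?thesis by simp
qed

lemma (in zd_system) nrm_minus_tendsto_unique:
  assumes "X \<in> carr A" "Y \<in> carr A" "\<And>n. T n \<in> carr A"
    and "(\<lambda>n. nrm A (sub A (T n) X)) \<longlonglongrightarrow> 0" "(\<lambda>n. nrm A (sub A (T n) Y)) \<longlonglongrightarrow> 0"
  shows "X = Y"
proof -
  have "(\<lambda>n. nrm A (sub A (T n) X) + nrm A (sub A (T n) Y)) \<longlonglongrightarrow> 0"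
    using tendsto_add[OF assms(4,5)] by simp
  moreover have "nrm A (sub A X Y) \<le> nrm A (sub A (T n) X) + nrm A (sub A (T n) Y)" for n
    using crossed.q_sub_triangle[OF assms(1) assms(3)[of n] assms(2)]
      crossed.q_sub_commute[OF assms(1) assms(3)[of n]] by simp
  ultimately have "nrm A (sub A X Y) \<le> 0" by (intro LIMSEQ_le_const) auto
  then have "sub A X Y = zer A"
    using crossed.q_nonneg[of "sub A X Y"] assms(1,2) by (intro crossed.nrm_zero antisym) simp_all
  then show ?thesis by (rule crossed.eq_if_sub_zero[OF assms(1,2)])
qed

lemma (in zd_system) emb_tendsto_cls:
  assumes s: "env.cauchy s"
  shows "(\<lambda>n. nrm A (sub A (emb (s n)) (env.cl s))) \<longlonglongrightarrow> 0"
proof (rule LIMSEQ_I)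
  fix e :: real assume "e > 0"
  then obtain N where N: "\<forall>m\<ge>N. \<forall>n\<ge>N. universal_seminorm S (sub S (s m) (s n)) < e / 2"
    using s unfolding cauchy_seq_def by (meson half_gt_zero)
  have sc: "s n \<in> carr S" for n by (rule env.cauchyD[OF s])
  have clc: "env.cl s \<in> carr A" using s by (simp add: crossed_product_completion)
  have "norm (nrm A (sub A (emb (s n)) (env.cl s)) - 0) < e" if "n \<ge> N" for n
  proof -
    have c: "env.cauchy (\<lambda>k. sub S (s n) (s k))" using s sc by simp
    have "(\<lambda>k. universal_seminorm S (sub S (s n) (s k))) \<longlonglongrightarrow> nrm A (sub A (emb (s n)) (env.cl s))"
      using env.nrm_C_lim[OF c] s sc by (simp add: crossed_product_completion emb_cls)
    then have "nrm A (sub A (emb (s n)) (env.cl s)) \<le> e / 2"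
      by (rule LIMSEQ_le_const2) (use N that in \<open>auto intro!: exI[of _ N] less_imp_le\<close>)
    moreover have "0 \<le> nrm A (sub A (emb (s n)) (env.cl s))"
      using clc emb_simps(1)[OF sc] by simp
    ultimately show ?thesis using \<open>e > 0\<close> by simp
  qed
  then show "\<exists>N. \<forall>n\<ge>N. norm (nrm A (sub A (emb (s n)) (env.cl s)) - 0) < e" by blast
qed

section \<open>Free systems and clopen sets of the Cantor set\<close>

locale free_cantor_zd_system = zd_system \<phi>
  for \<phi> :: "int ^ 'd \<Rightarrow> 'x::topological_space \<Rightarrow> 'x" +
  assumes cantor: "(UNIV :: 'x set) homeomorphic (UNIV :: (nat \<Rightarrow> bool) set)"
    and free: "free_system \<phi>"
begin

lemma compact_space: "compact (UNIV :: 'x set)"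
  using dyn by (simp add: dynamical_system_def)

lemma phi_eq_iff: "\<phi> v x = \<phi> w x \<longleftrightarrow> v = w"
proof
  assume "\<phi> v x = \<phi> w x"
  then have "\<phi> (- w) (\<phi> v x) = \<phi> (- w) (\<phi> w x)" by simp
  then have "\<phi> (v - w) x = x" by simp
  then show "v = w" using free unfolding free_system_def by (metis eq_iff_diff_eq_0)
qed simp

text \<open>The homeomorphism to the sequence space separates \<open>x\<close> and \<open>y\<close>
  in some coordinate, and each coordinate is a continuous map to a discrete space.\<close>

lemma clopen_separation:
  fixes x y :: 'x assumes "x \<noteq> y"
  shows "\<exists>C. open C \<and> closed C \<and> x \<in> C \<and> y \<notin> C"
proof -
  obtain h k where h: "homeomorphism (UNIV :: 'x set) (UNIV :: (nat \<Rightarrow> bool) set) h k"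
    using cantor unfolding homeomorphic_def by blast
  then have "h x \<noteq> h y" using assms unfolding homeomorphism_def by (metis UNIV_I)
  then obtain n where n: "h x n \<noteq> h y n" by blast
  have "continuous_on UNIV (\<lambda>z. h z n)"
    by (rule continuous_on_product_then_coordinatewise) (use h in \<open>simp add: homeomorphism_def\<close>)
  then have "open ((\<lambda>z. h z n) -` B)" for B
    by (intro open_vimage) (simp_all add: open_discrete)
  then have "open ((\<lambda>z. h z n) -` {h x n})" "open ((\<lambda>z. h z n) -` (- {h x n}))" by blast+
  then have "open ((\<lambda>z. h z n) -` {h x n})" "closed ((\<lambda>z. h z n) -` {h x n})"
    by (simp_all only: closed_def vimage_Compl)
  then show ?thesis using n by (intro exI[of _ "(\<lambda>z. h z n) -` {h x n}"]) simp
qed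

text \<open>Finitely many clopen sets that avoid \<open>y\<close> cover \<open>K\<close>; the
  complement of their union separates.\<close>

lemma clopen_separation_compact:
  fixes K :: "'x set"
  assumes "compact K" "y \<notin> K"
  shows "\<exists>C. open C \<and> closed C \<and> y \<in> C \<and> C \<inter> K = {}"
proof -
  have "\<exists>C. open C \<and> closed C \<and> x \<in> C \<and> y \<notin> C" if "x \<in> K" for x
    using that assms(2) by (intro clopen_separation) auto
  then obtain C where C: "open (C x)" "closed (C x)" "x \<in> C x" "y \<notin> C x" if "x \<in> K" for x
    by metis
  obtain I where I: "I \<subseteq> K" "finite I" "K \<subseteq> (\<Union>x\<in>I. C x)"
  proof (rule compactE_image[OF assms(1), of K C])
    show "K \<subseteq> (\<Union>x\<in>K. C x)" using C(3) by blast
  qed (use C(1) in auto)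
  have IK: "x \<in> K" if "x \<in> I" for x using that I(1) by blast
  have "closed (\<Union>x\<in>I. C x)" using I(2) C(2)[OF IK] by (intro closed_UN) simp_all
  moreover have "open (\<Union>x\<in>I. C x)" using C(1)[OF IK] by (intro open_UN) simp
  moreover have "y \<in> - (\<Union>x\<in>I. C x)" "- (\<Union>x\<in>I. C x) \<inter> K = {}" using I(3) C(4)[OF IK] by blast+
  ultimately show ?thesis by (intro exI[of _ "- (\<Union>x\<in>I. C x)"]) (simp only: open_Compl closed_Compl)
qed

text \<open>The type of the space carries no Hausdorff axiom; separation by clopen sets replaces
  it.\<close>

lemma compact_closed: fixes K :: "'x set" assumes "compact K" shows "closed K"
  unfolding closed_def open_subopen[of "- K"]
proof
  fix y assume "y \<in> - K"
  then obtain C where "open C" "y \<in> C" "C \<inter> K = {}" using clopen_separation_compact[OF assms, of y] by blast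
  then show "\<exists>T. open T \<and> y \<in> T \<and> T \<subseteq> - K" by (intro exI[of _ C]) auto
qed

lemma continuous_indicator:
  assumes "open C" "closed (C :: 'x set)"
  shows "continuous_on UNIV (\<lambda>x. if x \<in> C then f x else 0 :: complex) \<longleftrightarrow> continuous_on C f"
proof
  assume "continuous_on UNIV (\<lambda>x. if x \<in> C then f x else 0)"
  then have "continuous_on C (\<lambda>x. if x \<in> C then f x else 0)" by (rule continuous_on_subset) simp
  then show "continuous_on C f" by (subst continuous_on_cong[OF refl, of _ _ "\<lambda>x. if x \<in> C then f x else 0"]) simp_all
next
  assume f: "continuous_on C f"
  have "continuous_on (C \<union> - C) (\<lambda>x. if x \<in> C then f x else 0)"
    using assms f by (intro continuous_on_If) (auto simp: closed_def intro: continuous_on_const)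
  then show "continuous_on UNIV (\<lambda>x. if x \<in> C then f x else 0)" by simp
qed

lemma continuous_separation:
  fixes x y :: 'x
  assumes "\<And>f :: 'x \<Rightarrow> complex. continuous_on UNIV f \<Longrightarrow> f x = f y"
  shows "x = y"
proof (rule ccontr)
  assume "x \<noteq> y"
  then obtain C where "open C" "closed C" "x \<in> C" "y \<notin> C" using clopen_separation by blast
  then show False
    using assms[of "\<lambda>x. if x \<in> C then 1 else 0"] continuous_indicator[of C "\<lambda>x. 1"] by simp
qed

end

section \<open>The cocycle of a bounded orbit injection\<close>

locale bounded_injection =
  X: free_cantor_zd_system \<phi> + Z: free_cantor_zd_system \<psi>
  for \<phi> :: "int ^ 'd \<Rightarrow> 'x::topological_space \<Rightarrow> 'x"
    and \<psi> :: "int ^ 'd \<Rightarrow> 'z::topological_space \<Rightarrow> 'z" +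
  fixes \<theta> :: "'x \<Rightarrow> 'z"
  assumes boi: "bounded_orbit_injection \<phi> \<psi> \<theta>"
begin

abbreviation "Y \<equiv> range \<theta>"

lemma theta_cont: "continuous_on UNIV \<theta>"
  and theta_open: "open U \<Longrightarrow> open (\<theta> ` U)"
  and theta_inj: "inj \<theta>"
  and orbit_iff: "(\<exists>w. \<phi> w x = y) \<longleftrightarrow> (\<exists>v. \<psi> v (\<theta> x) = \<theta> y)"
  and cocycle_cont: "continuous_on UNIV (cocycle \<phi> \<psi> \<theta>)"
  using boi by (simp_all add: bounded_orbit_injection_def orbit_injection_def)

lemma theta_eq_iff [simp]: "\<theta> x = \<theta> y \<longleftrightarrow> x = y"
  using theta_inj by (simp add: inj_eq)

lemma open_Y: "open Y"
  by (rule theta_open) simp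

lemma closed_Y: "closed Y"
  by (intro Z.compact_closed compact_continuous_image theta_cont X.compact_space)

definition eta :: "'x \<Rightarrow> int ^ 'd \<Rightarrow> int ^ 'd" where "eta x w = cocycle \<phi> \<psi> \<theta> (x, w)"

lemma eta_iff: "\<psi> v (\<theta> x) = \<theta> (\<phi> w x) \<longleftrightarrow> v = eta x w"
proof -
  have "\<exists>v. \<psi> v (\<theta> x) = \<theta> (\<phi> w x)" using orbit_iff[of x "\<phi> w x"] by blast
  then obtain v' where v': "\<psi> v' (\<theta> x) = \<theta> (\<phi> w x)" by blast
  have un: "u = v'" if "\<psi> u (\<theta> x) = \<theta> (\<phi> w x)" for u
    using that v' Z.phi_eq_iff[of u "\<theta> x" v'] by simp
  have "eta x w = v'"
    unfolding eta_def cocycle_def prod.case by (rule the_equality, rule v', rule un)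
  then show ?thesis using v' un by blast
qed

lemma eta_eqI: "\<psi> v (\<theta> x) = \<theta> (\<phi> w x) \<Longrightarrow> eta x w = v"
  by (simp add: eta_iff)

lemma psi_eta: "\<psi> (eta x w) (\<theta> x) = \<theta> (\<phi> w x)"
  by (simp add: eta_iff)

lemma eta_inj: "eta x w = eta x w' \<longleftrightarrow> w = w'"
proof
  assume "eta x w = eta x w'"
  then have "\<theta> (\<phi> w x) = \<theta> (\<phi> w' x)" by (simp flip: psi_eta)
  then show "w = w'" by (simp add: X.phi_eq_iff)
qed simp

text \<open>The group is discrete, so the level sets of a continuous cocycle are open.\<close>

lemma eta_open: "open {x. eta x w = v}"
proof -
  have "continuous_on UNIV (\<lambda>x. eta x w)"
    unfolding eta_def by (rule continuous_on_compose2[OF cocycle_cont]) (auto intro: continuous_intros)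
  then have "open ((\<lambda>x. eta x w) -` {v})"
    by (intro open_vimage) (simp_all add: open_singleton_int_vec)
  then show ?thesis by (simp add: vimage_def)
qed

text \<open>For fixed \<open>w\<close> the level sets of the cocycle are a partition of a compact
  space into open sets.\<close>

lemma finite_eta: "finite {v. \<exists>x. eta x w = v}"
proof -
  have "finite {v. {x. eta x w = v} \<inter> UNIV \<noteq> {}}"
    by (rule finite_disjoint_open_cover[OF X.compact_space]) (auto simp: eta_open)
  then show ?thesis by simp
qed

text \<open>The cocycle of the restriction of the orbit relation of \<open>\<psi>\<close> to \<open>Y\<close> is bounded as well: for
  fixed \<open>v\<close> the domain of \<open>\<psi>\<^sup>v\<close> in \<open>Y\<close> is compact.\<close>

lemma finite_eta_inverse: "finite {w. \<exists>x. eta x w = v}"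
proof -
  define K where "K = (\<lambda>x. \<psi> v (\<theta> x)) -` Y"
  have "continuous_on UNIV (\<lambda>x. \<psi> v (\<theta> x))"
    by (rule continuous_on_compose2[OF Z.phi_cont theta_cont]) simp
  then have "closed K" unfolding K_def using closed_Y by (intro closed_vimage)
  then have "compact (UNIV \<inter> K)" using X.compact_space by (intro compact_Int_closed)
  then have "finite {w. {x. eta x w = v} \<inter> (UNIV \<inter> K) \<noteq> {}}"
  proof (rule finite_disjoint_open_cover)
    show "UNIV \<inter> K \<subseteq> (\<Union>w. {x. eta x w = v})"
    proof
      fix x assume "x \<in> UNIV \<inter> K"
      then obtain y where "\<psi> v (\<theta> x) = \<theta> y" by (auto simp: K_def)
      then obtain w where "\<psi> v (\<theta> x) = \<theta> (\<phi> w x)" using orbit_iff by metis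
      then show "x \<in> (\<Union>w. {x. eta x w = v})" using eta_eqI by blast
    qed
    show "{x. eta x w = v} \<inter> {x. eta x w' = v} = {}" if "w \<noteq> w'" for w w'
      using that by (auto simp: eta_inj)
  qed (rule eta_open)
  moreover have "{w. \<exists>x. eta x w = v} \<subseteq> {w. {x. eta x w = v} \<inter> (UNIV \<inter> K) \<noteq> {}}"
    using psi_eta unfolding K_def by blast
  ultimately show ?thesis using finite_subset by blast
qed

lemma orbit_cases:
  obtains (outside) "z \<notin> Y \<or> \<psi> v z \<notin> Y" | (inside) x w where "z = \<theta> x" "eta x w = v"
proof (cases "z \<notin> Y \<or> \<psi> v z \<notin> Y")
  case False
  then obtain x y where xy: "z = \<theta> x" "\<psi> v (\<theta> x) = \<theta> y" by blast
  then obtain w where "\<phi> w x = y" using orbit_iff by blast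
  then show ?thesis using xy eta_eqI inside by blast
qed (rule outside)

section \<open>Relabelling coefficients along orbits\<close>

definition theta_inv :: "'z \<Rightarrow> 'x" where "theta_inv = inv_into UNIV \<theta>"

text \<open>The coefficient at \<open>v\<close> of the image of \<open>a\<close>, evaluated at \<open>\<theta> x\<close>, is the coefficient of \<open>a\<close> at
  the \<open>w\<close> with \<open>\<psi>\<^sup>-\<^sup>v (\<theta> x) = \<theta> (\<phi>\<^sup>-\<^sup>w x)\<close>. The sum has at most one summand.\<close>

definition transfer :: "(int ^ 'd \<Rightarrow> 'x \<Rightarrow> complex) \<Rightarrow> int ^ 'd \<Rightarrow> 'z \<Rightarrow> complex" where
  "transfer a v z = (if z \<in> Y then \<Sum>w | eta (theta_inv z) (- w) = - v. a w (theta_inv z) else 0)"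

lemma inv_theta [simp]: "theta_inv (\<theta> x) = x"
  using theta_inj by (simp add: theta_inv_def)

lemma transfer_inside: assumes "eta x (- w) = - v" shows "transfer a v (\<theta> x) = a w x"
proof -
  have "{w. eta x (- w) = - v} = {w}" using assms eta_inj by (auto, metis minus_equation_iff)
  then show ?thesis by (simp add: transfer_def)
qed

lemma transfer_outside: assumes "z \<notin> Y \<or> \<psi> (- v) z \<notin> Y" shows "transfer a v z = 0"
proof (cases "z \<in> Y")
  case True
  then obtain x where z: "z = \<theta> x" by blast
  have "{w. eta x (- w) = - v} = {}" using assms True psi_eta unfolding z by (auto, metis rangeI)
  then show ?thesis by (simp add: transfer_def z)
qed (simp add: transfer_def)

lemma transfer_cases:
  obtains "z \<notin> Y \<or> \<psi> (- v) z \<notin> Y" | x w where "z = \<theta> x" "eta x (- w) = - v"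
  by (cases rule: orbit_cases[of z "- v"]) (auto, metis minus_minus)

lemma inv_theta_cont: "continuous_on Y (theta_inv)"
  unfolding continuous_on_open_vimage[OF open_Y]
proof (intro allI impI)
  fix B :: "'x set" assume "open B"
  moreover have "theta_inv -` B \<inter> Y = \<theta> ` B" by force
  ultimately show "open (theta_inv -` B \<inter> Y)" by (simp add: theta_open)
qed

text \<open>The support is finite by \<open>finite_eta\<close>. Continuity is local: near an inside
  point the label \<open>w\<close> is constant since \<open>eta\<close> has open level sets, and
  outside points form an open set on which the coefficient is 0.\<close>

lemma transfer_carr: assumes a: "a \<in> carr X.S" shows "transfer a \<in> carr Z.S"
  unfolding Z.skew_carr
proof (intro conjI allI)
  have "Z.supp (transfer a) \<subseteq> (\<Union>w\<in>X.supp a. uminus ` {v. \<exists>x. eta x (- w) = v})"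
  proof
    fix v assume "v \<in> Z.supp (transfer a)"
    then obtain z where z: "transfer a v z \<noteq> 0" by auto
    then obtain x w where xw: "z = \<theta> x" "eta x (- w) = - v"
      using transfer_outside by (cases rule: transfer_cases[of z v]) blast+
    then have "w \<in> X.supp a" using z transfer_inside[OF xw(2), of a] by auto
    moreover have "v \<in> uminus ` {v. \<exists>x. eta x (- w) = v}" using xw(2) by (intro image_eqI[of _ _ "- v"]) auto
    ultimately show "v \<in> (\<Union>w\<in>X.supp a. uminus ` {v. \<exists>x. eta x (- w) = v})" by blast
  qed
  moreover have "finite (\<Union>w\<in>X.supp a. uminus ` {v. \<exists>x. eta x (- w) = v})"
    using a finite_eta by (intro finite_UN_I finite_imageI) (auto simp: X.skew_carr)
  ultimately show "finite (Z.supp (transfer a))" using finite_subset by blast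
  fix v
  show "continuous_on UNIV (transfer a v)"
  proof (rule continuous_on_UNIV_local)
    fix z
    show "\<exists>U. open U \<and> z \<in> U \<and> continuous_on U (transfer a v)"
    proof (cases rule: transfer_cases[of z v])
      case 1
      let ?U = "- Y \<union> (\<psi> (- v)) -` (- Y)"
      have "open ?U" using closed_Y Z.phi_cont by (intro open_Un open_vimage) auto
      moreover have "continuous_on ?U (transfer a v)"
        by (subst continuous_on_cong[OF refl, of _ _ "\<lambda>_. 0"]) (auto simp: transfer_outside)
      ultimately show ?thesis using 1 by blast
    next
      case (2 x w)
      let ?U = "\<theta> ` {x. eta x (- w) = - v}"
      have "continuous_on UNIV (a w)" using a by (simp add: X.skew_carr)
      moreover have "continuous_on ?U theta_inv" by (rule continuous_on_subset[OF inv_theta_cont]) auto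
      ultimately have "continuous_on ?U (\<lambda>z. a w (theta_inv z))"
        by (rule continuous_on_compose2) simp
      then have "continuous_on ?U (transfer a v)"
        by (subst continuous_on_cong[OF refl, of _ _ "\<lambda>z. a w (theta_inv z)"]) (auto simp: transfer_inside)
      then show ?thesis using 2 theta_open[OF eta_open] by blast
    qed
  qed
qed

text \<open>At a point \<open>\<theta> x\<close> the convolution sums correspond under the injective
  relabelling of the orbit; summands whose intermediate point is outside \<open>Y\<close>
  vanish.\<close>

lemma transfer_mul:
  assumes a: "a \<in> carr X.S"
  shows "transfer (mul X.S a b) = mul Z.S (transfer a) (transfer b)"
proof (intro ext)
  fix v z
  have fin: "finite (X.supp a)" using a by (simp add: X.skew_carr)
  have finT: "finite (Z.supp (transfer a))" using transfer_carr[OF a] by (simp add: Z.skew_carr)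
  let ?t = "\<lambda>v'. transfer a v' z * transfer b (v - v') (\<psi> (- v') z)"
  show "transfer (mul X.S a b) v z = mul Z.S (transfer a) (transfer b) v z"
  proof (cases rule: transfer_cases[of z v])
    case 1
    \<comment> \<open>The first factor requires \<open>z\<close> in \<open>Y\<close>, the second
      requires \<open>\<psi> (- v) z\<close> in \<open>Y\<close>.\<close>
    have "?t v' = 0" for v'
      using 1 transfer_outside[of z v' a] transfer_outside[of "\<psi> (- v') z" "v - v'" b] by auto
    then have "mul Z.S (transfer a) (transfer b) v z = 0"
      unfolding Z.skew_mul[OF finT subset_refl] by (intro sum.neutral) blast
    then show ?thesis using 1 by (simp add: transfer_outside)
  next
    case (2 x w)
    \<comment> \<open>The label that the coefficient at \<open>w'\<close> receives at the point
      \<open>\<theta> x\<close>.\<close>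
    define \<iota> where "\<iota> w' = - eta x (- w')" for w'
    have \<iota>: "eta x (- w') = - \<iota> w'" for w' by (simp add: \<iota>_def)
    have inj: "inj \<iota>" by (auto intro!: injI simp: \<iota>_def eta_inj)
    have "mul Z.S (transfer a) (transfer b) v z = (\<Sum>v'\<in>Z.supp (transfer a) \<union> \<iota> ` X.supp a. ?t v')"
      using fin finT by (intro Z.skew_mul) auto
    also have "\<dots> = (\<Sum>v'\<in>\<iota> ` X.supp a. ?t v')"
    proof (rule sum.mono_neutral_right)
      show "\<forall>v'\<in>Z.supp (transfer a) \<union> \<iota> ` X.supp a - \<iota> ` X.supp a. ?t v' = 0"
      proof
        fix v' assume v': "v' \<in> Z.supp (transfer a) \<union> \<iota> ` X.supp a - \<iota> ` X.supp a"
        have "transfer a v' z = 0"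
        proof (cases rule: transfer_cases[of z v'])
          case 1
          then show ?thesis by (rule transfer_outside)
        next
          case (2 x' w')
          then have "x' = x" using \<open>z = \<theta> x\<close> by simp
          then have "v' = \<iota> w'" using 2 by (simp add: \<iota>_def)
          then have "w' \<notin> X.supp a" using v' by blast
          then show ?thesis using 2 transfer_inside[of x' w' v' a] by simp
        qed
        then show "?t v' = 0" by simp
      qed
    qed (use fin finT in auto)
    also have "\<dots> = (\<Sum>w'\<in>X.supp a. ?t (\<iota> w'))"
      by (rule sum.reindex[unfolded comp_def]) (use inj in \<open>auto intro: inj_on_subset\<close>)
    also have "\<dots> = (\<Sum>w'\<in>X.supp a. a w' x * b (w - w') (\<phi> (- w') x))"
    proof (rule sum.cong[OF refl])
      fix w'
      have p: "\<psi> (- \<iota> w') (\<theta> x) = \<theta> (\<phi> (- w') x)" using psi_eta[of x "- w'"] by (simp add: \<iota>)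
      \<comment> \<open>The cocycle identity: from the intermediate point, the remaining
        displacement \<open>w - w'\<close> has the label \<open>v - \<iota> w'\<close>.\<close>
      have "\<psi> (- (v - \<iota> w')) (\<theta> (\<phi> (- w') x)) = \<psi> (- v) (\<theta> x)" unfolding p[symmetric] by simp
      also have "\<dots> = \<theta> (\<phi> (- w) x)" using psi_eta[of x "- w"] 2(2) by simp
      finally have "\<psi> (- (v - \<iota> w')) (\<theta> (\<phi> (- w') x)) = \<theta> (\<phi> (- (w - w')) (\<phi> (- w') x))" by simp
      then have "eta (\<phi> (- w') x) (- (w - w')) = - (v - \<iota> w')" by (rule eta_eqI)
      then show "?t (\<iota> w') = a w' x * b (w - w') (\<phi> (- w') x)"
        unfolding 2(1) p using transfer_inside \<iota> by metis
    qed
    also have "\<dots> = mul X.S a b w x" by (rule X.skew_mul[OF fin subset_refl, symmetric])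
    finally show ?thesis using 2 by (simp add: transfer_inside)
  qed
qed

lemma transfer_adj: "transfer (adj X.S a) = adj Z.S (transfer a)"
proof (intro ext)
  fix v z
  show "transfer (adj X.S a) v z = adj Z.S (transfer a) v z"
  proof (cases rule: transfer_cases[of z v])
    case 1
    then show ?thesis using transfer_outside[of "\<psi> (- v) z" "- v" a]
      by (auto simp: transfer_outside Z.skew_simps)
  next
    case (2 x w)
    have p: "\<psi> (- v) (\<theta> x) = \<theta> (\<phi> (- w) x)" using psi_eta[of x "- w"] 2(2) by simp
    have "\<psi> v (\<psi> (- v) (\<theta> x)) = \<theta> (\<phi> w (\<phi> (- w) x))" by simp
    then have "eta (\<phi> (- w) x) (- (- w)) = - (- v)" unfolding p by (intro eta_eqI) simp
    then show ?thesis
      unfolding 2(1) transfer_inside[OF 2(2)]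
      using transfer_inside[of "\<phi> (- w) x" "- w" "- v" a] p by (simp add: X.skew_simps Z.skew_simps)
  qed
qed

lemma transfer_linear:
  "transfer (add X.S a b) = add Z.S (transfer a) (transfer b)"
  "transfer (smul X.S c a) = smul Z.S c (transfer a)"
  by (auto simp: fun_eq_iff transfer_def X.skew_simps Z.skew_simps sum.distrib sum_distrib_left)

lemma transfer_hom: "star_hom X.S Z.S transfer"
  unfolding star_hom_def by (simp add: transfer_carr transfer_mul transfer_adj transfer_linear)

definition proj_Y :: "int ^ 'd \<Rightarrow> 'z \<Rightarrow> complex" where
  "proj_Y = single 0 (\<lambda>z. if z \<in> Y then 1 else 0)"

lemma proj_Y_cont: "continuous_on UNIV (\<lambda>z. if z \<in> Y then 1 else 0 :: complex)"
  using Z.continuous_indicator[OF open_Y closed_Y, of "\<lambda>_. 1"] by simp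

lemma transfer_single_0:
  "transfer (single 0 f) = single 0 (\<lambda>z. if z \<in> Y then f (theta_inv z) else 0)"
proof (intro ext)
  fix v z
  have e0: "eta x 0 = 0" for x by (rule eta_eqI) simp
  show "transfer (single 0 f) v z = single 0 (\<lambda>z. if z \<in> Y then f (theta_inv z) else 0) v z"
  proof (cases rule: transfer_cases[of z v])
    case 1
    then show ?thesis by (auto simp: transfer_outside single_def)
  next
    case (2 x w)
    then have "w = 0 \<longleftrightarrow> v = 0" using e0[of x] eta_inj[of x "- w" 0] by auto
    then show ?thesis using 2 by (simp add: transfer_inside single_def)
  qed
qed

lemma transfer_unt: "transfer (unt X.S) = proj_Y"
  by (simp add: X.skew_simps transfer_single_0 proj_Y_def)

lemma corner_coefficients:
  assumes b: "b \<in> carr Z.S"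
  shows "mul Z.S proj_Y (mul Z.S b proj_Y) v z = (if z \<in> Y \<and> \<psi> (- v) z \<in> Y then b v z else 0)"
  unfolding proj_Y_def Z.single_mul using Z.mul_single[OF b] by simp

text \<open>The relabelling is read backwards; the preimage has finite support by
  \<open>finite_eta_inverse\<close>.\<close>

lemma transfer_onto_corner:
  assumes b: "b \<in> carr Z.S"
  shows "\<exists>a\<in>carr X.S. transfer a = mul Z.S proj_Y (mul Z.S b proj_Y)"
proof
  define a where "a w x = b (- eta x (- w)) (\<theta> x)" for w x
  show "a \<in> carr X.S"
    unfolding X.skew_carr
  proof (intro conjI allI)
    have "X.supp a \<subseteq> (\<Union>v\<in>Z.supp b. uminus ` {w. \<exists>x. eta x w = - v})"
    proof
      fix w assume "w \<in> X.supp a"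
      then obtain x where x: "a w x \<noteq> 0" by auto
      let ?v = "- eta x (- w)"
      have "?v \<in> Z.supp b" using x by (auto simp: a_def)
      moreover have "w \<in> uminus ` {w. \<exists>x. eta x w = - ?v}" by (intro image_eqI[of _ _ "- w"]) auto
      ultimately show "w \<in> (\<Union>v\<in>Z.supp b. uminus ` {w. \<exists>x. eta x w = - v})" by blast
    qed
    moreover have "finite (\<Union>v\<in>Z.supp b. uminus ` {w. \<exists>x. eta x w = - v})"
      using b finite_eta_inverse by (intro finite_UN_I finite_imageI) (auto simp: Z.skew_carr)
    ultimately show "finite (X.supp a)" using finite_subset by blast
    fix w
    show "continuous_on UNIV (a w)"
    proof (rule continuous_on_UNIV_local)
      fix x
      let ?U = "{y. eta y (- w) = eta x (- w)}"
      have "continuous_on UNIV (\<lambda>y. b (- eta x (- w)) (\<theta> y))"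
        using b theta_cont by (intro continuous_on_compose2[of UNIV "b (- eta x (- w))" UNIV \<theta>])
          (auto simp: Z.skew_carr)
      then have "continuous_on ?U (\<lambda>y. b (- eta x (- w)) (\<theta> y))" by (rule continuous_on_subset) simp
      then have "continuous_on ?U (a w)"
        by (subst continuous_on_cong[OF refl, of _ _ "\<lambda>y. b (- eta x (- w)) (\<theta> y)"]) (auto simp: a_def)
      then show "\<exists>U. open U \<and> x \<in> U \<and> continuous_on U (a w)" using eta_open by blast
    qed
  qed
  show "transfer a = mul Z.S proj_Y (mul Z.S b proj_Y)"
  proof (intro ext)
    fix v z
    show "transfer a v z = mul Z.S proj_Y (mul Z.S b proj_Y) v z"
      unfolding corner_coefficients[OF b]
    proof (cases rule: transfer_cases[of z v])
      case 1
      then show "transfer a v z = (if z \<in> Y \<and> \<psi> (- v) z \<in> Y then b v z else 0)"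
        by (auto simp: transfer_outside)
    next
      case (2 x w)
      have "\<psi> (- v) z \<in> Y" using psi_eta[of x "- w"] 2 by simp
      then show "transfer a v z = (if z \<in> Y \<and> \<psi> (- v) z \<in> Y then b v z else 0)"
        using 2 by (simp add: transfer_inside a_def)
    qed
  qed
qed

text \<open>The pulled back seminorm is a C*-seminorm, so universality gives one inequality. Every
  coefficient of \<open>a\<close> is a coefficient of \<open>transfer a\<close>, so
  \<open>seminorm_le_if_coefficients_le\<close> gives the other.\<close>

lemma universal_seminorm_transfer:
  assumes a: "a \<in> carr X.S"
  shows "universal_seminorm Z.S (transfer a) = universal_seminorm X.S a"
proof (rule antisym)
  have hom: "transfer (add X.S a b) = add Z.S (transfer a) (transfer b)"
    "transfer (mul X.S a b) = mul Z.S (transfer a) (transfer b)"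
    "transfer (smul X.S c a) = smul Z.S c (transfer a)"
    "transfer (adj X.S a) = adj Z.S (transfer a)"
    if "a \<in> carr X.S" for a b c
    using that by (simp_all add: transfer_linear transfer_mul transfer_adj)
  have cs: "cstar_seminorm X.S (\<lambda>a. universal_seminorm Z.S (transfer a))"
    using Z.env.cstar_q transfer_carr unfolding cstar_seminorm_def by (simp add: hom)
  show "universal_seminorm Z.S (transfer a) \<le> universal_seminorm X.S a"
    by (rule universal_seminorm_upper[OF X.skew_seminorm_bounded a cs])
  show "universal_seminorm X.S a \<le> universal_seminorm Z.S (transfer a)"
  proof (rule X.seminorm_le_if_coefficients_le[OF X.env.cstar_q cs _ a])
    fix a w x assume a: "a \<in> carr X.S"
    have "a w x = transfer a (- eta x (- w)) (\<theta> x)" by (rule transfer_inside[symmetric]) simp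
    then show "norm (a w x) \<le> universal_seminorm Z.S (transfer a)"
      using Z.coefficient_le_universal[OF transfer_carr[OF a]] by simp
  qed
qed

text \<open>The universal property extends \<open>transfer\<close> to the completion, and density
  makes the extension isometric, hence injective.\<close>

theorem corner_embedding:
  shows "\<exists>\<alpha>. star_monomorphism X.A Z.A \<alpha> \<and>
    \<alpha> ` function_subalgebra \<phi> \<subseteq> function_subalgebra \<psi> \<and>
    \<alpha> ` carr X.A = {mul Z.A (\<alpha> (unt X.A)) (mul Z.A b (\<alpha> (unt X.A))) | b. b \<in> carr Z.A}"
proof -
  have hom: "star_hom X.S Z.A (\<lambda>a. Z.emb (transfer a))"
    using transfer_hom Z.emb_hom unfolding star_hom_def by simp
  obtain \<alpha> where \<alpha>: "star_hom X.A Z.A \<alpha>" and emb: "\<And>a. a \<in> carr X.S \<Longrightarrow> \<alpha> (X.emb a) = Z.emb (transfer a)"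
    and contr: "\<And>x. x \<in> carr X.A \<Longrightarrow> nrm Z.A (\<alpha> x) \<le> nrm X.A x"
    using enveloping_cstar_universal[OF X.skew_star_algebra X.skew_seminorm_bounded Z.crossed.cstar_algebra_axioms hom]
    unfolding crossed_product_def by blast
  have \<alpha>c: "\<alpha> x \<in> carr Z.A" "\<alpha> (smul X.A c x) = smul Z.A c (\<alpha> x)" "\<alpha> (adj X.A x) = adj Z.A (\<alpha> x)"
    if "x \<in> carr X.A" for x c using \<alpha> that by (simp_all add: star_hom_def)
  have \<alpha>2: "\<alpha> (add X.A x y) = add Z.A (\<alpha> x) (\<alpha> y)" "\<alpha> (mul X.A x y) = mul Z.A (\<alpha> x) (\<alpha> y)"
    if "x \<in> carr X.A" "y \<in> carr X.A" for x y using \<alpha> that by (simp_all add: star_hom_def)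
  have isoS: "nrm Z.A (Z.emb (transfer a)) = nrm X.A (X.emb a)" if "a \<in> carr X.S" for a
    using that by (simp add: X.nrm_emb Z.nrm_emb transfer_carr universal_seminorm_transfer)
  have iso: "nrm Z.A (\<alpha> x) = nrm X.A x" if x: "x \<in> carr X.A" for x
  proof (rule antisym[OF contr[OF x]])
    show "nrm X.A x \<le> nrm Z.A (\<alpha> x)"
    proof (rule field_le_epsilon)
      fix e :: real assume "e > 0"
      then obtain a where a: "a \<in> carr X.S" "nrm X.A (sub X.A x (X.emb a)) < e / 2"
        using X.emb_dense[OF x, of "e / 2"] by auto
      have ea: "X.emb a \<in> carr X.A" by (rule X.emb_simps(1)[OF a(1)])
      have d: "sub X.A x (X.emb a) \<in> carr X.A" using x ea by simp
      have "\<bar>nrm X.A x - nrm X.A (X.emb a)\<bar> \<le> nrm X.A (sub X.A x (X.emb a))"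
        by (rule X.crossed.q_diff[OF x ea])
      moreover have "\<bar>nrm Z.A (\<alpha> x) - nrm Z.A (\<alpha> (X.emb a))\<bar> \<le> nrm Z.A (sub Z.A (\<alpha> x) (\<alpha> (X.emb a)))"
        by (rule Z.crossed.q_diff[OF \<alpha>c(1)[OF x] \<alpha>c(1)[OF ea]])
      moreover have "nrm Z.A (sub Z.A (\<alpha> x) (\<alpha> (X.emb a))) \<le> nrm X.A (sub X.A x (X.emb a))"
        using contr[OF d] star_hom_sub[OF X.crossed.star_algebra_axioms \<alpha> x ea] by simp
      moreover have "nrm Z.A (\<alpha> (X.emb a)) = nrm X.A (X.emb a)" using a(1) by (simp add: emb isoS)
      ultimately show "nrm X.A x \<le> nrm Z.A (\<alpha> x) + e" using a(2) by linarith
    qed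
  qed
  have inj: "inj_on \<alpha> (carr X.A)"
  proof (rule inj_onI)
    fix x y assume xy: "x \<in> carr X.A" "y \<in> carr X.A" "\<alpha> x = \<alpha> y"
    have "nrm X.A (sub X.A x y) = nrm Z.A (sub Z.A (\<alpha> x) (\<alpha> y))"
      using iso[of "sub X.A x y"] star_hom_sub[OF X.crossed.star_algebra_axioms \<alpha> xy(1,2)] xy(1,2) by simp
    also have "\<dots> = 0" using xy \<alpha>c(1) by simp
    finally have "sub X.A x y = zer X.A" using xy(1,2) by (intro X.crossed.nrm_zero) simp_all
    then show "x = y" by (rule X.crossed.eq_if_sub_zero[OF xy(1,2)])
  qed
  let ?p = "\<alpha> (unt X.A)"
  have p: "?p = Z.emb proj_Y" using emb[of "unt X.S"] X.emb_unt transfer_unt by simp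
  have pS: "proj_Y \<in> carr Z.S" unfolding proj_Y_def using proj_Y_cont by simp
  have pc: "?p \<in> carr Z.A" unfolding p by (rule Z.emb_simps(1)[OF pS])
  have "\<alpha> ` carr X.A = {mul Z.A ?p (mul Z.A b ?p) | b. b \<in> carr Z.A}"
  proof (intro equalityI subsetI)
    fix y assume "y \<in> \<alpha> ` carr X.A"
    then obtain x where x: "x \<in> carr X.A" "y = \<alpha> x" by blast
    have "\<alpha> x = \<alpha> (mul X.A (unt X.A) (mul X.A x (unt X.A)))" using x by simp
    also have "\<dots> = mul Z.A ?p (mul Z.A (\<alpha> x) ?p)" using x(1) by (simp only: \<alpha>2 X.crossed.unt_closed X.crossed.mul_closed)
    finally show "y \<in> {mul Z.A ?p (mul Z.A b ?p) | b. b \<in> carr Z.A}" using x \<alpha>c(1) by blast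
  next
    fix y assume "y \<in> {mul Z.A ?p (mul Z.A b ?p) | b. b \<in> carr Z.A}"
    then obtain b where b: "b \<in> carr Z.A" "y = mul Z.A ?p (mul Z.A b ?p)" by blast
    obtain s where s: "Z.env.cauchy s" "b = Z.env.cl s" using b(1) by (rule Z.crossed_cases)
    have sc: "s n \<in> carr Z.S" for n by (rule Z.env.cauchyD[OF s(1)])
    \<comment> \<open>The approximants of \<open>b\<close>, cut down to the corner, have preimages
      under \<open>transfer\<close>. These form a Cauchy sequence by isometry, and its limit is
      mapped to \<open>y\<close>.\<close>
    obtain a where a: "\<And>n. a n \<in> carr X.S" "\<And>n. transfer (a n) = mul Z.S proj_Y (mul Z.S (s n) proj_Y)"
      using transfer_onto_corner[OF sc] by metis
    have tc: "Z.env.cauchy (\<lambda>n. transfer (a n))"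
      unfolding a(2) using s(1) pS by simp
    have y: "y = Z.env.cl (\<lambda>n. transfer (a n))"
      unfolding b(2) p s(2) Z.crossed_product_completion Z.emb_cls a(2) using s(1) pS by simp
    have sub: "transfer (sub X.S (a m) (a n)) = sub Z.S (transfer (a m)) (transfer (a n))" for m n
      by (simp add: transfer_linear)
    have ac: "X.env.cauchy a"
      using tc a(1) unfolding cauchy_seq_def sub[symmetric]
      by (simp add: universal_seminorm_transfer)
    let ?x = "X.env.cl a"
    have xc: "?x \<in> carr X.A" using ac by (simp add: X.crossed_product_completion)
    have "\<alpha> ?x = y"
    proof (rule Z.nrm_minus_tendsto_unique)
      show "\<alpha> ?x \<in> carr Z.A" using xc by (rule \<alpha>c)
      show "y \<in> carr Z.A" using b pc by simp
      show "Z.emb (transfer (a n)) \<in> carr Z.A" for n by (intro Z.emb_simps transfer_carr a)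
      show "(\<lambda>n. nrm Z.A (sub Z.A (Z.emb (transfer (a n))) y)) \<longlonglongrightarrow> 0"
        unfolding y by (rule Z.emb_tendsto_cls[OF tc])
      have "nrm Z.A (sub Z.A (Z.emb (transfer (a n))) (\<alpha> ?x)) = nrm X.A (sub X.A (X.emb (a n)) ?x)" for n
        using iso[of "sub X.A (X.emb (a n)) ?x"] X.emb_simps(1)[OF a(1)[of n]] xc
          star_hom_sub[OF X.crossed.star_algebra_axioms \<alpha>, of "X.emb (a n)" ?x] emb[OF a(1)[of n]] by simp
      then show "(\<lambda>n. nrm Z.A (sub Z.A (Z.emb (transfer (a n))) (\<alpha> ?x))) \<longlonglongrightarrow> 0"
        using X.emb_tendsto_cls[OF ac] by simp
    qed
    then show "y \<in> \<alpha> ` carr X.A" using xc by blast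
  qed
  moreover have "\<alpha> ` function_subalgebra \<phi> \<subseteq> function_subalgebra \<psi>"
  proof
    fix y assume "y \<in> \<alpha> ` function_subalgebra \<phi>"
    then obtain f where f: "continuous_on UNIV f" "y = \<alpha> (X.emb (single 0 f))"
      unfolding function_subalgebra_def function_elem_def by blast
    let ?g = "\<lambda>z. if z \<in> Y then f (theta_inv z) else 0"
    have "continuous_on Y (\<lambda>z. f (theta_inv z))"
      by (rule continuous_on_compose2[OF f(1) inv_theta_cont]) simp
    then have "continuous_on UNIV ?g" by (rule Z.continuous_indicator[OF open_Y closed_Y, THEN iffD2])
    moreover have "y = Z.emb (single 0 ?g)" using f by (simp add: emb transfer_single_0)
    ultimately show "y \<in> function_subalgebra \<psi>" unfolding function_subalgebra_def function_elem_def by blast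
  qed
  ultimately show ?thesis using \<alpha> inj unfolding star_monomorphism_def by blast
qed

end


section \<open>From corner embeddings to orbit injections\<close>

context zd_system begin

abbreviation "fe \<equiv> function_elem \<phi>"

lemma fe_emb: "fe f = emb (single 0 f)"
  by (simp add: function_elem_def)

lemma fe_carr: "continuous_on UNIV f \<Longrightarrow> fe f \<in> carr A"
  unfolding fe_emb by (intro emb_simps single_carr)

lemma fe_add: "\<lbrakk>continuous_on UNIV f; continuous_on UNIV g\<rbrakk> \<Longrightarrow> add A (fe f) (fe g) = fe (\<lambda>x. f x + g x)"
  and fe_mul: "\<lbrakk>continuous_on UNIV f; continuous_on UNIV g\<rbrakk> \<Longrightarrow> mul A (fe f) (fe g) = fe (\<lambda>x. f x * g x)"
  and fe_smul: "continuous_on UNIV f \<Longrightarrow> smul A c (fe f) = fe (\<lambda>x. c * f x)"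
  unfolding fe_emb by (simp_all add: single_add single_smul single_single flip: emb_simps)

lemma fe_one: "fe (\<lambda>x. 1) = unt A"
  using emb_unt by (simp add: fe_emb skew_simps)

lemma coef_fe: "continuous_on UNIV f \<Longrightarrow> coef (fe f) w x = (if w = 0 then f x else 0)"
  unfolding fe_emb by (simp add: coef_emb) (simp add: single_def)

lemma coef_fe_mul:
  "\<lbrakk>continuous_on UNIV f; X \<in> carr A\<rbrakk> \<Longrightarrow> coef (mul A (fe f) X) w x = f x * coef X w x"
  unfolding fe_emb by (simp add: coef_single_mul)

lemma coef_mul_fe:
  "\<lbrakk>continuous_on UNIV f; X \<in> carr A\<rbrakk> \<Longrightarrow> coef (mul A X (fe f)) w x = coef X w x * f (\<phi> (- w) x)"
  unfolding fe_emb by (simp add: coef_mul_single)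

end

section \<open>The homeomorphism dual to the embedding\<close>

locale diagonal_corner_embedding =
  X: free_cantor_zd_system \<phi> + Z: free_cantor_zd_system \<psi>
  for \<phi> :: "int ^ 'd \<Rightarrow> 'x::topological_space \<Rightarrow> 'x"
    and \<psi> :: "int ^ 'd \<Rightarrow> 'z::topological_space \<Rightarrow> 'z" +
  fixes \<alpha>
  assumes mono: "star_monomorphism X.A Z.A \<alpha>"
    and diagonal: "\<alpha> ` function_subalgebra \<phi> \<subseteq> function_subalgebra \<psi>"
    and corner: "\<alpha> ` carr X.A = {mul Z.A (\<alpha> (unt X.A)) (mul Z.A b (\<alpha> (unt X.A))) | b. b \<in> carr Z.A}"
begin

lemma \<alpha>_simps:
  "x \<in> carr X.A \<Longrightarrow> \<alpha> x \<in> carr Z.A"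
  "\<lbrakk>x \<in> carr X.A; y \<in> carr X.A\<rbrakk> \<Longrightarrow> \<alpha> (add X.A x y) = add Z.A (\<alpha> x) (\<alpha> y)"
  "x \<in> carr X.A \<Longrightarrow> \<alpha> (smul X.A c x) = smul Z.A c (\<alpha> x)"
  "\<lbrakk>x \<in> carr X.A; y \<in> carr X.A\<rbrakk> \<Longrightarrow> \<alpha> (mul X.A x y) = mul Z.A (\<alpha> x) (\<alpha> y)"
  "x \<in> carr X.A \<Longrightarrow> \<alpha> (adj X.A x) = adj Z.A (\<alpha> x)"
  using mono by (simp_all add: star_monomorphism_def star_hom_def)

lemma \<alpha>_inject: "\<lbrakk>\<alpha> x = \<alpha> y; x \<in> carr X.A; y \<in> carr X.A\<rbrakk> \<Longrightarrow> x = y"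
  using mono unfolding star_monomorphism_def inj_on_def by blast

text \<open>The restriction of \<alpha> to C(X) as a map into C(Z): an element of the function
  subalgebra is recovered from its coefficient at 0.\<close>

definition T :: "('x \<Rightarrow> complex) \<Rightarrow> 'z \<Rightarrow> complex" where "T f = Z.coef (\<alpha> (X.fe f)) 0"

lemma T_cont [simp]: "continuous_on UNIV f \<Longrightarrow> continuous_on UNIV (T f)"
  unfolding T_def by (intro Z.coef_continuous \<alpha>_simps X.fe_carr)

lemma \<alpha>_fe: assumes f: "continuous_on UNIV f" shows "\<alpha> (X.fe f) = Z.fe (T f)"
proof -
  have "X.fe f \<in> function_subalgebra \<phi>" using f by (auto simp: function_subalgebra_def)
  then have "\<alpha> (X.fe f) \<in> function_subalgebra \<psi>" using diagonal by blast
  then obtain g where g: "continuous_on UNIV g" "\<alpha> (X.fe f) = Z.fe g" by (auto simp: function_subalgebra_def)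
  have "T f = g" by (rule ext) (simp add: T_def g Z.coef_fe)
  then show ?thesis using g by simp
qed

lemma T_eqI: "\<lbrakk>\<alpha> (X.fe f) = Z.fe g; continuous_on UNIV g\<rbrakk> \<Longrightarrow> T f = g"
  by (rule ext) (simp add: T_def Z.coef_fe)

lemma T_add: "\<lbrakk>continuous_on UNIV f; continuous_on UNIV g\<rbrakk> \<Longrightarrow> T (\<lambda>x. f x + g x) z = T f z + T g z"
  by (subst T_eqI[of _ "\<lambda>z. T f z + T g z"])
    (simp_all add: \<alpha>_simps X.fe_carr \<alpha>_fe Z.fe_add continuous_on_add flip: X.fe_add)

lemma T_mul: "\<lbrakk>continuous_on UNIV f; continuous_on UNIV g\<rbrakk> \<Longrightarrow> T (\<lambda>x. f x * g x) z = T f z * T g z"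
  by (subst T_eqI[of _ "\<lambda>z. T f z * T g z"])
    (simp_all add: \<alpha>_simps X.fe_carr \<alpha>_fe Z.fe_mul continuous_on_mult flip: X.fe_mul)

lemma T_smul: "continuous_on UNIV f \<Longrightarrow> T (\<lambda>x. c * f x) z = c * T f z"
  by (subst T_eqI[of _ "\<lambda>z. c * T f z"])
    (simp_all add: \<alpha>_simps X.fe_carr \<alpha>_fe Z.fe_smul continuous_on_mult_left flip: X.fe_smul)

definition P :: "'z \<Rightarrow> complex" where "P = T (\<lambda>x. 1)"
definition Y :: "'z set" where "Y = {z. P z \<noteq> 0}"

lemma P_cont [simp]: "continuous_on UNIV P"
  by (simp add: P_def)

lemma \<alpha>_unt: "\<alpha> (unt X.A) = Z.fe P"
  using \<alpha>_fe[of "\<lambda>x. 1"] by (simp add: X.fe_one P_def)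

lemma P_T: "continuous_on UNIV f \<Longrightarrow> P z * T f z = T f z"
  using T_mul[of "\<lambda>x. 1" f z] by (simp add: P_def)

text \<open>As the image of 1, \<open>P\<close> is idempotent.\<close>

lemma P_Y: "P z = (if z \<in> Y then 1 else 0)"
  using P_T[of "\<lambda>x. 1" z] by (auto simp: Y_def P_def)

lemma open_Y: "open Y"
proof -
  have "open (P -` (- {0}))" by (intro open_vimage open_Compl) simp_all
  then show ?thesis by (simp add: Y_def vimage_def)
qed

lemma closed_Y: "closed Y"
proof -
  have "closed (P -` {1})" by (intro closed_vimage) simp_all
  moreover have "P -` {1} = Y" by (auto simp: P_Y split: if_splits)
  ultimately show ?thesis by simp
qed

lemma T_outside: "\<lbrakk>continuous_on UNIV f; z \<notin> Y\<rbrakk> \<Longrightarrow> T f z = 0"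
  using P_T[of f z] by (simp add: P_Y)

text \<open>A character of \<open>C(X)\<close> is the evaluation at a point: otherwise its kernel contains, by
  compactness, a sum of squares without zeros.\<close>

lemma character_evaluation:
  assumes z: "z \<in> Y"
  shows "\<exists>x. \<forall>f. continuous_on UNIV f \<longrightarrow> T f z = f x"
proof (rule ccontr)
  assume "\<not> ?thesis"
  then obtain f where f: "\<And>x. continuous_on UNIV (f x)" "\<And>x. T (f x) z \<noteq> f x x" by metis
  \<comment> \<open>The function \<open>g x\<close> lies in the kernel of the character at
    \<open>z\<close>, where \<open>T\<close> maps 1 to 1, and does not vanish at
    \<open>x\<close>.\<close>
  define g where "g x y = f x y + (- T (f x) z) * 1" for x y
  have gc: "continuous_on UNIV (g x)" for x unfolding g_def by (intro continuous_intros f)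
  have Tg: "T (g x) z = 0" for x
    unfolding g_def using T_smul[of "\<lambda>x. 1" "- T (f x) z" z] f z
    by (subst T_add) (simp_all add: P_Y flip: P_def)
  define U where "U x = {y. g x y \<noteq> 0}" for x
  have U: "open (U x)" "x \<in> U x" for x
  proof -
    have "open (g x -` (- {0}))" by (intro open_vimage gc open_Compl) simp
    then show "open (U x)" by (simp add: U_def vimage_def)
    show "x \<in> U x" using f(2)[of x] by (simp add: U_def g_def)
  qed
  obtain I where I: "finite I" "UNIV \<subseteq> (\<Union>x\<in>I. U x)"
    by (rule compactE_image[OF X.compact_space, of UNIV U]) (use U in auto)
  define h where "h J y = (\<Sum>x\<in>J. g x y * cnj (g x y))" for J y
  have hc: "continuous_on UNIV (h J)" for J unfolding h_def by (intro continuous_intros gc)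
  have T0: "T (\<lambda>x. 0) z = 0" using T_smul[of "\<lambda>x. 1" 0 z] by simp
  have Th: "T (h J) z = 0" if "finite J" for J
    using that
  proof (induction J rule: finite_induct)
    case empty
    then show ?case using T0 by (simp add: h_def)
  next
    case (insert x J)
    have "h (insert x J) = (\<lambda>y. g x y * cnj (g x y) + h J y)" using insert by (simp add: h_def fun_eq_iff)
    moreover have "continuous_on UNIV (\<lambda>y. g x y * cnj (g x y))" "continuous_on UNIV (\<lambda>y. cnj (g x y))"
      by (intro continuous_intros gc)+
    ultimately show ?case using insert hc gc by (simp add: T_add T_mul Tg)
  qed
  have "h I y \<noteq> 0" for y
  proof
    assume "h I y = 0"
    moreover have "h I y = of_real (\<Sum>x\<in>I. (norm (g x y))\<^sup>2)"
      unfolding h_def of_real_sum complex_norm_square ..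
    ultimately have "(\<Sum>x\<in>I. (norm (g x y))\<^sup>2) = 0" using of_real_eq_0_iff by metis
    then have "\<forall>x\<in>I. g x y = 0" using I(1) by (simp add: sum_nonneg_eq_0_iff)
    moreover have "y \<in> (\<Union>x\<in>I. U x)" using I(2) by blast
    ultimately show False by (auto simp: U_def)
  qed
  then have "continuous_on UNIV (\<lambda>y. inverse (h I y))" and e: "(\<lambda>y. h I y * inverse (h I y)) = (\<lambda>y. 1)"
    using hc by (auto intro!: continuous_on_inverse)
  \<comment> \<open>The kernel contains the invertible function \<open>h I\<close>, which would
    force \<open>P z = 0\<close>.\<close>
  then have "P z = T (h I) z * T (\<lambda>y. inverse (h I y)) z"
    using T_mul[OF hc, of "\<lambda>y. inverse (h I y)" I z] by (simp add: P_def)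
  then show False using Th[OF I(1)] z by (simp add: P_Y)
qed

text \<open>On \<open>Y\<close> the map \<open>T\<close> is composition with \<open>\<tau>\<close>.
  Outside \<open>Y\<close> all \<open>T f\<close> vanish and the value of \<open>\<tau>\<close> is
  arbitrary.\<close>

definition \<tau> :: "'z \<Rightarrow> 'x" where "\<tau> z = (SOME x. \<forall>f. continuous_on UNIV f \<longrightarrow> T f z = f x)"

lemma T_tau: "\<lbrakk>z \<in> Y; continuous_on UNIV f\<rbrakk> \<Longrightarrow> T f z = f (\<tau> z)"
  using someI_ex[OF character_evaluation] unfolding \<tau>_def by blast

text \<open>\<open>C(X)\<close> is a maximal abelian subalgebra since the action is free.\<close>

lemma T_onto:
  assumes g: "continuous_on UNIV g" and supp: "\<And>z. z \<notin> Y \<Longrightarrow> g z = 0"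
  shows "\<exists>f. continuous_on UNIV f \<and> T f = g"
proof -
  have e: "(\<lambda>z. P z * (g z * P z)) = g" using supp by (auto simp: P_Y fun_eq_iff)
  have "mul Z.A (\<alpha> (unt X.A)) (mul Z.A (Z.fe g) (\<alpha> (unt X.A))) = Z.fe g"
    unfolding \<alpha>_unt using g by (simp add: Z.fe_mul continuous_on_mult e)
  then have "Z.fe g \<in> \<alpha> ` carr X.A" unfolding corner using Z.fe_carr[OF g] by force
  then obtain a where a: "a \<in> carr X.A" "\<alpha> a = Z.fe g" by auto
  have comm: "mul X.A (X.fe f) a = mul X.A a (X.fe f)" if f: "continuous_on UNIV f" for f
  proof (rule \<alpha>_inject)
    show "\<alpha> (mul X.A (X.fe f) a) = \<alpha> (mul X.A a (X.fe f))"
      using a f g by (simp add: \<alpha>_simps X.fe_carr \<alpha>_fe Z.fe_mul mult.commute)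
  qed (use a f X.fe_carr in simp_all)
  \<comment> \<open>Where the coefficient at \<open>w\<close> is nonzero, commutation with C(X)
    shows that no function distinguishes \<open>\<phi> (- w) x\<close> from \<open>x\<close>;
    freeness gives \<open>w = 0\<close>.\<close>
  have zero: "X.coef a w x = 0" if "w \<noteq> 0" for w x
  proof (rule ccontr)
    assume nz: "X.coef a w x \<noteq> 0"
    have "f (\<phi> (- w) x) = f x" if f: "continuous_on UNIV f" for f :: "'x \<Rightarrow> complex"
      using X.coef_fe_mul[OF f a(1), of w x] X.coef_mul_fe[OF f a(1), of w x] comm[OF f] nz by simp
    then have "\<phi> (- w) x = \<phi> 0 x" using X.continuous_separation[of "\<phi> (- w) x" x] by simp
    then show False using that by (simp only: X.phi_eq_iff) simp
  qed
  have c0: "continuous_on UNIV (X.coef a 0)" by (rule X.coef_continuous[OF a(1)])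
  have "a = X.fe (X.coef a 0)"
    using a(1) zero c0 by (intro X.coef_inject X.fe_carr) (auto simp: X.coef_fe)
  then have "T (X.coef a 0) = g" using a(2) g by (intro T_eqI) simp_all
  then show ?thesis using c0 by blast
qed

text \<open>By \<open>T_onto\<close> every continuous function supported in \<open>Y\<close> factors
  through \<open>\<tau>\<close>, and these functions separate the points of
  \<open>Y\<close>.\<close>

lemma tau_inj: "inj_on \<tau> Y"
proof (rule inj_onI)
  fix z z' assume z: "z \<in> Y" "z' \<in> Y" "\<tau> z = \<tau> z'"
  show "z = z'"
  proof (rule Z.continuous_separation)
    fix g :: "'z \<Rightarrow> complex" assume g: "continuous_on UNIV g"
    have "continuous_on UNIV (\<lambda>z. P z * g z)" using g by (intro continuous_on_mult P_cont)
    then obtain f where f: "continuous_on UNIV f" "T f = (\<lambda>z. P z * g z)"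
      using T_onto[of "\<lambda>z. P z * g z"] by (auto simp: P_Y)
    then have "P z * g z = P z' * g z'" using T_tau[OF z(1) f(1)] T_tau[OF z(2) f(1)] z(3) by simp
    then show "g z = g z'" using z by (simp add: P_Y)
  qed
qed

text \<open>For a clopen \<open>C\<close> inside \<open>B\<close>, the image under \<open>T\<close>
  of its indicator is continuous and is nonzero exactly at the points of \<open>Y\<close> that
  \<open>\<tau>\<close> maps into \<open>C\<close>.\<close>

lemma tau_open_vimage: assumes B: "open B" shows "open (\<tau> -` B \<inter> Y)"
  unfolding open_subopen[of "\<tau> -` B \<inter> Y"]
proof
  fix z assume z: "z \<in> \<tau> -` B \<inter> Y"
  have "compact (UNIV \<inter> - B)" using X.compact_space B by (intro compact_Int_closed closed_Compl)
  then obtain C where C: "open C" "closed C" "\<tau> z \<in> C" "C \<inter> - B = {}"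
    using X.clopen_separation_compact[of "- B" "\<tau> z"] z by auto
  let ?f = "\<lambda>x. if x \<in> C then 1 else 0 :: complex"
  have f: "continuous_on UNIV ?f" using X.continuous_indicator[OF C(1,2), of "\<lambda>_. 1"] by simp
  let ?V = "T ?f -` (- {0}) \<inter> Y"
  have "open ?V" using f open_Y by (intro open_Int open_vimage open_Compl) simp_all
  moreover have "z \<in> ?V" using z C(3) by (simp add: T_tau f)
  moreover have "?V \<subseteq> \<tau> -` B \<inter> Y"
  proof
    fix y assume y: "y \<in> ?V"
    then have "\<tau> y \<in> C" using T_tau[OF _ f, of y] by (auto split: if_splits)
    then show "y \<in> \<tau> -` B \<inter> Y" using y C(4) by auto
  qed
  ultimately show "\<exists>V. open V \<and> z \<in> V \<and> V \<subseteq> \<tau> -` B \<inter> Y" by blast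
qed

lemma tau_cont: "continuous_on Y \<tau>"
  using tau_open_vimage by (simp add: continuous_on_open_vimage[OF open_Y])

lemma compact_tau_image: assumes "closed C" shows "compact (\<tau> ` (C \<inter> Y))"
proof -
  have "compact (UNIV \<inter> (C \<inter> Y))"
    using assms closed_Y Z.compact_space by (intro compact_Int_closed closed_Int)
  then have "compact (C \<inter> Y)" by simp
  then show ?thesis by (intro compact_continuous_image continuous_on_subset[OF tau_cont]) simp_all
qed

text \<open>A point missed by the compact image has a clopen neighbourhood disjoint from it.
  \<open>T\<close> would kill the indicator of this neighbourhood, against injectivity of
  \<alpha>.\<close>

lemma tau_onto: "\<tau> ` Y = UNIV"
proof (rule ccontr)
  assume "\<tau> ` Y \<noteq> UNIV"
  then obtain x where x: "x \<notin> \<tau> ` Y" by blast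
  have "compact (\<tau> ` Y)" using compact_tau_image[of UNIV] by simp
  then obtain C where C: "open C" "closed C" "x \<in> C" "C \<inter> \<tau> ` Y = {}"
    using X.clopen_separation_compact[OF _ x] by blast
  let ?f = "\<lambda>x. if x \<in> C then 1 else 0 :: complex"
  have f: "continuous_on UNIV ?f" using X.continuous_indicator[OF C(1,2), of "\<lambda>_. 1"] by simp
  have T0: "T ?f z = 0" for z
    using C(4) f T_outside[OF f, of z] T_tau[OF _ f, of z] by (cases "z \<in> Y") auto
  have T00: "T (\<lambda>x. 0) z = 0" for z using T_smul[of "\<lambda>x. 1" 0 z] by simp
  have "T ?f = T (\<lambda>x. 0)" using T0 T00 by auto
  then have "X.fe ?f = X.fe (\<lambda>x. 0)"
    using f X.fe_carr by (intro \<alpha>_inject) (simp_all add: \<alpha>_fe)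
  then have "X.coef (X.fe ?f) 0 x = X.coef (X.fe (\<lambda>x. 0)) 0 x" by simp
  then show False using f C(3) by (simp add: X.coef_fe)
qed

definition \<theta> :: "'x \<Rightarrow> 'z" where "\<theta> = inv_into Y \<tau>"

lemma theta_Y [simp]: "\<theta> x \<in> Y"
  unfolding \<theta>_def by (intro inv_into_into) (simp add: tau_onto)

lemma tau_theta [simp]: "\<tau> (\<theta> x) = x"
  unfolding \<theta>_def by (intro f_inv_into_f) (simp add: tau_onto)

lemma theta_tau: "z \<in> Y \<Longrightarrow> \<theta> (\<tau> z) = z"
  unfolding \<theta>_def by (rule inv_into_f_f[OF tau_inj])

lemma T_theta: "continuous_on UNIV f \<Longrightarrow> T f (\<theta> x) = f x"
  by (simp add: T_tau)

lemma theta_inj: "inj \<theta>"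
  by (metis injI tau_theta)

lemma theta_open: assumes "open U" shows "open (\<theta> ` U)"
proof -
  have "\<theta> ` U = \<tau> -` U \<inter> Y"
  proof (intro equalityI subsetI)
    fix z assume "z \<in> \<tau> -` U \<inter> Y"
    then show "z \<in> \<theta> ` U" using theta_tau[of z] by (intro image_eqI[of _ _ "\<tau> z"]) simp_all
  qed auto
  then show ?thesis using tau_open_vimage[OF assms] by simp
qed

text \<open>The preimage of a closed set under \<open>\<theta>\<close> is an image under
  \<open>\<tau>\<close> of a compact set, hence closed.\<close>

lemma theta_cont: "continuous_on UNIV \<theta>"
  unfolding continuous_on_closed_vimage[OF closed_UNIV]
proof (intro allI impI)
  fix C :: "'z set" assume C: "closed C"
  have "\<theta> -` C \<inter> UNIV = \<tau> ` (C \<inter> Y)"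
  proof (intro equalityI subsetI)
    fix x assume "x \<in> \<theta> -` C \<inter> UNIV"
    then show "x \<in> \<tau> ` (C \<inter> Y)" by (intro image_eqI[of _ _ "\<theta> x"]) simp_all
  qed (auto simp: theta_tau)
  then show "closed (\<theta> -` C \<inter> UNIV)" using X.compact_closed[OF compact_tau_image[OF C]] by simp
qed

section \<open>Images of the unitaries and the orbit relation\<close>

definition U :: "int ^ 'd \<Rightarrow> (nat \<Rightarrow> int ^ 'd \<Rightarrow> 'z \<Rightarrow> complex) set" where
  "U w = \<alpha> (X.emb (single w (\<lambda>x. 1)))"

lemma U_carr: "U w \<in> carr Z.A"
  unfolding U_def by (intro \<alpha>_simps X.emb_simps X.single_carr) simp

text \<open>\<alpha> carries over the covariance relation. Comparing coefficients at
  \<open>v\<close> and cancelling the nonzero one shows that \<open>T f\<close> at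
  \<open>\<psi> (- v) z\<close> equals \<open>f\<close> at \<open>\<phi> (- w) (\<tau> z)\<close>;
  taking \<open>f\<close> as 1 places the point in \<open>Y\<close>.\<close>

lemma U_coef_nonzero:
  assumes z: "z \<in> Y" and nz: "Z.coef (U w) v z \<noteq> 0"
  shows "\<psi> (- v) z \<in> Y" "\<tau> (\<psi> (- v) z) = \<phi> (- w) (\<tau> z)"
proof -
  let ?u = "X.emb (single w (\<lambda>x. 1))"
  have key: "T f (\<psi> (- v) z) = f (\<phi> (- w) (\<tau> z))" if f: "continuous_on UNIV f" for f
  proof -
    have f': "continuous_on UNIV (\<lambda>x. f (\<phi> (- w) x))" by (rule X.cont_phi[OF f])
    have "mul X.A ?u (X.fe f) = mul X.A (X.fe (\<lambda>x. f (\<phi> (- w) x))) ?u"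
      using f f' unfolding X.fe_emb by (simp add: X.single_single flip: X.emb_simps)
    then have "\<alpha> (mul X.A ?u (X.fe f)) = \<alpha> (mul X.A (X.fe (\<lambda>x. f (\<phi> (- w) x))) ?u)"
      by simp
    then have "mul Z.A (U w) (Z.fe (T f)) = mul Z.A (Z.fe (T (\<lambda>x. f (\<phi> (- w) x)))) (U w)"
      using f f' by (simp add: \<alpha>_simps X.emb_simps X.fe_carr \<alpha>_fe U_def)
    then have "Z.coef (U w) v z * T f (\<psi> (- v) z) = T (\<lambda>x. f (\<phi> (- w) x)) z * Z.coef (U w) v z"
      using Z.coef_mul_fe[OF T_cont[OF f] U_carr] Z.coef_fe_mul[OF T_cont[OF f'] U_carr] by metis
    then show ?thesis using nz T_tau[OF z f'] by simp
  qed
  from key[of "\<lambda>x. 1"] show Y: "\<psi> (- v) z \<in> Y" by (simp add: Y_def P_def)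
  show "\<tau> (\<psi> (- v) z) = \<phi> (- w) (\<tau> z)"
    by (rule X.continuous_separation) (use key T_tau[OF Y] in simp)
qed

text \<open>Otherwise all coefficients of \<open>U w\<close> times its adjoint would vanish at
  \<open>z\<close>, but this product is \<open>Z.fe P\<close>.\<close>

lemma U_coef_ex: assumes z: "z \<in> Y" shows "\<exists>v. Z.coef (U w) v z \<noteq> 0"
proof (rule ccontr)
  assume "\<not> ?thesis"
  then have "\<And>v. Z.coef (U w) v z = 0" by blast
  then have "Z.coef (mul Z.A (U w) (adj Z.A (U w))) 0 z = 0"
    using U_carr by (intro Z.coef_mul_zero) simp_all
  moreover let ?u = "X.emb (single w (\<lambda>x. 1))"
  have "mul X.A ?u (adj X.A ?u) = unt X.A"
    by (simp add: X.single_adj X.single_single X.emb_unt[symmetric] X.skew_simps(2) flip: X.emb_simps)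
  then have "\<alpha> (mul X.A ?u (adj X.A ?u)) = Z.fe P" using \<alpha>_unt by simp
  then have "mul Z.A (U w) (adj Z.A (U w)) = Z.fe P"
    by (simp add: \<alpha>_simps X.emb_simps U_def)
  ultimately show False using z Z.coef_fe[OF P_cont, of 0 z] by (simp add: P_Y)
qed

text \<open>At each point of \<open>Y\<close> exactly one coefficient of \<open>U w\<close> is
  nonzero: existence is \<open>U_coef_ex\<close>, and freeness of \<open>\<psi>\<close> gives
  uniqueness. Its index is the value of the cocycle.\<close>

lemma U_coef_iff: "Z.coef (U w) v (\<theta> (\<phi> w x)) \<noteq> 0 \<longleftrightarrow> \<psi> v (\<theta> x) = \<theta> (\<phi> w x)"
proof -
  let ?z = "\<theta> (\<phi> w x)"
  have imp: "\<psi> v (\<theta> x) = ?z" if "Z.coef (U w) v ?z \<noteq> 0" for v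
  proof -
    have "\<psi> (- v) ?z \<in> Y" "\<tau> (\<psi> (- v) ?z) = x"
      using U_coef_nonzero[OF theta_Y that] by simp_all
    then have "\<theta> x = \<psi> (- v) ?z" using theta_tau by metis
    then show ?thesis by simp
  qed
  obtain v' where v': "Z.coef (U w) v' ?z \<noteq> 0" using U_coef_ex[OF theta_Y] by blast
  then show ?thesis using imp Z.phi_eq_iff by metis
qed

lemma orbit_forward: "\<exists>v. \<psi> v (\<theta> x) = \<theta> (\<phi> w x)"
  using U_coef_ex[OF theta_Y] U_coef_iff by metis

text \<open>This is where \<alpha> has to fill the corner. The unitary of \<open>v\<close>, cut down
  by \<open>P\<close> on both sides, has a preimage \<open>a\<close>. It intertwines functions as
  the unitaries do, so a nonzero coefficient of \<open>a\<close> at \<open>y\<close> leads back to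
  \<open>x\<close>.\<close>

lemma orbit_backward: assumes v: "\<psi> v (\<theta> x) = \<theta> y" shows "\<exists>w. \<phi> w x = y"
proof -
  \<comment> \<open>The indicator of the points of \<open>Y\<close> that \<open>\<psi> (- v)\<close>
    keeps in \<open>Y\<close>; it is the coefficient at \<open>v\<close> of the cut down
    unitary.\<close>
  define h where "h z = P z * P (\<psi> (- v) z)" for z
  have P'c: "continuous_on UNIV (\<lambda>z. P (\<psi> (- v) z))" by (rule Z.cont_phi[OF P_cont])
  have hc: "continuous_on UNIV h" unfolding h_def by (intro continuous_on_mult P_cont P'c)
  have hy: "h (\<theta> y) = 1" unfolding h_def using v[symmetric] by (simp add: P_Y) (simp add: v)
  let ?b = "Z.emb (single v h)"
  have "mul Z.A (\<alpha> (unt X.A)) (mul Z.A (Z.emb (single v (\<lambda>z. 1))) (\<alpha> (unt X.A))) = ?b"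
    unfolding \<alpha>_unt Z.fe_emb h_def using P'c
    by (simp add: Z.single_single flip: Z.emb_simps)
  moreover have "Z.emb (single v (\<lambda>z. 1)) \<in> carr Z.A" by (intro Z.emb_simps Z.single_carr) simp
  ultimately have "?b \<in> \<alpha> ` carr X.A" unfolding corner by force
  then obtain a where a: "a \<in> carr X.A" "\<alpha> a = ?b" by auto
  have key: "X.coef a w y * f (\<phi> (- w) y) = f x * X.coef a w y" if f: "continuous_on UNIV f" for f w
  proof -
    \<comment> \<open>Moving \<open>T f\<close> past \<open>?b\<close> turns it into this function.
      It is supported in \<open>Y\<close>, hence in the range of \<open>T\<close>.\<close>
    define g where "g z = P z * T f (\<psi> (- v) z)" for z
    have T'c: "continuous_on UNIV (\<lambda>z. T f (\<psi> (- v) z))" by (rule Z.cont_phi[OF T_cont[OF f]])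
    have gc: "continuous_on UNIV g" unfolding g_def by (intro continuous_on_mult P_cont T'c)
    obtain f' where f': "continuous_on UNIV f'" "T f' = g"
      using T_onto[OF gc] by (auto simp: g_def P_Y)
    have "f' y = g (\<theta> y)" using T_theta[OF f'(1)] f'(2) by simp
    also have "\<dots> = T f (\<psi> (- v) (\<psi> v (\<theta> x)))" unfolding g_def v by (simp add: P_Y)
    also have "\<dots> = f x" by (simp add: T_theta f)
    finally have f'y: "f' y = f x" .
    have "(\<lambda>z. h z * T f (\<psi> (- v) z)) = (\<lambda>z. g z * h z)"
      by (auto simp: h_def g_def P_Y)
    then have "mul Z.A ?b (Z.fe (T f)) = mul Z.A (Z.fe g) ?b"
      unfolding Z.fe_emb using hc gc f by (simp add: Z.single_single flip: Z.emb_simps)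
    then have "mul X.A a (X.fe f) = mul X.A (X.fe f') a"
      using a f f' X.fe_carr by (intro \<alpha>_inject) (simp_all add: \<alpha>_simps \<alpha>_fe)
    then show ?thesis
      using X.coef_mul_fe[OF f a(1), of w y] X.coef_fe_mul[OF f'(1) a(1), of w y] f'y by metis
  qed
  \<comment> \<open>Otherwise \<open>a\<close> times its adjoint would vanish at \<open>y\<close>,
    but \<alpha> maps it to the squared modulus of \<open>h\<close>, which is 1 at
    \<open>\<theta> y\<close>.\<close>
  have "\<exists>w. X.coef a w y \<noteq> 0"
  proof (rule ccontr)
    assume "\<not> ?thesis"
    then have "\<And>w. X.coef a w y = 0" by blast
    then have zero: "X.coef (mul X.A a (adj X.A a)) 0 y = 0"
      using a(1) by (intro X.coef_mul_zero) simp_all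
    define k where "k z = h z * cnj (h z)" for z
    have kc: "continuous_on UNIV k" unfolding k_def by (intro continuous_on_mult continuous_on_cnj hc)
    obtain k' where k': "continuous_on UNIV k'" "T k' = k"
      using T_onto[OF kc] by (auto simp: k_def h_def P_Y)
    have "mul Z.A ?b (adj Z.A ?b) = Z.fe k"
      unfolding Z.fe_emb k_def using hc
      by (simp add: Z.single_adj Z.single_single continuous_on_cnj Z.cont_phi flip: Z.emb_simps)
    then have "mul X.A a (adj X.A a) = X.fe k'"
      using a k' X.fe_carr by (intro \<alpha>_inject) (simp_all add: \<alpha>_simps \<alpha>_fe)
    then have "k' y = 0" using zero k' by (simp add: X.coef_fe)
    then show False using T_theta[OF k'(1), of y] k'(2) hy by (simp add: k_def)
  qed
  then obtain w where w: "X.coef a w y \<noteq> 0" ..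
  have "\<phi> (- w) y = x"
    by (rule X.continuous_separation) (use key[of _ w] w in auto)
  then have "\<phi> w x = y" by auto
  then show ?thesis ..
qed

theorem bounded_orbit_injection_theta: "bounded_orbit_injection \<phi> \<psi> \<theta>"
proof -
  have orbit: "(\<exists>w. \<phi> w x = y) \<longleftrightarrow> (\<exists>v. \<psi> v (\<theta> x) = \<theta> y)" for x y
    using orbit_forward orbit_backward by blast
  have coc: "cocycle \<phi> \<psi> \<theta> (x, w) = v \<longleftrightarrow> \<psi> v (\<theta> x) = \<theta> (\<phi> w x)" for x w v
  proof -
    obtain v' where v': "\<psi> v' (\<theta> x) = \<theta> (\<phi> w x)" using orbit_forward by blast
    have un: "u = v'" if "\<psi> u (\<theta> x) = \<theta> (\<phi> w x)" for u
      using that v' Z.phi_eq_iff[of u "\<theta> x" v'] by simp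
    have "cocycle \<phi> \<psi> \<theta> (x, w) = v'"
      unfolding cocycle_def prod.case by (rule the_equality, rule v', rule un)
    then show ?thesis using v' un by blast
  qed
  have "continuous_on UNIV (cocycle \<phi> \<psi> \<theta>)"
    unfolding continuous_on_open_vimage[OF open_UNIV]
  proof (intro allI impI)
    fix B :: "(int ^ 'd) set"
    \<comment> \<open>The level sets of the cocycle, written as nonvanishing sets of continuous
      coefficients of \<open>U w\<close>; so they are open.\<close>
    define D where "D w v = (\<lambda>x. Z.coef (U w) v (\<theta> (\<phi> w x))) -` (- {0})" for w v
    have D: "x \<in> D w v \<longleftrightarrow> cocycle \<phi> \<psi> \<theta> (x, w) = v" for x w v
      using U_coef_iff coc by (simp add: D_def)
    have "open (D w v)" for w v
    proof -
      have "continuous_on UNIV (\<lambda>x. \<theta> (\<phi> w x))"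
        by (rule continuous_on_compose2[OF theta_cont X.phi_cont]) simp
      then have "continuous_on UNIV (\<lambda>x. Z.coef (U w) v (\<theta> (\<phi> w x)))"
        by (rule continuous_on_compose2[OF Z.coef_continuous[OF U_carr]]) simp
      then show ?thesis unfolding D_def by (intro open_vimage open_Compl) simp_all
    qed
    then have "open (\<Union>w. \<Union>v\<in>B. D w v \<times> {w})"
      by (intro open_UN ballI open_Times) (simp_all add: open_singleton_int_vec)
    moreover have "cocycle \<phi> \<psi> \<theta> -` B \<inter> UNIV = (\<Union>w. \<Union>v\<in>B. D w v \<times> {w})"
      by (auto simp: D)
    ultimately show "open (cocycle \<phi> \<psi> \<theta> -` B \<inter> UNIV)" by simp
  qed
  then show ?thesis
    unfolding bounded_orbit_injection_def orbit_injection_def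
    using theta_cont theta_open theta_inj orbit by blast
qed

end

lemma free_cantor_zd_systemI: "\<lbrakk>cantor_system \<phi>; free_system \<phi>\<rbrakk> \<Longrightarrow> free_cantor_zd_system \<phi>"
  by unfold_locales (simp_all add: cantor_system_def)

theorem theorem2p4:
  fixes \<phi> :: "int ^ 'd \<Rightarrow> 'x::topological_space \<Rightarrow> 'x"
    and \<psi> :: "int ^ 'd \<Rightarrow> 'z::topological_space \<Rightarrow> 'z"
  assumes "cantor_system \<phi>" "free_system \<phi>" "minimal_system \<phi>"
    and "cantor_system \<psi>" "free_system \<psi>" "minimal_system \<psi>"
  shows "(\<exists>\<theta>. bounded_orbit_injection \<phi> \<psi> \<theta>) \<longleftrightarrow>
         (\<exists>\<alpha>. star_monomorphism (crossed_product \<phi>) (crossed_product \<psi>) \<alpha> \<and>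
              \<alpha> ` function_subalgebra \<phi> \<subseteq> function_subalgebra \<psi> \<and>
              (let p = \<alpha> (unt (crossed_product \<phi>))
               in \<alpha> ` carr (crossed_product \<phi>) =
                  {mul (crossed_product \<psi>) p (mul (crossed_product \<psi>) b p) | b.
                     b \<in> carr (crossed_product \<psi>)}))"
  unfolding Let_def
proof
  note sys = free_cantor_zd_systemI[OF assms(1,2)] free_cantor_zd_systemI[OF assms(4,5)]
  assume "\<exists>\<theta>. bounded_orbit_injection \<phi> \<psi> \<theta>"
  then obtain \<theta> where "bounded_orbit_injection \<phi> \<psi> \<theta>" ..
  then interpret bounded_injection \<phi> \<psi> \<theta>
    by (intro bounded_injection.intro sys bounded_injection_axioms.intro)
  show "\<exists>\<alpha>. star_monomorphism (crossed_product \<phi>) (crossed_product \<psi>) \<alpha> \<and>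
    \<alpha> ` function_subalgebra \<phi> \<subseteq> function_subalgebra \<psi> \<and>
    \<alpha> ` carr (crossed_product \<phi>) = {mul (crossed_product \<psi>) (\<alpha> (unt (crossed_product \<phi>)))
      (mul (crossed_product \<psi>) b (\<alpha> (unt (crossed_product \<phi>)))) | b. b \<in> carr (crossed_product \<psi>)}"
    by (rule corner_embedding)
next
  note sys = free_cantor_zd_systemI[OF assms(1,2)] free_cantor_zd_systemI[OF assms(4,5)]
  assume "\<exists>\<alpha>. star_monomorphism (crossed_product \<phi>) (crossed_product \<psi>) \<alpha> \<and>
    \<alpha> ` function_subalgebra \<phi> \<subseteq> function_subalgebra \<psi> \<and>
    \<alpha> ` carr (crossed_product \<phi>) = {mul (crossed_product \<psi>) (\<alpha> (unt (crossed_product \<phi>)))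
      (mul (crossed_product \<psi>) b (\<alpha> (unt (crossed_product \<phi>)))) | b. b \<in> carr (crossed_product \<psi>)}"
  then obtain \<alpha> where "star_monomorphism (crossed_product \<phi>) (crossed_product \<psi>) \<alpha>"
    "\<alpha> ` function_subalgebra \<phi> \<subseteq> function_subalgebra \<psi>"
    "\<alpha> ` carr (crossed_product \<phi>) = {mul (crossed_product \<psi>) (\<alpha> (unt (crossed_product \<phi>)))
      (mul (crossed_product \<psi>) b (\<alpha> (unt (crossed_product \<phi>)))) | b. b \<in> carr (crossed_product \<psi>)}"
    by blast
  then interpret diagonal_corner_embedding \<phi> \<psi> \<alpha>
    by (intro diagonal_corner_embedding.intro sys diagonal_corner_embedding_axioms.intro)
  show "\<exists>\<theta>. bounded_orbit_injection \<phi> \<psi> \<theta>" using bounded_orbit_injection_theta by blast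
qed

end
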